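(* Let $(\xi_l)_{l\ge0}$ be a subordinator with Laplace–Bernstein exponent $\Phi\not\equiv0$, let $\mathcal I=\int_0^\infty e^{-\xi_l}\mathrm dl$ and let $\kappa$ be the measure on $\mathbb R_+$ whose Laplace transform is $\Phi'/\Phi$. Then $\mathcal I$ is multiplicatively infinitely divisible if and only if $\kappa(\mathrm dx)\le\mathrm dx$ (as measures on $\mathbb R_+$). Moreover, if $\mathcal I$ is multiplicatively infinitely divisible, then the Lévy measure of the infinitely divisible variable $\log\mathcal I$ is \[ 1_{(-\infty,0)}(x)\,x^{-1}\,(1-e^{-x})^{-1}\,\bigl(1-k(-x)\bigr)\,\mathrm dx, \] where $k$ denotes the density $\kappa(\mathrm dx)/\mathrm dx$.
   Context: $\Phi$ is defined by $\mathbb E[e^{-s\xi_l}]=e^{-l\Phi(s)}$; $\kappa$ is the measure on $[0,\infty)$ with $\int e^{-sx}\kappa(\mathrm dx)=\Phi'(s)/\Phi(s)$ for $s>0$. A positive random variable $X$ is multiplicatively infinitely divisible if for every integer $n\ge2$ there exist i.i.d. positive random variables $X_1,\dots,X_n$ with $X\overset{\mathrm{law}}{=}X_1\cdots X_n$ (equivalently, for $X>0$, $\log X$ is infinitely divisible). *)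

theory Defs
  imports "HOL-Probability.Probability"
begin

definition subordinator :: "'a measure \<Rightarrow> (real \<Rightarrow> 'a \<Rightarrow> real) \<Rightarrow> bool" where
  "subordinator M \<xi> \<longleftrightarrow>
     prob_space M \<and>
     (\<forall>l. \<xi> l \<in> borel_measurable M) \<and>
     (\<forall>\<omega>\<in>space M. \<xi> 0 \<omega> = 0 \<and> mono_on {0..} (\<lambda>l. \<xi> l \<omega>) \<and>
        (\<forall>l\<ge>0. continuous (at_right l) (\<lambda>t. \<xi> t \<omega>))) \<and>
     (\<forall>s t. 0 \<le> s \<longrightarrow> 0 \<le> t \<longrightarrow>
        distr M borel (\<lambda>\<omega>. \<xi> (t + s) \<omega> - \<xi> t \<omega>) = distr M borel (\<xi> s)) \<and>
     (\<forall>(n::nat) (t::nat \<Rightarrow> real). 0 \<le> t 0 \<and> mono t \<longrightarrow>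
        prob_space.indep_vars M (\<lambda>_. borel) (\<lambda>i \<omega>. \<xi> (t (Suc i)) \<omega> - \<xi> (t i) \<omega>) {..<n})"

text \<open>Laplace exponent \<Phi>: E[exp(-s \<xi>_l)] = exp(-l \<Phi>(s)); read off at l = 1.\<close>
definition laplace_exponent :: "'a measure \<Rightarrow> (real \<Rightarrow> 'a \<Rightarrow> real) \<Rightarrow> real \<Rightarrow> real" where
  "laplace_exponent M \<xi> s = - ln (prob_space.expectation M (\<lambda>\<omega>. exp (- s * \<xi> 1 \<omega>)))"

definition exp_functional :: "(real \<Rightarrow> 'a \<Rightarrow> real) \<Rightarrow> 'a \<Rightarrow> real" where
  "exp_functional \<xi> \<omega> = (LBINT l:{0..}. exp (- \<xi> l \<omega>))"

text \<open>Multiplicative infinite divisibility of the random variable X on M: for every n \<ge> 2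
  there are i.i.d. positive random variables X_0,...,X_{n-1} (on some probability
  space; a canonical sequence space suffices) whose product has the law of X.\<close>
definition mult_inf_div :: "'a measure \<Rightarrow> ('a \<Rightarrow> real) \<Rightarrow> bool" where
  "mult_inf_div M X \<longleftrightarrow>
     (\<forall>n::nat. n \<ge> 2 \<longrightarrow>
       (\<exists>(N :: (nat \<Rightarrow> real) measure) (Y :: nat \<Rightarrow> (nat \<Rightarrow> real) \<Rightarrow> real).
          prob_space N \<and>
          (\<forall>i<n. Y i \<in> borel_measurable N \<and> (AE \<omega> in N. Y i \<omega> > 0)) \<and>
          prob_space.indep_vars N (\<lambda>_. borel) Y {..<n} \<and>
          (\<forall>i<n. distr N borel (Y i) = distr N borel (Y 0)) \<and>
          distr N borel (\<lambda>\<omega>. \<Prod>i<n. Y i \<omega>) = distr M borel X))"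

definition levy_measure_of :: "real measure \<Rightarrow> real measure \<Rightarrow> bool" where
  "levy_measure_of \<mu> \<nu> \<longleftrightarrow>
     sets \<nu> = sets borel \<and> emeasure \<nu> {0} = 0 \<and>
     (\<integral>\<^sup>+x. ennreal (min 1 (x\<^sup>2)) \<partial>\<nu>) < \<infinity> \<and>
     (\<exists>b \<sigma>2::real. \<sigma>2 \<ge> 0 \<and>
        (\<forall>t. char \<mu> t = exp (\<i> * complex_of_real (b * t) - complex_of_real (\<sigma>2 * t\<^sup>2 / 2)
           + (CLINT x|\<nu>. iexp (t * x) - 1 - \<i> * complex_of_real (t * x * indicator {-1..1} x)))))"

end

theory Submission
  imports Defs "HOL-Computational_Algebra.Polynomial"
begin

text \<open>Let f(n) be the n-th moment of I, so f(n) = n! / (\<Phi>(1) ... \<Phi>(n)). Since the exponential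
  moments of I are finite near 0, the sequence f determines the law of I. The second difference of
  ln f at m is the integral of exp (- m x) w(x) against dx - \<kappa>(dx), where w > 0 is the integral of
  exp (- s x) over s in [1, 2].

  If I is the product of n independent copies of Y, then E Y^j = f(j)^(1/n). Applying
  n E p(Y) \<ge> 0 to p(x) = (x - 1)^2 q(x)^2 and letting n tend to infinity shows that
  the integral of q(exp (- x))^2 w(x) against dx - \<kappa>(dx) is nonnegative for every polynomial q; by
  Weierstrass approximation and outer regularity, \<kappa>(dx) \<le> dx.

  Conversely, if \<kappa> has a density k \<le> 1, the stated Levy density gives an infinitely divisible
  law, obtained as a weak limit of compensated compound sums. The logarithms of its exponential moments
  have the same second differences as ln f, so after a shift it is the law of ln I. Scaling the
  Levy density by 1/n yields the n-th convolution roots.\<close>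

text \<open>Lebesgue measure enters through the factorial: n! is the product over 1, ..., n of the
  identity, whose logarithmic derivative 1/s is the Laplace transform of dx on the half line, just
  as \<Phi>'/\<Phi> is that of \<kappa>. The second difference of ln f at m is the integral of 1/s -
  \<Phi>'(s)/\<Phi>(s) over s in [m+1, m+2]; exchanging integrals produces the weight w. Second
  differences serve both directions. On polynomials they are multiplication by (x - 1)^2; on
  exponents they kill the affine part, which is left to the drift. Only integer m occur, but u = exp
  (- x) turns the integrals of exp (- m x) into moments on [0, 1]. The second difference in m of exp
  (m y) - 1 - m y is exp (m y) (exp y - 1)^2. Requiring it at y = -x, times the Levy density, to be
  exp (- m x) w(x) (1 - k(x)) leaves (1 - k(x)) / (x (exp x - 1)) as the only candidate. In general
  this is of order 1/x^2 at 0, so neither it nor x times it need be integrable; hence the cutoffs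
  and the centring in the construction of the law.\<close>

section \<open>Moments of the exponential functional\<close>

text \<open>Formally the derivative of \<open>A ^ Suc n\<close> is
  \<open>- Suc n * e * A ^ n\<close>. Differentiation is avoided, since \<open>A\<close> may be
  infinite: in the induction one factor \<open>A t\<close> is split at u into
  \<open>A u + B u\<close>, and Tonelli turns the \<open>B\<close> part into one more copy of the
  integral already present.\<close>

lemma tail_integral_power:
  fixes e :: "real \<Rightarrow> ennreal"
  assumes e[measurable]: "e \<in> borel_measurable borel"
  defines "A \<equiv> \<lambda>t. \<integral>\<^sup>+u. e u * indicator {t..} u \<partial>lborel"
  shows "A t ^ Suc n = of_nat (Suc n) * (\<integral>\<^sup>+u. e u * A u ^ n * indicator {t..} u \<partial>lborel)"
proof (induction n arbitrary: t)
  case 0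
  show ?case by (simp add: A_def)
next
  case (Suc n)
  have I: "indicator {t..} u = (if t \<le> u then 1 else (0::ennreal))" for t u :: real
    by (simp add: indicator_def)
  have A_meas[measurable]: "A \<in> borel_measurable borel"
    unfolding A_def I by measurable
  define B where "B u = (\<integral>\<^sup>+v. e v * indicator {t..<u} v \<partial>lborel)" for u
  have I2: "indicator {t..<u} v = (if t \<le> v \<and> v < u then 1 else (0::ennreal))" for u v :: real
    by (simp add: indicator_def)
  have B_meas[measurable]: "B \<in> borel_measurable borel"
    unfolding B_def I2 by measurable
  have split: "A t = A u + B u" if "t \<le> u" for u
  proof -
    have "A t = (\<integral>\<^sup>+v. e v * indicator {u..} v + e v * indicator {t..<u} v \<partial>lborel)"
      unfolding A_def using that by (intro nn_integral_cong) (auto split: split_indicator)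
    also have "\<dots> = A u + B u"
      unfolding A_def B_def by (rule nn_integral_add) auto
    finally show ?thesis .
  qed
  let ?c = "of_nat (Suc n) :: ennreal"
  have "A t ^ Suc (Suc n) = A t * (?c * (\<integral>\<^sup>+u. e u * A u ^ n * indicator {t..} u \<partial>lborel))"
    by (subst power_Suc, subst Suc) simp
  also have "\<dots> = ?c * (\<integral>\<^sup>+u. A t * (e u * A u ^ n * indicator {t..} u) \<partial>lborel)"
    by (subst nn_integral_cmult) (simp_all add: mult_ac)
  also have "(\<integral>\<^sup>+u. A t * (e u * A u ^ n * indicator {t..} u) \<partial>lborel)
     = (\<integral>\<^sup>+u. e u * A u ^ Suc n * indicator {t..} u + e u * A u ^ n * B u * indicator {t..} u \<partial>lborel)"
  proof (intro nn_integral_cong)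
    fix u
    show "A t * (e u * A u ^ n * indicator {t..} u)
      = e u * A u ^ Suc n * indicator {t..} u + e u * A u ^ n * B u * indicator {t..} u"
      using split[of u] by (auto simp: indicator_def algebra_simps)
  qed
  also have "\<dots> = (\<integral>\<^sup>+u. e u * A u ^ Suc n * indicator {t..} u \<partial>lborel)
       + (\<integral>\<^sup>+u. e u * A u ^ n * B u * indicator {t..} u \<partial>lborel)"
    by (rule nn_integral_add) auto
  also have "(\<integral>\<^sup>+u. e u * A u ^ n * B u * indicator {t..} u \<partial>lborel)
     = (\<integral>\<^sup>+u. (\<integral>\<^sup>+v. e u * A u ^ n * e v * (if t \<le> v \<and> v < u then 1 else 0) \<partial>lborel) \<partial>lborel)"
  proof (intro nn_integral_cong)
    fix u
    have "(\<integral>\<^sup>+v. e u * A u ^ n * e v * (if t \<le> v \<and> v < u then 1 else 0) \<partial>lborel)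
       = e u * A u ^ n * B u"
      unfolding B_def I2 by (subst nn_integral_cmult[symmetric]) (auto simp: mult_ac)
    moreover have "B u = 0" if "\<not> t \<le> u"
      using that by (auto simp: B_def)
    ultimately show "e u * A u ^ n * B u * indicator {t..} u
        = (\<integral>\<^sup>+v. e u * A u ^ n * e v * (if t \<le> v \<and> v < u then 1 else 0) \<partial>lborel)"
      by (auto simp: indicator_def)
  qed
  also have "\<dots> = (\<integral>\<^sup>+v. (\<integral>\<^sup>+u. e u * A u ^ n * e v * (if t \<le> v \<and> v < u then 1 else 0) \<partial>lborel) \<partial>lborel)"
    by (rule lborel_pair.Fubini') measurable
  finally have *: "A t ^ Suc (Suc n) = ?c * (\<integral>\<^sup>+u. e u * A u ^ Suc n * indicator {t..} u \<partial>lborel)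
     + (\<integral>\<^sup>+v. ?c * (\<integral>\<^sup>+u. e u * A u ^ n * e v * (if t \<le> v \<and> v < u then 1 else 0) \<partial>lborel) \<partial>lborel)"
    by (simp add: distrib_left nn_integral_cmult del: of_nat_Suc power_Suc)
  have "?c * (\<integral>\<^sup>+u. e u * A u ^ n * e v * (if t \<le> v \<and> v < u then 1 else 0) \<partial>lborel)
     = e v * A v ^ Suc n * indicator {t..} v" for v
  proof -
    have "(\<integral>\<^sup>+u. e u * A u ^ n * e v * (if t \<le> v \<and> v < u then 1 else 0) \<partial>lborel)
       = (\<integral>\<^sup>+u. e v * indicator {t..} v * (e u * A u ^ n * indicator {v..} u) \<partial>lborel)"
    proof (rule nn_integral_cong_AE)
      \<comment> \<open>\<open>B\<close> integrates up to u exclusively while \<open>A v\<close>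
        starts at v inclusively; the two conditions differ only on the diagonal.\<close>
      have "AE u in lborel. u \<noteq> v" by (rule AE_lborel_singleton)
      then show "AE u in lborel. e u * A u ^ n * e v * (if t \<le> v \<and> v < u then 1 else 0)
          = e v * indicator {t..} v * (e u * A u ^ n * indicator {v..} u)"
        by eventually_elim (auto simp: indicator_def mult_ac)
    qed
    also have "\<dots> = e v * indicator {t..} v * (\<integral>\<^sup>+u. e u * A u ^ n * indicator {v..} u \<partial>lborel)"
      by (rule nn_integral_cmult) auto
    finally show ?thesis using Suc[of v] by (simp add: mult_ac)
  qed
  with * have "A t ^ Suc (Suc n) = ?c * (\<integral>\<^sup>+u. e u * A u ^ Suc n * indicator {t..} u \<partial>lborel)
     + (\<integral>\<^sup>+u. e u * A u ^ Suc n * indicator {t..} u \<partial>lborel)" by simp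
  then show ?case by (simp add: algebra_simps)
qed

text \<open>Time is rounded to a grid point strictly to the right, so right continuity gives
  pointwise convergence, and each approximation takes only countably many times. Clamping at 0 keeps
  to the times where right continuity is assumed.\<close>

lemma right_continuous_jointly_measurable:
  fixes X :: "real \<Rightarrow> 'a \<Rightarrow> real"
  assumes meas[measurable]: "\<And>l. X l \<in> borel_measurable M"
    and rc: "\<And>\<omega> l. \<omega> \<in> space M \<Longrightarrow> 0 \<le> l \<Longrightarrow> continuous (at_right l) (\<lambda>t. X t \<omega>)"
  shows "(\<lambda>(u, \<omega>). X (max 0 u) \<omega>) \<in> borel_measurable (borel \<Otimes>\<^sub>M M)"
proof -
  define g where "g k u = (of_int \<lfloor>real (Suc k) * max 0 u\<rfloor> + 1) / real (Suc k)" for k :: nat and u :: real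
  have g_gt: "max 0 u < g k u" for k u
  proof -
    have "max 0 u * real (Suc k) < of_int \<lfloor>real (Suc k) * max 0 u\<rfloor> + 1"
      using real_of_int_floor_add_one_gt[of "real (Suc k) * max 0 u"] by (simp only: mult.commute)
    then show ?thesis unfolding g_def by (subst pos_less_divide_eq) simp_all
  qed
  have g_le: "g k u \<le> max 0 u + 1 / real (Suc k)" for k u
  proof -
    have "of_int \<lfloor>real (Suc k) * max 0 u\<rfloor> + 1 \<le> (max 0 u + 1 / real (Suc k)) * real (Suc k)"
      using of_int_floor_le[of "real (Suc k) * max 0 u"] by (simp add: distrib_right del: of_nat_Suc) (simp add: mult.commute del: of_nat_Suc)
    then show ?thesis unfolding g_def by (subst pos_divide_le_eq) simp_all
  qed
  have g_lim: "(\<lambda>k. g k u) \<longlonglongrightarrow> max 0 u" for u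
  proof (rule tendsto_sandwich)
    show "(\<lambda>k. max 0 u) \<longlonglongrightarrow> max 0 u" by simp
    have "(\<lambda>k. max 0 u + 1 / real (Suc k)) \<longlonglongrightarrow> max 0 u + 0"
      by (intro tendsto_intros LIMSEQ_Suc[OF lim_1_over_n])
    then show "(\<lambda>k. max 0 u + 1 / real (Suc k)) \<longlonglongrightarrow> max 0 u" by simp
  qed (intro always_eventually allI less_imp_le[OF g_gt] g_le)+
  show ?thesis
  proof (rule borel_measurable_LIMSEQ_real)
    fix p :: "real \<times> 'a" assume "p \<in> space (borel \<Otimes>\<^sub>M M)"
    then obtain u \<omega> where p: "p = (u, \<omega>)" "\<omega> \<in> space M" by (auto simp: space_pair_measure)
    have "filterlim (\<lambda>k. g k u) (at_right (max 0 u)) sequentially"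
      unfolding filterlim_at using g_lim g_gt by (auto intro!: always_eventually simp: less_imp_neq[OF g_gt, symmetric])
    moreover have "((\<lambda>t. X t \<omega>) \<longlongrightarrow> X (max 0 u) \<omega>) (at_right (max 0 u))"
      using rc[OF p(2), of "max 0 u"] by (simp add: continuous_within)
    ultimately have "(\<lambda>k. X (g k u) \<omega>) \<longlonglongrightarrow> X (max 0 u) \<omega>"
      by (rule filterlim_compose[rotated])
    then show "(\<lambda>k. (\<lambda>(u, \<omega>). X (g k u) \<omega>) p) \<longlonglongrightarrow> (\<lambda>(u, \<omega>). X (max 0 u) \<omega>) p"
      by (simp add: p)
  next
    fix k
    have "(\<lambda>p. (\<lambda>(i::int) p. X ((of_int i + 1) / real (Suc k)) (snd p)) \<lfloor>real (Suc k) * max 0 (fst p)\<rfloor> p)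
        \<in> borel_measurable (borel \<Otimes>\<^sub>M M)"
      by (rule measurable_compose_countable) measurable
    then show "(\<lambda>(u, \<omega>). X (g k u) \<omega>) \<in> borel_measurable (borel \<Otimes>\<^sub>M M)"
      by (simp add: g_def case_prod_beta)
  qed
qed

text \<open>Cauchy's equation with monotonicity in place of continuity. With m the floor of n t,
  both \<open>n * l t\<close> and \<open>n * t * l 1\<close> lie between \<open>m * l 1\<close> and
  \<open>(m + 1) * l 1\<close>, so they differ by at most \<open>l 1\<close> for every n.\<close>

lemma multiplicative_antimono_exp:
  fixes f :: "real \<Rightarrow> real"
  assumes pos: "\<And>t. 0 \<le> t \<Longrightarrow> 0 < f t"
    and mult: "\<And>s t. 0 \<le> s \<Longrightarrow> 0 \<le> t \<Longrightarrow> f (t + s) = f t * f s"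
    and anti: "\<And>s t. 0 \<le> s \<Longrightarrow> s \<le> t \<Longrightarrow> f t \<le> f s"
    and t: "0 \<le> t"
  shows "f t = exp (t * ln (f 1))"
proof -
  define l where "l s = - ln (f s)" for s
  have l_add: "l (s + t) = l s + l t" if "0 \<le> s" "0 \<le> t" for s t
    using mult[of t s] pos[of s] pos[of t] that by (simp add: l_def ln_mult)
  have l_mono: "l s \<le> l t" if "0 \<le> s" "s \<le> t" for s t
    using anti[of s t] pos[of s] pos[of t] that by (simp add: l_def)
  have l0: "l 0 = 0" using l_add[of 0 0] by simp
  have l_nat: "l (real n * t) = real n * l t" if "0 \<le> t" for n t
    by (induction n) (use that l0 in \<open>auto simp: l_add distrib_right\<close>)
  have l1: "0 \<le> l 1" using l_mono[of 0 1] l0 by simp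
  have bound: "real n * \<bar>l t - t * l 1\<bar> \<le> l 1" for n
  proof -
    define m where "m = nat \<lfloor>real n * t\<rfloor>"
    have m: "real m \<le> real n * t" "real n * t \<le> real (Suc m)"
      using t real_of_int_floor_add_one_ge[of "real n * t"] by (auto simp: m_def add.commute)
    have "real m * l 1 \<le> real n * l t" "real n * l t \<le> real (Suc m) * l 1"
      using l_mono[OF _ m(1)] l_mono[OF _ m(2)] l_nat[of 1 m] l_nat[of 1 "Suc m"] l_nat[of t n] t by auto
    moreover have "real m * l 1 \<le> real n * t * l 1" "real n * t * l 1 \<le> real (Suc m) * l 1"
      using m l1 by (auto intro: mult_right_mono)
    ultimately have "\<bar>real n * (l t - t * l 1)\<bar> \<le> l 1"
      by (simp add: algebra_simps abs_le_iff)
    then show ?thesis by (simp add: abs_mult)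
  qed
  have "l t = t * l 1"
  proof (rule ccontr)
    assume "l t \<noteq> t * l 1"
    then have "0 < \<bar>l t - t * l 1\<bar>" by simp
    then obtain n where "l 1 < real n * \<bar>l t - t * l 1\<bar>"
      using reals_Archimedean3 by blast
    with bound[of n] show False by simp
  qed
  then have "ln (f t) = t * ln (f 1)" by (simp add: l_def)
  then show ?thesis using pos[OF t] by (metis exp_ln)
qed

section \<open>The Laplace exponent of a subordinator\<close>

locale subordinator_process = prob_space M for M :: "'a measure" +
  fixes \<xi> :: "real \<Rightarrow> 'a \<Rightarrow> real"
  assumes subordinator: "subordinator M \<xi>"
begin

abbreviation "\<Phi> \<equiv> laplace_exponent M \<xi>"

lemma xi_measurable[measurable]: "\<xi> l \<in> borel_measurable M"
  using subordinator by (simp add: subordinator_def)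

lemma xi_mono: "\<omega> \<in> space M \<Longrightarrow> 0 \<le> s \<Longrightarrow> s \<le> t \<Longrightarrow> \<xi> s \<omega> \<le> \<xi> t \<omega>"
  using subordinator by (auto simp: subordinator_def mono_on_def)

lemma xi_zero: "\<omega> \<in> space M \<Longrightarrow> \<xi> 0 \<omega> = 0"
  using subordinator by (auto simp: subordinator_def)

lemma xi_nonneg: "\<omega> \<in> space M \<Longrightarrow> 0 \<le> t \<Longrightarrow> 0 \<le> \<xi> t \<omega>"
  using xi_mono[of \<omega> 0 t] xi_zero[of \<omega>] by simp

lemma integrable_exp_xi: "0 \<le> a \<Longrightarrow> 0 \<le> t \<Longrightarrow> integrable M (\<lambda>\<omega>. exp (- a * \<xi> t \<omega>))"
  by (rule integrable_const_bound[where B=1]) (auto simp: xi_nonneg)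

lemma laplace_xi_pos:
  assumes "0 \<le> a" "0 \<le> t" shows "0 < expectation (\<lambda>\<omega>. exp (- a * \<xi> t \<omega>))"
proof -
  have "expectation (\<lambda>\<omega>. 0) < expectation (\<lambda>\<omega>. exp (- a * \<xi> t \<omega>))"
    by (rule integral_less_AE_space) (use integrable_exp_xi[OF assms] in \<open>auto simp: emeasure_space_1\<close>)
  then show ?thesis by simp
qed

lemma nn_laplace_increment:
  assumes "0 \<le> a" "0 \<le> s" "0 \<le> t"
  shows "(\<integral>\<^sup>+\<omega>. ennreal (exp (- a * (\<xi> (t + s) \<omega> - \<xi> t \<omega>))) \<partial>M)
       = ennreal (expectation (\<lambda>\<omega>. exp (- a * \<xi> s \<omega>)))"
proof -
  have "(\<integral>\<^sup>+\<omega>. ennreal (exp (- a * (\<xi> (t + s) \<omega> - \<xi> t \<omega>))) \<partial>M)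
     = (\<integral>\<^sup>+x. ennreal (exp (- a * x)) \<partial>distr M borel (\<lambda>\<omega>. \<xi> (t + s) \<omega> - \<xi> t \<omega>))"
    by (subst nn_integral_distr) auto
  also have "distr M borel (\<lambda>\<omega>. \<xi> (t + s) \<omega> - \<xi> t \<omega>) = distr M borel (\<xi> s)"
    using subordinator assms by (auto simp: subordinator_def)
  also have "(\<integral>\<^sup>+x. ennreal (exp (- a * x)) \<partial>distr M borel (\<xi> s)) = (\<integral>\<^sup>+\<omega>. ennreal (exp (- a * \<xi> s \<omega>)) \<partial>M)"
    by (subst nn_integral_distr) auto
  also have "\<dots> = ennreal (expectation (\<lambda>\<omega>. exp (- a * \<xi> s \<omega>)))"
    by (rule nn_integral_eq_integral) (use integrable_exp_xi assms in auto)
  finally show ?thesis .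
qed

lemma nn_laplace_increments:
  fixes t a :: "nat \<Rightarrow> real"
  assumes t: "0 \<le> t 0" "mono t" and a: "\<And>i. i < m \<Longrightarrow> 0 \<le> a i"
  shows "(\<integral>\<^sup>+\<omega>. (\<Prod>i<m. ennreal (exp (- a i * (\<xi> (t (Suc i)) \<omega> - \<xi> (t i) \<omega>)))) \<partial>M)
     = (\<Prod>i<m. ennreal (expectation (\<lambda>\<omega>. exp (- a i * \<xi> (t (Suc i) - t i) \<omega>))))"
proof -
  have t_pos: "0 \<le> t i" for i using t monoD[of t 0 i] by (meson le0 order.trans)
  have t_suc: "t i \<le> t (Suc i)" for i using t(2) by (simp add: monoD)
  have "indep_vars (\<lambda>_. borel) (\<lambda>i \<omega>. \<xi> (t (Suc i)) \<omega> - \<xi> (t i) \<omega>) {..<m}"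
    using subordinator t by (auto simp: subordinator_def)
  then have "indep_vars (\<lambda>_. borel) (\<lambda>i \<omega>. ennreal (exp (- a i * (\<xi> (t (Suc i)) \<omega> - \<xi> (t i) \<omega>)))) {..<m}"
    by (rule indep_vars_compose2[where Y="\<lambda>i x. ennreal (exp (- a i * x))"]) simp
  then have "(\<integral>\<^sup>+\<omega>. (\<Prod>i<m. ennreal (exp (- a i * (\<xi> (t (Suc i)) \<omega> - \<xi> (t i) \<omega>)))) \<partial>M)
     = (\<Prod>i<m. \<integral>\<^sup>+\<omega>. ennreal (exp (- a i * (\<xi> (t (Suc i)) \<omega> - \<xi> (t i) \<omega>))) \<partial>M)"
    by (intro indep_vars_nn_integral) auto
  also have "\<dots> = (\<Prod>i<m. ennreal (expectation (\<lambda>\<omega>. exp (- a i * \<xi> (t (Suc i) - t i) \<omega>))))"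
  proof (intro prod.cong refl)
    fix i assume "i \<in> {..<m}"
    then show "(\<integral>\<^sup>+\<omega>. ennreal (exp (- a i * (\<xi> (t (Suc i)) \<omega> - \<xi> (t i) \<omega>))) \<partial>M)
       = ennreal (expectation (\<lambda>\<omega>. exp (- a i * \<xi> (t (Suc i) - t i) \<omega>)))"
      using nn_laplace_increment[of "a i" "t (Suc i) - t i" "t i"] a t_pos[of i] t_suc[of i] by simp
  qed
  finally show ?thesis .
qed

text \<open>The exponent is read off at time 1 only. Stationary independent increments make the
  transform multiplicative in time, and monotone paths make it decreasing, which forces an
  exponential.\<close>

lemma laplace_xi:
  assumes a: "0 \<le> a" and t: "0 \<le> t"
  shows "expectation (\<lambda>\<omega>. exp (- a * \<xi> t \<omega>)) = exp (- t * \<Phi> a)"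
proof -
  let ?f = "\<lambda>t. expectation (\<lambda>\<omega>. exp (- a * \<xi> t \<omega>))"
  have "?f t = exp (t * ln (?f 1))"
  proof (rule multiplicative_antimono_exp[OF _ _ _ t])
    show "0 < ?f t" if "0 \<le> t" for t using laplace_xi_pos[OF a that] .
    show "?f t \<le> ?f s" if "0 \<le> s" "s \<le> t" for s t
      using that a by (intro integral_mono integrable_exp_xi) (auto intro!: mult_left_mono xi_mono)
    show "?f (t + s) = ?f t * ?f s" if st: "0 \<le> s" "0 \<le> t" for s t
    proof -
      \<comment> \<open>Independence is stated for infinite monotone sequences of times, so the grid
        0, t, t + s is continued as a constant.\<close>
      define \<tau> where "\<tau> i = (if i = 0 then 0 else if i = 1 then t else t + s)" for i :: nat
      have \<tau>: "\<tau> 0 = 0" "\<tau> (Suc 0) = t" "\<tau> (Suc (Suc 0)) = t + s" by (auto simp: \<tau>_def)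
      have "mono \<tau>" using st by (auto simp: mono_def \<tau>_def)
      then have "(\<integral>\<^sup>+\<omega>. (\<Prod>i<Suc (Suc 0). ennreal (exp (- a * (\<xi> (\<tau> (Suc i)) \<omega> - \<xi> (\<tau> i) \<omega>)))) \<partial>M)
          = (\<Prod>i<Suc (Suc 0). ennreal (?f (\<tau> (Suc i) - \<tau> i)))"
        using a by (intro nn_laplace_increments) (auto simp: \<tau>)
      also have "\<dots> = ennreal (?f t * ?f s)"
        by (simp add: \<tau> ennreal_mult'[symmetric] integral_nonneg_AE)
      also have "(\<integral>\<^sup>+\<omega>. (\<Prod>i<Suc (Suc 0). ennreal (exp (- a * (\<xi> (\<tau> (Suc i)) \<omega> - \<xi> (\<tau> i) \<omega>)))) \<partial>M)
          = (\<integral>\<^sup>+\<omega>. ennreal (exp (- a * \<xi> (t + s) \<omega>)) \<partial>M)"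
        by (intro nn_integral_cong)
          (simp add: \<tau> xi_zero ennreal_mult'[symmetric] mult_exp_exp algebra_simps)
      also have "\<dots> = ennreal (?f (t + s))"
        by (rule nn_integral_eq_integral) (use integrable_exp_xi a st in auto)
      finally show ?thesis by (simp add: ennreal_inj integral_nonneg_AE)
    qed
  qed
  then show ?thesis by (simp add: laplace_exponent_def)
qed

end

lemma nn_integral_exp_tail:
  assumes "0 < \<phi>"
  shows "(\<integral>\<^sup>+u. ennreal (exp (- (u - c) * \<phi>)) * indicator {c..} u \<partial>lborel) = ennreal (1 / \<phi>)"
proof -
  have lim: "((\<lambda>u. - exp (- (u - c) * \<phi>) / \<phi>) \<longlongrightarrow> - 0 / \<phi>) at_top"
  proof (intro tendsto_intros)
    have "LIM u at_top. (u - c) * \<phi> :> at_top"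
      using assms by real_asymp
    then have "LIM u at_top. - ((u - c) * \<phi>) :> at_bot"
      by (simp add: filterlim_uminus_at_bot)
    then have "((\<lambda>u. exp (- ((u - c) * \<phi>))) \<longlongrightarrow> 0) at_top"
      by (rule filterlim_compose[OF exp_at_bot])
    then show "((\<lambda>u. exp (- (u - c) * \<phi>)) \<longlongrightarrow> 0) at_top" by (simp only: minus_mult_left)
  qed (use assms in auto)
  show ?thesis
    using assms lim by (subst nn_integral_FTC_atLeast[where F="\<lambda>u. - exp (- (u - c) * \<phi>) / \<phi>" and T="- 0 / \<phi>"])
      (auto intro!: derivative_eq_intros)
qed

locale nonzero_subordinator = subordinator_process +
  assumes nonzero: "\<exists>s>0. laplace_exponent M \<xi> s \<noteq> 0"
begin

lemma exp_minus_Phi: "0 \<le> a \<Longrightarrow> exp (- \<Phi> a) = expectation (\<lambda>\<omega>. exp (- a * \<xi> 1 \<omega>))"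
  using laplace_xi[of a 1] by simp

text \<open>If the exponent vanished at one a > 0, then \<open>exp (- a * \<xi> 1 \<omega>)\<close>,
  which is at most 1, would have expectation 1. So \<open>\<xi> 1\<close> would be 0 almost surely
  and the exponent would vanish identically, against \<open>nonzero\<close>.\<close>

lemma Phi_pos:
  assumes a: "0 < a" shows "0 < \<Phi> a"
proof -
  have "expectation (\<lambda>\<omega>. exp (- a * \<xi> 1 \<omega>)) \<le> expectation (\<lambda>\<omega>. 1)"
    using a by (intro integral_mono integrable_exp_xi) (auto simp: xi_nonneg)
  then have "exp (- \<Phi> a) \<le> 1" using exp_minus_Phi[of a] a by (simp add: prob_space)
  moreover have "\<Phi> a \<noteq> 0"
  proof
    assume "\<Phi> a = 0"
    then have "expectation (\<lambda>\<omega>. 1 - exp (- a * \<xi> 1 \<omega>)) = 0"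
      using exp_minus_Phi[of a] a integrable_exp_xi[of a 1] by (simp add: prob_space)
    then have "AE \<omega> in M. 1 - exp (- a * \<xi> 1 \<omega>) = 0"
      using a integrable_exp_xi[of a 1]
      by (subst (asm) integral_nonneg_eq_0_iff_AE) (auto intro!: AE_I2 simp: xi_nonneg)
    then have ae: "AE \<omega> in M. \<xi> 1 \<omega> = 0"
      by eventually_elim (use a in auto)
    have "\<Phi> s = 0" for s
    proof -
      have "expectation (\<lambda>\<omega>. exp (- s * \<xi> 1 \<omega>)) = expectation (\<lambda>\<omega>. 1)"
        using ae by (intro integral_cong_AE) auto
      then show ?thesis by (simp add: laplace_exponent_def prob_space)
    qed
    with nonzero show False by auto
  qed
  ultimately show ?thesis by simp
qed

text \<open>Values in \<open>ennreal\<close> let the moment recursion run before the integral is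
  known to be finite. Paths are controlled on nonnegative times only; \<open>max 0 u\<close> makes
  the integrand jointly measurable on the whole line.\<close>

definition tail :: "real \<Rightarrow> 'a \<Rightarrow> ennreal" where
  "tail t \<omega> = (\<integral>\<^sup>+u. ennreal (exp (- \<xi> (max 0 u) \<omega>)) * indicator {t..} u \<partial>lborel)"

lemma xi_joint_measurable[measurable]:
  "(\<lambda>p. \<xi> (max 0 (fst p)) (snd p)) \<in> borel_measurable (borel \<Otimes>\<^sub>M M)"
proof -
  have "(\<lambda>(u, \<omega>). \<xi> (max 0 u) \<omega>) \<in> borel_measurable (borel \<Otimes>\<^sub>M M)"
    using subordinator by (intro right_continuous_jointly_measurable) (auto simp: subordinator_def)
  then show ?thesis by (simp add: case_prod_beta)
qed

lemma xi_joint_measurable'[measurable (raw)]: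
  assumes [measurable]: "f \<in> borel_measurable N" "g \<in> measurable N M"
  shows "(\<lambda>x. \<xi> (max 0 (f x)) (g x)) \<in> borel_measurable N"
  using measurable_compose[OF measurable_Pair[OF assms] xi_joint_measurable] by simp

lemma tail_joint_measurable[measurable]:
  "(\<lambda>p. tail (fst p) (snd p)) \<in> borel_measurable (borel \<Otimes>\<^sub>M M)"
proof -
  have "indicator {t..} u = (if t \<le> u then 1 else (0::ennreal))" for t u :: real
    by (simp add: indicator_def)
  then show ?thesis unfolding tail_def by simp measurable
qed

lemma tail_joint_measurable'[measurable (raw)]:
  assumes [measurable]: "f \<in> borel_measurable N" "g \<in> measurable N M"
  shows "(\<lambda>x. tail (f x) (g x)) \<in> borel_measurable N"
  using measurable_compose[OF measurable_Pair[OF assms] tail_joint_measurable] by simp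

lemma tail_power:
  assumes "\<omega> \<in> space M"
  shows "tail t \<omega> ^ Suc n = of_nat (Suc n) *
    (\<integral>\<^sup>+u. ennreal (exp (- \<xi> (max 0 u) \<omega>)) * tail u \<omega> ^ n * indicator {t..} u \<partial>lborel)"
  unfolding tail_def
proof (rule tail_integral_power)
  have "(\<lambda>u. \<omega>) \<in> measurable borel M" using assms by simp
  then show "(\<lambda>u. ennreal (exp (- \<xi> (max 0 u) \<omega>))) \<in> borel_measurable borel"
    by measurable
qed

text \<open>Only finite-dimensional independence of the increments enters: writing
  \<^term>\<open>tail (t m) \<omega> ^ Suc n\<close> as an integral over a further time u multiplies the increment
  factors by exp (- \<xi> u), which is absorbed by raising every coefficient by one and
  appending u to the time grid.\<close>

lemma tail_moment:
  fixes t a :: "nat \<Rightarrow> real"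
  assumes "t 0 = 0" "mono t" and "\<And>i. i < m \<Longrightarrow> 0 \<le> a i"
  shows "(\<integral>\<^sup>+\<omega>. (\<Prod>i<m. ennreal (exp (- a i * (\<xi> (t (Suc i)) \<omega> - \<xi> (t i) \<omega>)))) * tail (t m) \<omega> ^ n \<partial>M)
    = ennreal (fact n / (\<Prod>k=1..n. \<Phi> (real k)) * (\<Prod>i<m. exp (- (t (Suc i) - t i) * \<Phi> (a i + n))))"
  using assms
proof (induction n arbitrary: m t a)
  case 0
  then have "0 \<le> t (Suc i) - t i" for i by (simp add: monoD)
  then have "(\<Prod>i<m. ennreal (expectation (\<lambda>\<omega>. exp (- a i * \<xi> (t (Suc i) - t i) \<omega>))))
    = (\<Prod>i<m. ennreal (exp (- (t (Suc i) - t i) * \<Phi> (a i))))"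
    by (intro prod.cong refl arg_cong[where f=ennreal] laplace_xi) (use 0 in auto)
  with 0 nn_laplace_increments[of t m a] show ?case
    by (simp add: prod_ennreal)
next
  case (Suc n)
  let ?D = "\<lambda>\<omega>. \<Prod>i<m. ennreal (exp (- a i * (\<xi> (t (Suc i)) \<omega> - \<xi> (t i) \<omega>)))"
  let ?e = "\<lambda>u \<omega>. ennreal (exp (- \<xi> (max 0 u) \<omega>))"
  have t_pos: "0 \<le> t i" for i using Suc.prems monoD[of t 0 i] by simp
  define C where "C = fact n / (\<Prod>k=1..n. \<Phi> (real k)) * (\<Prod>i<m. exp (- (t (Suc i) - t i) * \<Phi> (a i + Suc n)))"
  have prod_pos: "0 < (\<Prod>k=1..n. \<Phi> (real k))" for n by (intro prod_pos) (auto intro: Phi_pos)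
  have C: "0 \<le> C" unfolding C_def using prod_pos[of n] by (intro mult_nonneg_nonneg divide_nonneg_pos prod_nonneg) auto
  have inner: "(\<integral>\<^sup>+\<omega>. ?D \<omega> * (?e u \<omega> * tail u \<omega> ^ n) \<partial>M) = ennreal C * ennreal (exp (- (u - t m) * \<Phi> (Suc n)))"
    if u: "t m \<le> u" for u
  proof -
    define t' where "t' i = (if i \<le> m then t i else u)" for i
    define a' where "a' i = (if i < m then a i + 1 else 1)" for i
    have mono: "mono t'" using u \<open>mono t\<close> unfolding mono_def t'_def
      by (auto intro: order.trans)
    have "t' 0 = 0" using Suc.prems by (simp add: t'_def)
    moreover note mono
    moreover have "0 \<le> a' i" if "i < Suc m" for i using Suc.prems(3) by (auto simp: a'_def)
    ultimately have IH: "(\<integral>\<^sup>+\<omega>. (\<Prod>i<Suc m. ennreal (exp (- a' i * (\<xi> (t' (Suc i)) \<omega> - \<xi> (t' i) \<omega>)))) * tail (t' (Suc m)) \<omega> ^ n \<partial>M)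
      = ennreal (fact n / (\<Prod>k=1..n. \<Phi> (real k)) * (\<Prod>i<Suc m. exp (- (t' (Suc i) - t' i) * \<Phi> (a' i + n))))"
      by (rule Suc.IH)
    have D: "(\<Prod>i<Suc m. ennreal (exp (- a' i * (\<xi> (t' (Suc i)) \<omega> - \<xi> (t' i) \<omega>)))) = ?D \<omega> * ?e u \<omega>"
      if \<omega>: "\<omega> \<in> space M" for \<omega>
    proof -
      have "(\<Sum>i<m. \<xi> (t (Suc i)) \<omega> - \<xi> (t i) \<omega>) = \<xi> (t m) \<omega>"
        by (subst sum_lessThan_telescope) (simp add: Suc.prems xi_zero \<omega>)
      moreover have "max 0 u = u" using u t_pos[of m] by simp
      ultimately have "(\<Prod>i<Suc m. exp (- a' i * (\<xi> (t' (Suc i)) \<omega> - \<xi> (t' i) \<omega>)))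
        = (\<Prod>i<m. exp (- a i * (\<xi> (t (Suc i)) \<omega> - \<xi> (t i) \<omega>))) * exp (- \<xi> (max 0 u) \<omega>)"
        by (simp add: t'_def a'_def exp_sum[symmetric] mult_exp_exp sum.distrib[symmetric]
            sum_negf[symmetric] algebra_simps)
         (simp add: sum_subtractf sum.distrib algebra_simps sum_negf)
      then show ?thesis
        by (simp only: prod_ennreal exp_ge_zero)
          (simp add: ennreal_mult' prod_nonneg del: prod.lessThan_Suc)
    qed
    \<comment> \<open>The appended increment has coefficient 1, which the induction hypothesis
      evaluates at 1 + n. Integrating its exponential over u from \<open>t m\<close> on then yields
      the new factor \<open>1 / \<Phi> (Suc n)\<close>.\<close>
    have "(\<Prod>i<Suc m. exp (- (t' (Suc i) - t' i) * \<Phi> (a' i + n)))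
       = (\<Prod>i<m. exp (- (t (Suc i) - t i) * \<Phi> (a i + Suc n))) * exp (- (u - t m) * \<Phi> (Suc n))"
      by (simp add: t'_def a'_def algebra_simps)
    then have "(\<integral>\<^sup>+\<omega>. ?D \<omega> * ?e u \<omega> * tail u \<omega> ^ n \<partial>M) = ennreal (C * exp (- (u - t m) * \<Phi> (Suc n)))"
      using IH D by (simp add: C_def t'_def mult.assoc del: prod.lessThan_Suc cong: nn_integral_cong_simp)
    then show ?thesis using C by (simp add: ennreal_mult' mult.assoc)
  qed
  have I: "indicator {t m..} u = (if t m \<le> u then 1 else (0::ennreal))" for u :: real
    by (simp add: indicator_def)
  interpret MP: pair_sigma_finite lborel M ..
  have "(\<integral>\<^sup>+\<omega>. ?D \<omega> * tail (t m) \<omega> ^ Suc n \<partial>M)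
     = (\<integral>\<^sup>+\<omega>. (\<integral>\<^sup>+u. of_nat (Suc n) * (?D \<omega> * (?e u \<omega> * tail u \<omega> ^ n) * indicator {t m..} u) \<partial>lborel) \<partial>M)"
  proof (intro nn_integral_cong)
    fix \<omega> assume "\<omega> \<in> space M"
    then have [measurable]: "(\<lambda>u. \<omega>) \<in> measurable borel M" by simp
    show "?D \<omega> * tail (t m) \<omega> ^ Suc n
      = (\<integral>\<^sup>+u. of_nat (Suc n) * (?D \<omega> * (?e u \<omega> * tail u \<omega> ^ n) * indicator {t m..} u) \<partial>lborel)"
      unfolding tail_power[OF \<open>\<omega> \<in> space M\<close>] mult.assoc[of "of_nat (Suc n)"]
      by (subst nn_integral_cmult, measurable, subst mult.assoc, subst nn_integral_cmult, measurable)
        (simp add: mult_ac)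
  qed
  also have "\<dots> = (\<integral>\<^sup>+u. (\<integral>\<^sup>+\<omega>. of_nat (Suc n) * (?D \<omega> * (?e u \<omega> * tail u \<omega> ^ n) * indicator {t m..} u) \<partial>M) \<partial>lborel)"
    unfolding I by (rule MP.Fubini') measurable
  also have "\<dots> = (\<integral>\<^sup>+u. ennreal (real (Suc n) * C) * (ennreal (exp (- (u - t m) * \<Phi> (Suc n))) * indicator {t m..} u) \<partial>lborel)"
  proof (intro nn_integral_cong)
    fix u
    have [measurable]: "(\<lambda>\<omega>. \<xi> (max 0 u) \<omega>) \<in> borel_measurable M" by simp
    have "(\<integral>\<^sup>+\<omega>. of_nat (Suc n) * (?D \<omega> * (?e u \<omega> * tail u \<omega> ^ n) * indicator {t m..} u) \<partial>M)
      = of_nat (Suc n) * (\<integral>\<^sup>+\<omega>. ?D \<omega> * (?e u \<omega> * tail u \<omega> ^ n) \<partial>M) * indicator {t m..} u"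
      by (subst nn_integral_cmult, measurable, subst nn_integral_multc, measurable) (simp add: mult_ac)
    also have "\<dots> = ennreal (real (Suc n) * C) * (ennreal (exp (- (u - t m) * \<Phi> (Suc n))) * indicator {t m..} u)"
      using inner[of u] C by (auto simp: indicator_def ennreal_mult' ennreal_of_nat_eq_real_of_nat mult.assoc simp del: of_nat_Suc)
    finally show "(\<integral>\<^sup>+\<omega>. of_nat (Suc n) * (?D \<omega> * (?e u \<omega> * tail u \<omega> ^ n) * indicator {t m..} u) \<partial>M)
      = ennreal (real (Suc n) * C) * (ennreal (exp (- (u - t m) * \<Phi> (Suc n))) * indicator {t m..} u)" .
  qed
  also have "\<dots> = ennreal (real (Suc n) * C) * ennreal (1 / \<Phi> (Suc n))"
    by (subst nn_integral_cmult, measurable, subst nn_integral_exp_tail) (simp_all add: Phi_pos del: of_nat_Suc)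
  also have "\<dots> = ennreal (real (Suc n) * C * (1 / \<Phi> (Suc n)))"
    using C Phi_pos[of "Suc n"] by (intro ennreal_mult'[symmetric]) simp
  also have "real (Suc n) * C * (1 / \<Phi> (Suc n)) = fact (Suc n) / (\<Prod>k=1..Suc n. \<Phi> (real k)) * (\<Prod>i<m. exp (- (t (Suc i) - t i) * \<Phi> (a i + Suc n)))"
    by (simp add: C_def del: of_nat_Suc)
  finally show ?case .
qed

end

section \<open>Differentiability of the Laplace exponent and the moments of the integral\<close>

lemma abs_exp_minus_one_le: "\<bar>exp z - 1\<bar> \<le> \<bar>z\<bar> * exp \<bar>z\<bar>" for z :: real
proof (cases "0 \<le> z")
  case True
  have "exp z * (1 - z) \<le> exp z * exp (- z)"
    using exp_ge_add_one_self[of "- z"] by (intro mult_left_mono) auto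
  then have "exp z - 1 \<le> z * exp z" by (simp add: exp_minus algebra_simps)
  then show ?thesis using True by simp
next
  case False
  moreover have "1 - exp z \<le> - z" using exp_ge_add_one_self[of z] by linarith
  ultimately have "\<bar>exp z - 1\<bar> \<le> \<bar>z\<bar> * 1" by simp
  also have "\<dots> \<le> \<bar>z\<bar> * exp \<bar>z\<bar>" by (intro mult_left_mono) auto
  finally show ?thesis .
qed

text \<open>Dominated convergence for the difference quotients. For increments below s/2 in modulus
  they are bounded by x exp (- s x / 2), hence by 2/s, so X itself may fail to be
  integrable.\<close>

lemma (in prob_space) laplace_has_derivative:
  assumes X[measurable]: "X \<in> borel_measurable M" and pos: "\<And>\<omega>. \<omega> \<in> space M \<Longrightarrow> 0 \<le> X \<omega>"
    and s: "0 < s"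
  shows "((\<lambda>a. expectation (\<lambda>\<omega>. exp (- a * X \<omega>))) has_real_derivative
     expectation (\<lambda>\<omega>. - X \<omega> * exp (- s * X \<omega>))) (at s)"
  unfolding DERIV_def tendsto_at_iff_sequentially
proof safe
  fix h :: "nat \<Rightarrow> real" assume "\<forall>i. h i \<in> UNIV - {0}" and lim: "h \<longlonglongrightarrow> 0"
  then have h0: "h i \<noteq> 0" for i by auto
  obtain N where N: "\<And>n. n \<ge> N \<Longrightarrow> \<bar>h n\<bar> < s / 2"
    using LIMSEQ_D[OF lim, of "s / 2"] s by auto
  \<comment> \<open>The domination must hold for every index, so the initial terms with increment
    s/2 or more are dropped.\<close>
  define g where "g n = h (n + N)" for n
  have g: "g \<longlonglongrightarrow> 0" "g n \<noteq> 0" "\<bar>g n\<bar> < s / 2" for n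
    using LIMSEQ_ignore_initial_segment[OF lim, of N] h0 N by (auto simp: g_def[abs_def])
  have int: "integrable M (\<lambda>\<omega>. exp (- a * X \<omega>))" if "0 \<le> a" for a
    using that pos by (intro integrable_const_bound[where B=1]) auto
  have L: "(\<lambda>n. expectation (\<lambda>\<omega>. (exp (- (s + g n) * X \<omega>) - exp (- s * X \<omega>)) / g n))
     \<longlonglongrightarrow> expectation (\<lambda>\<omega>. - X \<omega> * exp (- s * X \<omega>))"
  proof (rule integral_dominated_convergence[where w="\<lambda>_. 2 / s"])
    show "AE \<omega> in M. (\<lambda>n. (exp (- (s + g n) * X \<omega>) - exp (- s * X \<omega>)) / g n) \<longlonglongrightarrow> - X \<omega> * exp (- s * X \<omega>)"
    proof (rule AE_I2)
      fix \<omega>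
      have "((\<lambda>a. exp (- a * X \<omega>)) has_real_derivative - X \<omega> * exp (- s * X \<omega>)) (at s)"
        by (auto intro!: derivative_eq_intros)
      then show "(\<lambda>n. (exp (- (s + g n) * X \<omega>) - exp (- s * X \<omega>)) / g n) \<longlonglongrightarrow> - X \<omega> * exp (- s * X \<omega>)"
        unfolding DERIV_def tendsto_at_iff_sequentially using g by (auto simp: comp_def)
    qed
    show "AE \<omega> in M. norm ((exp (- (s + g n) * X \<omega>) - exp (- s * X \<omega>)) / g n) \<le> 2 / s" for n
    proof (rule AE_I2)
      fix \<omega> assume "\<omega> \<in> space M"
      define x where "x = X \<omega>"
      have x: "0 \<le> x" using pos \<open>\<omega> \<in> space M\<close> by (simp add: x_def)
      have "exp (- (s + g n) * x) - exp (- s * x) = exp (- s * x) * (exp (- g n * x) - 1)"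
        by (simp add: algebra_simps mult_exp_exp)
      then have "\<bar>exp (- (s + g n) * x) - exp (- s * x)\<bar> = exp (- s * x) * \<bar>exp (- g n * x) - 1\<bar>"
        by (simp add: abs_mult)
      also have "\<dots> \<le> exp (- s * x) * (\<bar>- g n * x\<bar> * exp \<bar>- g n * x\<bar>)"
        by (intro mult_left_mono abs_exp_minus_one_le) auto
      also have "\<dots> = \<bar>g n\<bar> * (x * exp (\<bar>g n\<bar> * x - s * x))"
        using x by (simp add: abs_mult exp_diff exp_minus field_simps)
      also have "\<dots> \<le> \<bar>g n\<bar> * (x * exp (- (s / 2 * x)))"
      proof -
        have "\<bar>g n\<bar> * x \<le> s / 2 * x" using g(3)[of n] x by (intro mult_right_mono) auto
        then show ?thesis using x by (intro mult_left_mono) auto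
      qed
      also have "x * exp (- (s / 2 * x)) \<le> 2 / s"
      proof -
        have "s / 2 * x \<le> exp (s / 2 * x)" using exp_ge_add_one_self[of "s / 2 * x"] by linarith
        then show ?thesis using s by (simp add: exp_minus field_simps)
      qed
      finally show "norm ((exp (- (s + g n) * X \<omega>) - exp (- s * X \<omega>)) / g n) \<le> 2 / s"
        using g(2)[of n] by (simp add: x_def field_simps abs_mult)
    qed
  qed (use s in auto)
  have E: "expectation (\<lambda>\<omega>. (exp (- (s + g n) * X \<omega>) - exp (- s * X \<omega>)) / g n)
     = (expectation (\<lambda>\<omega>. exp (- (s + g n) * X \<omega>)) - expectation (\<lambda>\<omega>. exp (- s * X \<omega>))) / g n" for n
    using g(3)[of n] s int[of "s + g n"] int[of s] by (subst integral_divide_zero, subst Bochner_Integration.integral_diff) auto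
  have "(\<lambda>n. (expectation (\<lambda>\<omega>. exp (- (s + g n) * X \<omega>)) - expectation (\<lambda>\<omega>. exp (- s * X \<omega>))) / g n)
     \<longlonglongrightarrow> expectation (\<lambda>\<omega>. - X \<omega> * exp (- s * X \<omega>))"
    by (rule Lim_transform_eventually[OF L]) (intro always_eventually allI E)
  then show "((\<lambda>ha. (expectation (\<lambda>\<omega>. exp (- (s + ha) * X \<omega>)) - expectation (\<lambda>\<omega>. exp (- s * X \<omega>))) / ha) \<circ> h)
     \<longlonglongrightarrow> expectation (\<lambda>\<omega>. - X \<omega> * exp (- s * X \<omega>))"
    unfolding g_def comp_def by (rule LIMSEQ_offset)
qed

context nonzero_subordinator
begin

lemma Phi_has_derivative:
  assumes "0 < s"
  shows "(\<Phi> has_real_derivative deriv \<Phi> s) (at s)" and "0 \<le> deriv \<Phi> s"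
proof -
  have "((\<lambda>a. - ln (expectation (\<lambda>\<omega>. exp (- a * \<xi> 1 \<omega>)))) has_real_derivative
     - (inverse (expectation (\<lambda>\<omega>. exp (- s * \<xi> 1 \<omega>))) * expectation (\<lambda>\<omega>. - \<xi> 1 \<omega> * exp (- s * \<xi> 1 \<omega>)))) (at s)"
    using assms laplace_xi_pos[of s 1]
    by (intro DERIV_minus DERIV_chain2[OF DERIV_ln laplace_has_derivative]) (auto simp: xi_nonneg)
  moreover have "\<Phi> = (\<lambda>a. - ln (expectation (\<lambda>\<omega>. exp (- a * \<xi> 1 \<omega>))))"
    by (rule ext) (rule laplace_exponent_def)
  ultimately have D: "(\<Phi> has_real_derivative
     - (inverse (expectation (\<lambda>\<omega>. exp (- s * \<xi> 1 \<omega>))) * expectation (\<lambda>\<omega>. - \<xi> 1 \<omega> * exp (- s * \<xi> 1 \<omega>)))) (at s)"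
    by (rule ssubst[rotated])
  show "(\<Phi> has_real_derivative deriv \<Phi> s) (at s)" unfolding DERIV_imp_deriv[OF D] by (rule D)
  have "0 \<le> expectation (\<lambda>\<omega>. \<xi> 1 \<omega> * exp (- s * \<xi> 1 \<omega>))"
    by (intro integral_nonneg_AE AE_I2) (simp add: xi_nonneg)
  then show "0 \<le> deriv \<Phi> s" unfolding DERIV_imp_deriv[OF D]
    using laplace_xi_pos[of s 1] assms by (simp add: mult_nonneg_nonneg)
qed

definition moment :: "nat \<Rightarrow> real" where
  "moment n = fact n / (\<Prod>k=1..n. \<Phi> (real k))"

lemma moment_pos: "0 < moment n"
  unfolding moment_def by (intro divide_pos_pos prod_pos) (auto intro: Phi_pos)

text \<open>Finiteness plays no part: where \<open>tail 0 \<omega>\<close> is infinite, the Lebesgue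
  integral defaults to 0 and so does \<open>enn2real\<close>.\<close>

lemma exp_functional_eq_tail: "\<omega> \<in> space M \<Longrightarrow> exp_functional \<xi> \<omega> = enn2real (tail 0 \<omega>)"
proof -
  assume "\<omega> \<in> space M"
  then have [measurable]: "(\<lambda>u. \<omega>) \<in> measurable borel M" by simp
  have "exp_functional \<xi> \<omega> = (\<integral>u. indicator {0..} u * exp (- \<xi> (max 0 u) \<omega>) \<partial>lborel)"
    unfolding exp_functional_def set_lebesgue_integral_def
    by (intro Bochner_Integration.integral_cong refl) (auto simp: indicator_def)
  also have "\<dots> = enn2real (\<integral>\<^sup>+u. ennreal (indicator {0..} u * exp (- \<xi> (max 0 u) \<omega>)) \<partial>lborel)"
    by (rule integral_eq_nn_integral) auto
  also have "(\<integral>\<^sup>+u. ennreal (indicator {0..} u * exp (- \<xi> (max 0 u) \<omega>)) \<partial>lborel) = tail 0 \<omega>"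
    unfolding tail_def by (intro nn_integral_cong) (auto simp: indicator_def)
  finally show ?thesis .
qed

lemma tail_zero_measurable[measurable]: "tail 0 \<in> borel_measurable M"
  by measurable

lemma exp_functional_measurable[measurable]: "exp_functional \<xi> \<in> borel_measurable M"
  by (subst measurable_cong[OF exp_functional_eq_tail]) auto

lemma tail_zero_moment: "(\<integral>\<^sup>+\<omega>. tail 0 \<omega> ^ n \<partial>M) = ennreal (moment n)"
  using tail_moment[of "\<lambda>_. 0" 0 "\<lambda>_. 0" n] by (simp add: moment_def monoI)

lemma tail_zero_finite: "AE \<omega> in M. tail 0 \<omega> \<noteq> \<infinity>"
  using tail_zero_moment[of 1] by (intro nn_integral_noteq_infinite) auto

lemma tail_zero_pos: "\<omega> \<in> space M \<Longrightarrow> 0 < tail 0 \<omega>"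
proof (rule ccontr)
  assume \<omega>: "\<omega> \<in> space M" and "\<not> 0 < tail 0 \<omega>"
  then have [measurable]: "(\<lambda>u. \<omega>) \<in> measurable borel M" by simp
  have "tail 0 \<omega> = 0" using \<open>\<not> 0 < tail 0 \<omega>\<close> by (simp add: zero_less_iff_neq_zero)
  then have "AE u in lborel. ennreal (exp (- \<xi> (max 0 u) \<omega>)) * indicator {0..} u = 0"
    unfolding tail_def by (subst (asm) nn_integral_0_iff_AE) auto
  then have "AE u in lborel. u \<notin> {0..(1::real)}"
    by eventually_elim (auto simp: indicator_def split: if_splits)
  then have "emeasure lborel {0..(1::real)} = 0"
    by (subst (asm) AE_iff_measurable[where N="{0..1}"]) auto
  then show False by simp
qed

lemma exp_functional_pos: "AE \<omega> in M. 0 < exp_functional \<xi> \<omega>"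
  using tail_zero_finite AE_space
proof eventually_elim
  case (elim \<omega>)
  then show ?case
    using tail_zero_pos[of \<omega>] exp_functional_eq_tail[of \<omega>] by (cases "tail 0 \<omega>") auto
qed

lemma exp_functional_moment: "(\<integral>\<^sup>+\<omega>. ennreal (exp_functional \<xi> \<omega> ^ n) \<partial>M) = ennreal (moment n)"
proof -
  have "(\<integral>\<^sup>+\<omega>. ennreal (exp_functional \<xi> \<omega> ^ n) \<partial>M) = (\<integral>\<^sup>+\<omega>. tail 0 \<omega> ^ n \<partial>M)"
  proof (intro nn_integral_cong_AE)
    show "AE \<omega> in M. ennreal (exp_functional \<xi> \<omega> ^ n) = tail 0 \<omega> ^ n"
      using tail_zero_finite AE_space
    proof eventually_elim
      case (elim \<omega>)
      then show ?case
        using exp_functional_eq_tail[of \<omega>] by (cases "tail 0 \<omega>") (auto simp: ennreal_power)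
    qed
  qed
  then show ?thesis by (simp add: tail_zero_moment)
qed

end

section \<open>Determinacy of laws by moments\<close>

text \<open>The series of exp (i h x) is integrated term by term. Its partial sums are dominated by
  exp (d |x| / 2), and the other half of the exponential moment absorbs the power of x. The radius
  d/2 depends on neither t nor n.\<close>

lemma fourier_moment_expansion:
  fixes M :: "real measure"
  assumes M: "real_distribution M" and exp_int: "integrable M (\<lambda>x. exp (d * \<bar>x\<bar>))" and d: "0 < d"
    and h: "\<bar>h\<bar> \<le> d / 2"
  shows "(\<lambda>k. (\<i> * of_real h) ^ k / fact k * (CLINT x|M. of_real (x ^ (n + k)) * iexp (t * x)))
     sums (CLINT x|M. of_real (x ^ n) * iexp ((t + h) * x))"
proof -
  interpret real_distribution M by fact
  have abs_bound: "\<bar>x\<bar> ^ m \<le> fact m * (2 / d) ^ m * exp (d / 2 * \<bar>x\<bar>)" for x :: real and m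
  proof -
    have "(\<lambda>n. (d / 2 * \<bar>x\<bar>) ^ n /\<^sub>R fact n) sums exp (d / 2 * \<bar>x\<bar>)" by (rule exp_converges)
    then have "(\<Sum>i\<in>{m}. (d / 2 * \<bar>x\<bar>) ^ i /\<^sub>R fact i) \<le> exp (d / 2 * \<bar>x\<bar>)"
      unfolding sums_iff using d by (metis (no_types, lifting) sum_le_suminf finite.emptyI finite.insertI abs_ge_zero divide_nonneg_nonneg
          less_imp_le mult_nonneg_nonneg scaleR_nonneg_nonneg zero_le_power inverse_nonnegative_iff_nonnegative fact_ge_zero zero_le_numeral)
    then have "(d / 2) ^ m * \<bar>x\<bar> ^ m \<le> fact m * exp (d / 2 * \<bar>x\<bar>)"
      by (simp add: field_simps)
    then have le: "(2 / d) ^ m * ((d / 2) ^ m * \<bar>x\<bar> ^ m) \<le> (2 / d) ^ m * (fact m * exp (d / 2 * \<bar>x\<bar>))"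
      using d by (intro mult_left_mono) auto
    have "\<bar>x\<bar> ^ m = (2 / d) ^ m * ((d / 2) ^ m * \<bar>x\<bar> ^ m)"
      using d by (simp add: power_mult_distrib[symmetric] mult.assoc[symmetric])
    also note le
    finally show ?thesis by (simp only: mult_ac)
  qed
  have dom_int: "integrable M (\<lambda>x. \<bar>x\<bar> ^ m * exp (d / 2 * \<bar>x\<bar>))" for m
  proof (rule Bochner_Integration.integrable_bound)
    show "integrable M (\<lambda>x. fact m * (2 / d) ^ m * exp (d * \<bar>x\<bar>))" using exp_int by simp
    have "\<bar>x\<bar> ^ m * exp (d / 2 * \<bar>x\<bar>) \<le> fact m * (2 / d) ^ m * exp (d / 2 * \<bar>x\<bar>) * exp (d / 2 * \<bar>x\<bar>)" for x
      by (intro mult_right_mono abs_bound) auto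
    then show "AE x in M. norm (\<bar>x\<bar> ^ m * exp (d / 2 * \<bar>x\<bar>)) \<le> norm (fact m * (2 / d) ^ m * exp (d * \<bar>x\<bar>))"
      using d by (intro AE_I2) (simp add: abs_mult mult.assoc mult_exp_exp)
  qed auto
  define f where "f k x = (\<i> * of_real h) ^ k / fact k * (complex_of_real (x ^ (n + k)) * iexp (t * x))" for k x
  have norm_f: "norm (f k x) = \<bar>x\<bar> ^ n * ((\<bar>h\<bar> * \<bar>x\<bar>) ^ k / fact k)" for k x
    by (simp add: f_def norm_mult norm_power norm_divide power_add power_mult_distrib norm_exp_i_times[of "t * x", simplified])
  have partial: "(\<Sum>k<N. norm (f k x)) \<le> \<bar>x\<bar> ^ n * exp (d / 2 * \<bar>x\<bar>)" for N x
  proof -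
    have "(\<Sum>k<N. (\<bar>h\<bar> * \<bar>x\<bar>) ^ k / fact k) \<le> exp (\<bar>h\<bar> * \<bar>x\<bar>)"
      unfolding exp_def scaleR_conv_of_real
      using summable_exp_generic[of "\<bar>h\<bar> * \<bar>x\<bar>"]
      by (simp add: divide_inverse mult.commute) (rule sum_le_suminf, auto simp: mult_ac)
    also have "\<dots> \<le> exp (d / 2 * \<bar>x\<bar>)" using mult_right_mono[OF h, of "\<bar>x\<bar>"] by simp
    finally show ?thesis unfolding norm_f sum_distrib_left[symmetric] by (intro mult_left_mono) auto
  qed
  have f_meas[measurable]: "f k \<in> borel_measurable M" for k unfolding f_def[abs_def] by measurable
  have f_int: "integrable M (f k)" for k
  proof (rule Bochner_Integration.integrable_bound[OF dom_int[of n]])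
    have "norm (f k x) \<le> (\<Sum>k<Suc k. norm (f k x))" for x
      by (simp add: sum_nonneg)
    then show "AE x in M. norm (f k x) \<le> norm (\<bar>x\<bar> ^ n * exp (d / 2 * \<bar>x\<bar>))"
      using order.trans[OF _ partial] by (intro AE_I2) (simp only: real_norm_def abs_mult power_abs abs_idempotent abs_exp_cancel, blast)
  qed simp
  have f_sums: "(\<lambda>k. f k x) sums (of_real (x ^ n) * iexp ((t + h) * x))" for x
  proof -
    have "(\<lambda>k. of_real (x ^ n) * iexp (t * x) * ((\<i> * of_real h * of_real x) ^ k /\<^sub>R fact k)) sums
       (of_real (x ^ n) * iexp (t * x) * exp (\<i> * of_real h * of_real x))"
      by (intro sums_mult exp_converges)
    moreover have "of_real (x ^ n) * iexp (t * x) * exp (\<i> * of_real h * of_real x) = of_real (x ^ n) * iexp ((t + h) * x)"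
      by (simp add: mult_exp_exp algebra_simps)
    moreover have "of_real (x ^ n) * iexp (t * x) * ((\<i> * of_real h * of_real x) ^ k /\<^sub>R fact k) = f k x" for k
      by (simp add: f_def power_add power_mult_distrib scaleR_conv_of_real field_simps)
    ultimately show ?thesis by (simp only:)
  qed
  have "(\<lambda>k. integral\<^sup>L M (f k)) sums (LINT x|M. (\<Sum>k. f k x))"
  proof (rule sums_integral[OF f_int])
    show "AE x in M. summable (\<lambda>k. norm (f k x))"
      by (intro AE_I2 summableI_nonneg_bounded[OF _ partial]) auto
    show "summable (\<lambda>k. LINT x|M. norm (f k x))"
    proof (rule summableI_nonneg_bounded)
      show "(\<Sum>k<N. LINT x|M. norm (f k x)) \<le> (LINT x|M. \<bar>x\<bar> ^ n * exp (d / 2 * \<bar>x\<bar>))" for N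
        unfolding Bochner_Integration.integral_sum[OF integrable_norm[OF f_int], symmetric]
        by (intro integral_mono Bochner_Integration.integrable_sum integrable_norm f_int dom_int partial)
    qed auto
  qed
  moreover have "(\<Sum>k. f k x) = of_real (x ^ n) * iexp ((t + h) * x)" for x
    using f_sums[of x] by (simp add: sums_iff)
  moreover have "integral\<^sup>L M (f k) = (\<i> * of_real h) ^ k / fact k * (CLINT x|M. of_real (x ^ (n + k)) * iexp (t * x))" for k
    unfolding f_def by (rule integral_mult_right_zero)
  ultimately show ?thesis by simp
qed

text \<open>Analytic continuation of the characteristic function along the real axis. Equality of
  all the integrals \<open>c M n\<close> at one point propagates by the expansion to every point
  within d/2; t is reached from 0 in N equal steps of that size. At 0 the integrals are the
  moments.\<close>

lemma moments_determine_distribution: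
  fixes M1 M2 :: "real measure"
  assumes M1: "real_distribution M1" "integrable M1 (\<lambda>x. exp (d * \<bar>x\<bar>))"
    and M2: "real_distribution M2" "integrable M2 (\<lambda>x. exp (d * \<bar>x\<bar>))"
    and d: "0 < d"
    and moments: "\<And>n. (LINT x|M1. x ^ n) = (LINT x|M2. x ^ n)"
  shows "M1 = M2"
proof (rule Levy_uniqueness[OF M1(1) M2(1)], rule ext)
  fix t
  define c where "c M n t = (CLINT x|M. of_real (x ^ n) * iexp (t * x))" for M n t
  obtain N :: nat where N: "2 * \<bar>t\<bar> / d < real N" using reals_Archimedean2 by blast
  have "0 \<le> 2 * \<bar>t\<bar> / d" using d by simp
  with N have "0 < real N" by linarith
  define h where "h = t / real N"
  have h: "\<bar>h\<bar> \<le> d / 2" using N \<open>0 < real N\<close> d by (simp add: h_def field_simps)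
  have "c M1 n (real j * h) = c M2 n (real j * h)" for n j
  proof (induction j arbitrary: n)
    case 0
    show ?case using moments[of n] by (simp add: c_def integral_complex_of_real del: of_real_power)
  next
    case (Suc j)
    have "(\<lambda>k. (\<i> * of_real h) ^ k / fact k * c M1 (n + k) (real j * h)) sums c M1 n (real j * h + h)"
      "(\<lambda>k. (\<i> * of_real h) ^ k / fact k * c M2 (n + k) (real j * h)) sums c M2 n (real j * h + h)"
      unfolding c_def using fourier_moment_expansion[OF M1 d h] fourier_moment_expansion[OF M2 d h] by blast+
    then show ?case using sums_unique2 by (simp add: Suc distrib_right add.commute) blast
  qed
  from this[of 0 N] have "c M1 0 t = c M2 0 t" using \<open>0 < real N\<close> by (simp add: h_def)
  then show "char M1 t = char M2 t" by (simp add: c_def char_def)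
qed

section \<open>Infinitely divisible laws with negative jumps\<close>

text \<open>The constant covers two regimes: exp 1 <= 3 in the Taylor remainder when |w| <= 1, and 1
  + 1 + |w| <= 3 |w| otherwise, where \<open>Re w \<le> 0\<close> bounds the exponential by
  1.\<close>

lemma norm_exp_minus_one_minus_le:
  fixes w :: complex
  assumes "Re w \<le> 0"
  shows "norm (exp w - 1 - w) \<le> 3 * (norm w)\<^sup>2"
proof (cases "norm w \<le> 1")
  case True
  have "norm (exp w - (\<Sum>k\<le>1. w ^ k / fact k)) \<le> exp \<bar>Re w\<bar> * norm w ^ Suc 1 / fact 1"
    by (rule Taylor_exp)
  moreover have "exp \<bar>Re w\<bar> \<le> exp 1"
    using True abs_Re_le_cmod[of w] by simp
  then have "exp \<bar>Re w\<bar> \<le> 3" using exp_le by linarith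
  then have "exp \<bar>Re w\<bar> * (norm w)\<^sup>2 \<le> 3 * (norm w)\<^sup>2" by (intro mult_right_mono) auto
  ultimately show ?thesis by (simp add: power2_eq_square algebra_simps)
next
  case False
  have "norm (exp w - 1 - w) \<le> norm (exp w) + norm (1::complex) + norm w"
    by (meson norm_triangle_ineq4 order.trans add_mono_thms_linordered_semiring(3))
  also have "\<dots> \<le> 1 + 1 + norm w" using assms by simp
  also have "\<dots> \<le> 3 * norm w" using False by simp
  also have "\<dots> \<le> 3 * (norm w)\<^sup>2" using False mult_left_mono[of 1 "norm w" "norm w"] by (simp add: power2_eq_square)
  finally show ?thesis .
qed

text \<open>The law of the sum of N independent copies of a variable with law
  h(y)/N dy plus an atom at 0, centred. To stay inside densities, the mass of the atom is spread
  over the unit interval, on which \<^term>\<open>\<lambda>y::real. min y 0\<close> vanishes.\<close>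

lemma compensated_compound_distribution:
  fixes h :: "real \<Rightarrow> real" and N :: nat
  assumes h[measurable]: "h \<in> borel_measurable borel" and h_nonneg: "\<And>y. 0 \<le> h y"
    and h_neg: "\<And>y. 0 \<le> y \<Longrightarrow> h y = 0"
    and int_h: "integrable lborel h" and int_yh: "integrable lborel (\<lambda>y. y * h y)"
    and N: "0 < N" "(LINT y|lborel. h y) \<le> real N"
  shows "\<exists>\<mu>. real_distribution \<mu> \<and> integrable \<mu> (\<lambda>y. y) \<and> (LINT y|\<mu>. y) = 0 \<and>
    (\<forall>s. 0 \<le> Re s \<longrightarrow> integrable \<mu> (\<lambda>y. exp (s * of_real y)) \<and>
      norm (1 + (CLINT y|lborel. (exp (s * of_real y) - 1) * of_real (h y)) / of_nat N) \<le> 1 \<and>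
      (CLINT y|\<mu>. exp (s * of_real y))
        = (1 + (CLINT y|lborel. (exp (s * of_real y) - 1) * of_real (h y)) / of_nat N) ^ N
          * exp (- s * of_real (LINT y|lborel. y * h y)))"
proof -
  define l where "l = (LINT y|lborel. h y)"
  define d where "d = - (LINT y|lborel. y * h y)"
  have l: "0 \<le> l" "l \<le> real N" using N h_nonneg by (auto simp: l_def)
  define p where "p y = h y / real N + (1 - l / real N) * indicator {0<..<1} y" for y
  have p_meas[measurable]: "p \<in> borel_measurable borel" unfolding p_def by measurable
  have p_nonneg: "0 \<le> p y" for y using h_nonneg l N by (auto simp: p_def)
  define P where "P = density lborel (\<lambda>y. ennreal (p y))"
  have space_P[simp]: "space P = UNIV" and sets_P[measurable_cong]: "sets P = sets borel"
    by (simp_all add: P_def)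
  have int_ind: "integrable lborel (indicator {0<..<1} :: real \<Rightarrow> real)" by simp
  have int_p: "integrable lborel p" unfolding p_def[abs_def] using int_h int_ind by simp
  interpret P: prob_space P
  proof
    have "emeasure P (space P) = (\<integral>\<^sup>+y. ennreal (p y) \<partial>lborel)"
      by (simp add: P_def emeasure_density)
    also have "\<dots> = ennreal (LINT y|lborel. p y)"
      using int_p p_nonneg by (intro nn_integral_eq_integral) auto
    also have "(LINT y|lborel. p y) = l / real N + (1 - l / real N) * 1"
      unfolding p_def using int_h int_ind by (simp add: l_def)
    finally show "emeasure P (space P) = 1" using N by simp
  qed
  define Z where "Z y = min y (0::real)" for y
  have Z_meas[measurable]: "Z \<in> borel_measurable borel" unfolding Z_def by measurable
  have P_integral: "integrable P (\<lambda>y. F (Z y)) \<and>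
      (LINT y|P. F (Z y)) = (LINT y|lborel. h y *\<^sub>R F y) /\<^sub>R real N + (1 - l / real N) *\<^sub>R F 0"
    if F[measurable]: "F \<in> borel_measurable borel" and int: "integrable lborel (\<lambda>y. h y *\<^sub>R F y)"
    for F :: "real \<Rightarrow> 'b::{banach, second_countable_topology}"
  proof -
    have eq: "p y *\<^sub>R F (Z y) = (h y *\<^sub>R F y) /\<^sub>R real N + (1 - l / real N) *\<^sub>R (indicator {0<..<1} y *\<^sub>R F 0)" for y
      using h_neg[of y] by (cases "0 \<le> y") (auto simp: p_def Z_def min_def indicator_def divide_inverse algebra_simps)
    have int2: "integrable lborel (\<lambda>y. indicator {0<..<1::real} y *\<^sub>R F 0)" using int_ind by simp
    have lin: "integrable lborel (\<lambda>y. G y /\<^sub>R real N + c *\<^sub>R H y) \<and>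
       (LINT y|lborel. G y /\<^sub>R real N + c *\<^sub>R H y) = (LINT y|lborel. G y) /\<^sub>R real N + c *\<^sub>R (LINT y|lborel. H y)"
      if "integrable lborel G" "integrable lborel H" for G H :: "real \<Rightarrow> 'b" and c
      using that by simp
    have "(LINT y|lborel. indicator {0<..<1::real} y *\<^sub>R F 0) = F 0" using int_ind by simp
    then have "integrable lborel (\<lambda>y. p y *\<^sub>R F (Z y)) \<and>
       (LINT y|lborel. p y *\<^sub>R F (Z y)) = (LINT y|lborel. h y *\<^sub>R F y) /\<^sub>R real N + (1 - l / real N) *\<^sub>R F 0"
      unfolding eq using lin[OF int int2, of "1 - l / real N"] by (simp only:)
    then show ?thesis
      unfolding P_def using p_nonneg by (simp add: integrable_density integral_density)
  qed
  interpret PP: product_prob_space "\<lambda>_::nat. P" "{..<N}" by unfold_locales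
  have Q: "prob_space (PiM {..<N} (\<lambda>_. P))" by (rule prob_space_PiM) unfold_locales
  define Y where "Y \<omega> = (\<Sum>i<N. Z (\<omega> i)) + d" for \<omega> :: "nat \<Rightarrow> real"
  have Y_meas[measurable]: "Y \<in> borel_measurable (PiM {..<N} (\<lambda>_. P))" unfolding Y_def[abs_def] by measurable
  define \<mu> where "\<mu> = distr (PiM {..<N} (\<lambda>_. P)) borel Y"
  have \<mu>: "real_distribution \<mu>" unfolding \<mu>_def by (rule PP.real_distribution_distr) measurable
  have comp: "integrable (PiM {..<N} (\<lambda>_. P)) (\<lambda>\<omega>. Z (\<omega> i)) \<and>
      (LINT \<omega>|PiM {..<N} (\<lambda>_. P). Z (\<omega> i)) = (LINT y|lborel. y * h y) / real N" if i: "i < N" for i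
  proof -
    have D: "distr (PiM {..<N} (\<lambda>_. P)) P (\<lambda>\<omega>. \<omega> i) = P"
      using distr_PiM_component[of "{..<N}" "\<lambda>_. P" i] i P.prob_space_axioms by auto
    have "integrable P Z \<and> (LINT y|P. Z y) = (LINT y|lborel. y * h y) / real N"
      using P_integral[of "\<lambda>y. y"] int_yh by (simp add: mult.commute divide_inverse)
    moreover have "integrable P Z = integrable (PiM {..<N} (\<lambda>_. P)) (\<lambda>\<omega>. Z (\<omega> i))"
      by (subst D[symmetric], subst integrable_distr_eq) (use i in auto)
    moreover have "(LINT y|P. Z y) = (LINT \<omega>|PiM {..<N} (\<lambda>_. P). Z (\<omega> i))"
      by (subst D[symmetric], subst integral_distr) (use i in auto)
    ultimately show ?thesis by simp
  qed
  have mean: "integrable \<mu> (\<lambda>y. y)" "(LINT y|\<mu>. y) = 0"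
  proof -
    have "integrable (PiM {..<N} (\<lambda>_. P)) Y"
      unfolding Y_def[abs_def] using comp by (intro Bochner_Integration.integrable_add Bochner_Integration.integrable_sum) auto
    then show "integrable \<mu> (\<lambda>y. y)" unfolding \<mu>_def by (subst integrable_distr_eq) auto
    have "(LINT y|\<mu>. y) = (LINT \<omega>|PiM {..<N} (\<lambda>_. P). Y \<omega>)"
      unfolding \<mu>_def by (subst integral_distr) auto
    also have "\<dots> = (\<Sum>i<N. (LINT y|lborel. y * h y) / real N) + d"
      unfolding Y_def using comp
      by (subst Bochner_Integration.integral_add, auto simp: prob_space.prob_space[OF Q])
    also have "\<dots> = 0" using N by (simp add: d_def)
    finally show "(LINT y|\<mu>. y) = 0" .
  qed
  have "integrable \<mu> (\<lambda>y. exp (s * of_real y)) \<and>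
      norm (1 + (CLINT y|lborel. (exp (s * of_real y) - 1) * of_real (h y)) / of_nat N) \<le> 1 \<and>
      (CLINT y|\<mu>. exp (s * of_real y))
        = (1 + (CLINT y|lborel. (exp (s * of_real y) - 1) * of_real (h y)) / of_nat N) ^ N
          * exp (- s * of_real (LINT y|lborel. y * h y))"
    if s: "0 \<le> Re s" for s
  proof -
    let ?z = "CLINT y|lborel. (exp (s * of_real y) - 1) * of_real (h y)"
    have norm_le: "norm (exp (s * of_real y)) \<le> 1" if "y \<le> 0" for y
      using s that by (simp add: mult_nonneg_nonpos)
    have int: "integrable lborel (\<lambda>y. h y *\<^sub>R exp (s * of_real y))"
    proof (rule Bochner_Integration.integrable_bound[OF int_h])
      show "AE y in lborel. norm (h y *\<^sub>R exp (s * of_real y)) \<le> norm (h y)"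
      proof (rule AE_I2)
        fix y show "norm (h y *\<^sub>R exp (s * of_real y)) \<le> norm (h y)"
          using norm_le[of y] h_neg[of y] h_nonneg[of y] mult_left_mono[OF norm_le[of y], of "h y"]
          by (cases "0 \<le> y") auto
      qed
    qed simp
    have int_c: "integrable lborel (\<lambda>y. complex_of_real (h y))" using int_h by simp
    have "?z = (CLINT y|lborel. h y *\<^sub>R exp (s * of_real y) - of_real (h y))"
      by (intro Bochner_Integration.integral_cong) (auto simp: algebra_simps scaleR_conv_of_real)
    also have "\<dots> = (CLINT y|lborel. h y *\<^sub>R exp (s * of_real y)) - of_real l"
      using int int_c by (simp add: l_def)
    finally have z: "(CLINT y|lborel. h y *\<^sub>R exp (s * of_real y)) = ?z + of_real l" by simp
    have alg: "(w + of_real l) /\<^sub>R real N + (1 - l / real N) *\<^sub>R 1 = 1 + w / of_nat N" for w :: complex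
      using N by (simp add: scaleR_conv_of_real field_simps)
    have "integrable P (\<lambda>y. exp (s * of_real (Z y))) \<and>
      (CLINT y|P. exp (s * of_real (Z y))) = (?z + of_real l) /\<^sub>R real N + (1 - l / real N) *\<^sub>R exp (s * of_real 0)"
      unfolding z[symmetric] by (rule P_integral[OF _ int]) simp
    then have E: "integrable P (\<lambda>y. exp (s * of_real (Z y)))"
      "(CLINT y|P. exp (s * of_real (Z y))) = 1 + ?z / of_nat N"
      using alg[of ?z] by (simp_all only: of_real_0 mult_zero_right exp_zero)
    have "norm (CLINT y|P. exp (s * of_real (Z y))) \<le> (LINT y|P. norm (exp (s * of_real (Z y))))"
      by (rule integral_norm_bound)
    \<comment> \<open>\<open>1 + ?z / of_nat N\<close> is the transform of one uncentred summand,
      which is nonpositive, so its modulus is at most 1 when \<open>Re s \<ge> 0\<close>. This bound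
      later allows N-th powers to be compared with a loss of a factor N only.\<close>
    also have "\<dots> \<le> (LINT y|P. 1)"
      using E(1) norm_le[of "Z _"] by (intro integral_mono integrable_norm) (simp_all only: Z_def min.cobounded2 P.integrable_const)
    finally have n: "norm (1 + ?z / of_nat N) \<le> 1" using E(2) P.prob_space by simp
    have exp_Y: "exp (s * of_real (Y \<omega>)) = (\<Prod>i<N. exp (s * of_real (Z (\<omega> i)))) * exp (s * of_real d)" for \<omega>
      by (simp add: Y_def exp_sum[symmetric] mult_exp_exp sum_distrib_left algebra_simps)
    have I: "integrable (PiM {..<N} (\<lambda>_. P)) (\<lambda>\<omega>. \<Prod>i<N. exp (s * of_real (Z (\<omega> i))))"
      using E(1) by (intro PP.product_integrable_prod) auto
    then have "integrable (PiM {..<N} (\<lambda>_. P)) (\<lambda>\<omega>. exp (s * of_real (Y \<omega>)))"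
      unfolding exp_Y by simp
    then have i: "integrable \<mu> (\<lambda>y. exp (s * of_real y))"
      unfolding \<mu>_def by (subst integrable_distr_eq) auto
    have "(CLINT y|\<mu>. exp (s * of_real y)) = (CLINT \<omega>|PiM {..<N} (\<lambda>_. P). exp (s * of_real (Y \<omega>)))"
      unfolding \<mu>_def by (subst integral_distr) auto
    also have "\<dots> = (\<Prod>i<N. CLINT y|P. exp (s * of_real (Z y))) * exp (s * of_real d)"
      unfolding exp_Y using E(1) by (subst integral_mult_left_zero, subst PP.product_integral_prod) auto
    also have "\<dots> = (1 + ?z / of_nat N) ^ N * exp (- s * of_real (LINT y|lborel. y * h y))"
      unfolding E(2) by (simp add: d_def)
    finally show ?thesis using i n by blast
  qed
  with \<mu> mean show ?thesis by blast
qed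

text \<open>Weak convergence handles bounded functions only. Truncating exp (a y) at k costs at most
  exp (2 a y) / k, so the bound \<open>B\<close> makes the error uniform in n; monotone convergence
  then removes k.\<close>

lemma weak_conv_exp_moment:
  fixes \<mu> :: "nat \<Rightarrow> real measure" and M :: "real measure"
  assumes dist: "\<And>n. real_distribution (\<mu> n)" "real_distribution M" and weak: "weak_conv_m \<mu> M"
    and int: "\<And>n. integrable (\<mu> n) (\<lambda>y. exp (a * y))" and int2: "\<And>n. integrable (\<mu> n) (\<lambda>y. exp (2 * a * y))"
    and B: "\<And>n. (LINT y|\<mu> n. exp (2 * a * y)) \<le> B"
    and L: "(\<lambda>n. LINT y|\<mu> n. exp (a * y)) \<longlonglongrightarrow> L"
  shows "integrable M (\<lambda>y. exp (a * y)) \<and> (LINT y|M. exp (a * y)) = L"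
proof -
  interpret M: real_distribution M by fact
  define f where "f k y = min (exp (a * y)) (real k)" for k :: nat and y
  have f_meas[measurable]: "f k \<in> borel_measurable borel" for k unfolding f_def by measurable
  have f_range: "0 \<le> f k y" "f k y \<le> real k" "f k y \<le> exp (a * y)" for k y by (auto simp: f_def)
  have f_conv: "(\<lambda>n. LINT y|\<mu> n. f k y) \<longlonglongrightarrow> (LINT y|M. f k y)" for k
  proof (rule weak_conv_imp_integral_bdd_continuous_conv[OF dist weak])
    show "isCont (f k) y" for y unfolding f_def[abs_def] by (intro continuous_intros)
    show "norm (f k y) \<le> real k" for y using f_range[of k y] by simp
  qed
  have f_int: "integrable M (f k)" for k
    by (rule M.integrable_const_bound[where B="real k"]) (use f_range in auto)
  have close: "\<bar>(LINT y|M. f k y) - L\<bar> \<le> B / real k" if k: "0 < k" for k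
  proof (rule tendsto_upperbound)
    show "(\<lambda>n. \<bar>(LINT y|\<mu> n. f k y) - (LINT y|\<mu> n. exp (a * y))\<bar>) \<longlonglongrightarrow> \<bar>(LINT y|M. f k y) - L\<bar>"
      by (intro tendsto_intros f_conv L)
    show "\<forall>\<^sub>F n in sequentially. \<bar>(LINT y|\<mu> n. f k y) - (LINT y|\<mu> n. exp (a * y))\<bar> \<le> B / real k"
    proof (rule always_eventually, rule allI)
      fix n
      interpret \<mu>: real_distribution "\<mu> n" by fact
      have fi: "integrable (\<mu> n) (f k)"
        by (rule \<mu>.integrable_const_bound[where B="real k"]) (use f_range in auto)
      have pt: "exp (a * y) - f k y \<le> exp (2 * a * y) / real k" for y
      proof (cases "exp (a * y) \<le> real k")
        case False
        then have "exp (a * y) - f k y \<le> exp (a * y) * 1" using f_range[of k y] by simp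
        also have "\<dots> \<le> exp (a * y) * (exp (a * y) / real k)"
          using False k by (intro mult_left_mono) auto
        also have "\<dots> = exp (2 * a * y) / real k" by (simp add: mult_exp_exp)
        finally show ?thesis .
      qed (simp add: f_def)
      have "\<bar>(LINT y|\<mu> n. f k y) - (LINT y|\<mu> n. exp (a * y))\<bar> = (LINT y|\<mu> n. exp (a * y) - f k y)"
      proof -
        have "(LINT y|\<mu> n. f k y) \<le> (LINT y|\<mu> n. exp (a * y))"
          using fi int[of n] f_range by (intro integral_mono)
        then show ?thesis using fi int[of n] by simp
      qed
      also have "\<dots> \<le> (LINT y|\<mu> n. exp (2 * a * y) / real k)"
        using fi int[of n] int2[of n] pt by (intro integral_mono) auto
      also have "\<dots> \<le> B / real k" using B[of n] k by (simp add: divide_right_mono)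
      finally show "\<bar>(LINT y|\<mu> n. f k y) - (LINT y|\<mu> n. exp (a * y))\<bar> \<le> B / real k" .
    qed
  qed simp
  have lim: "(\<lambda>k. LINT y|M. f k y) \<longlonglongrightarrow> L"
  proof -
    have "(\<lambda>k. (LINT y|M. f k y) - L) \<longlonglongrightarrow> 0"
    proof (rule Lim_null_comparison)
      show "\<forall>\<^sub>F k in sequentially. norm ((LINT y|M. f k y) - L) \<le> B / real k"
        using eventually_gt_at_top[of "0::nat"] by eventually_elim (use close in auto)
      show "(\<lambda>k. B / real k) \<longlonglongrightarrow> 0" by real_asymp
    qed
    then show ?thesis by (simp add: LIM_zero_iff)
  qed
  have ptlim: "(\<lambda>k. f k y) \<longlonglongrightarrow> exp (a * y)" for y
  proof (rule tendsto_eventually)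
    obtain K :: nat where "exp (a * y) \<le> real K" using real_arch_simple by blast
    then show "\<forall>\<^sub>F k in sequentially. f k y = exp (a * y)"
      by (intro eventually_sequentiallyI[of K]) (simp add: f_def)
  qed
  have "mono (\<lambda>k. f k y)" for y by (auto simp: mono_def f_def)
  then show ?thesis
    using integrable_monotone_convergence[OF f_int _ _ lim, of "\<lambda>y. exp (a * y)"]
      integral_monotone_convergence[OF f_int _ _ lim, of "\<lambda>y. exp (a * y)"] ptlim by auto
qed

lemma tight_if_abs_moment_bounded:
  fixes \<mu> :: "nat \<Rightarrow> real measure"
  assumes dist: "\<And>n. real_distribution (\<mu> n)" and int: "\<And>n. integrable (\<mu> n) (\<lambda>y. y)"
    and B: "\<And>n. (LINT y|\<mu> n. \<bar>y\<bar>) \<le> B"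
  shows "tight \<mu>"
  unfolding tight_def
proof (intro conjI allI impI dist)
  fix \<epsilon> :: real assume \<epsilon>: "0 < \<epsilon>"
  have "0 \<le> (LINT y|\<mu> 0. \<bar>y\<bar>)" by simp
  then have B0: "0 \<le> B" using B[of 0] by linarith
  \<comment> \<open>The added 1 keeps \<open>c\<close> positive when \<open>B\<close> is 0 and makes
    \<open>B / c < \<epsilon>\<close> strict.\<close>
  define c where "c = (B + 1) / \<epsilon>"
  have c: "0 < c" using B0 \<epsilon> by (simp add: c_def)
  have "1 - \<epsilon> < measure (\<mu> n) {-c<..c}" for n
  proof -
    interpret real_distribution "\<mu> n" by fact
    have "prob {y \<in> space (\<mu> n). c \<le> \<bar>y\<bar>} \<le> (LINT y|\<mu> n. \<bar>y\<bar>) / c"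
      using int[of n] c by (intro integral_Markov_inequality_measure[where A="{}"]) auto
    also have "\<dots> \<le> B / c" using B[of n] c by (intro divide_right_mono) auto
    also have "\<dots> < \<epsilon>" using \<epsilon> B0 by (simp add: c_def field_simps)
    finally have "prob {y. c \<le> \<bar>y\<bar>} < \<epsilon>" by simp
    moreover have "prob (UNIV - {y. c \<le> \<bar>y\<bar>}) = 1 - prob {y. c \<le> \<bar>y\<bar>}"
      using prob_compl[of "{y. c \<le> \<bar>y\<bar>}"] by simp
    moreover have "prob (UNIV - {y. c \<le> \<bar>y\<bar>}) \<le> prob {-c<..c}"
      by (intro finite_measure_mono) auto
    ultimately show ?thesis by linarith
  qed
  then show "\<exists>a b. a < b \<and> (\<forall>n. 1 - \<epsilon> < measure (\<mu> n) {a<..b})"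
    using c by (intro exI[of _ "-c"] exI[of _ c]) auto
qed

text \<open>Cutting \<open>h\<close> off near 0 makes both \<open>g j\<close> and y times
  \<open>g j\<close> integrable, so that centred compound sums exist. The cutoff and the number of
  summands vary together along one index j. The half plane \<open>0 \<le> Re s\<close> contains the
  imaginary axis, for characteristic functions, and the nonnegative reals, for exponential
  moments.\<close>

lemma infinitely_divisible_approximation:
  fixes h :: "real \<Rightarrow> real"
  assumes h[measurable]: "h \<in> borel_measurable borel" and h_nonneg: "\<And>y. 0 \<le> h y"
    and h_neg: "\<And>y. 0 \<le> y \<Longrightarrow> h y = 0"
    and int: "integrable lborel (\<lambda>y. y\<^sup>2 * h y)"
  obtains \<mu> where "\<And>j::nat. real_distribution (\<mu> j)" "\<And>j. integrable (\<mu> j) (\<lambda>y. y)" "\<And>j. (LINT y|\<mu> j. y) = 0"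
    "\<And>j s. 0 \<le> Re s \<Longrightarrow> integrable (\<mu> j) (\<lambda>y. exp (s * of_real y))"
    "\<And>s. 0 \<le> Re s \<Longrightarrow> (\<lambda>j. CLINT y|\<mu> j. exp (s * of_real y))
        \<longlonglongrightarrow> exp (CLINT y|lborel. (exp (s * of_real y) - 1 - s * of_real y) * of_real (h y))"
proof -
  define g where "g j y = indicator {..- 1 / real (Suc j)} y * h y" for j y
  have g_meas[measurable]: "g j \<in> borel_measurable borel" for j unfolding g_def[abs_def] by measurable
  have g_nonneg: "0 \<le> g j y" and g_neg: "0 \<le> y \<Longrightarrow> g j y = 0" and g_le: "g j y \<le> h y" for j y
    using h_nonneg[of y] h_neg[of y] by (auto simp: g_def indicator_def)
  have away: "1 \<le> real (Suc j) * \<bar>y\<bar>" if "g j y \<noteq> 0" for j y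
  proof -
    have "y \<le> - 1 / real (Suc j)" using that by (auto simp: g_def indicator_def split: if_splits)
    then have "1 / real (Suc j) \<le> \<bar>y\<bar>" by simp
    then show ?thesis by (simp add: field_simps)
  qed
  have gy_le: "\<bar>y\<bar> * g j y \<le> real (Suc j) * (y\<^sup>2 * h y)" for j y
  proof (cases "g j y = 0")
    case False
    have "\<bar>y\<bar> * g j y \<le> (real (Suc j) * \<bar>y\<bar>) * (\<bar>y\<bar> * g j y)"
      using mult_right_mono[OF away[OF False], of "\<bar>y\<bar> * g j y"] g_nonneg[of j y] by simp
    also have "\<dots> = real (Suc j) * (y\<^sup>2 * g j y)" by (simp add: power2_eq_square mult_ac abs_mult_self_eq)
    also have "\<dots> \<le> real (Suc j) * (y\<^sup>2 * h y)" using g_le by (intro mult_left_mono) auto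
    finally show ?thesis .
  qed (use h_nonneg in auto)
  have g_le2: "g j y \<le> (real (Suc j))\<^sup>2 * (y\<^sup>2 * h y)" for j y
  proof (cases "g j y = 0")
    case False
    have "g j y \<le> real (Suc j) * (\<bar>y\<bar> * g j y)"
      using mult_right_mono[OF away[OF False], of "g j y"] g_nonneg[of j y] by (simp add: mult.assoc)
    also have "\<dots> \<le> real (Suc j) * (real (Suc j) * (y\<^sup>2 * h y))" using gy_le by (intro mult_left_mono) auto
    finally show ?thesis by (simp add: power2_eq_square mult.assoc)
  qed (use h_nonneg in auto)
  have int_g: "integrable lborel (g j)" for j
    by (rule Bochner_Integration.integrable_bound[OF integrable_mult_right[OF int, of "(real (Suc j))\<^sup>2"]])
      (use g_le2 g_nonneg h_nonneg in \<open>auto simp: abs_mult simp del: of_nat_Suc\<close>)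
  have int_yg: "integrable lborel (\<lambda>y. y * g j y)" for j
    by (rule Bochner_Integration.integrable_bound[OF integrable_mult_right[OF int, of "real (Suc j)"]])
      (use gy_le g_nonneg h_nonneg in \<open>auto simp: abs_mult simp del: of_nat_Suc\<close>)
  define l where "l j = (LINT y|lborel. g j y)" for j
  define d where "d j = - (LINT y|lborel. y * g j y)" for j
  have l_nonneg: "0 \<le> l j" for j unfolding l_def by (intro integral_nonneg_AE) (simp add: g_nonneg)
  have d_nonneg: "0 \<le> d j" for j
  proof -
    have "0 \<le> (LINT y|lborel. - (y * g j y))"
    proof (intro integral_nonneg_AE AE_I2)
      fix y show "0 \<le> - (y * g j y)"
        using g_nonneg[of j y] g_neg[of y j] by (cases "0 \<le> y") (auto simp: mult_nonpos_nonneg)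
    qed
    then show ?thesis using int_yg by (simp add: d_def)
  qed
  \<comment> \<open>The compensators \<^term>\<open>d j\<close> may diverge; \<^term>\<open>N j\<close> is taken so large that the error of
    \<open>(1 + z/N)^N\<close> against \<open>exp z\<close> still vanishes after multiplication by \<open>exp (s d)\<close>.\<close>
  define N where "N j = nat \<lceil>1 + l j + real (Suc j) * (l j)\<^sup>2 * exp (real j * d j)\<rceil>" for j
  have N_ge: "1 + l j + real (Suc j) * (l j)\<^sup>2 * exp (real j * d j) \<le> real (N j)" for j
    unfolding N_def by (rule real_nat_ceiling_ge)
  have "0 \<le> real (Suc j) * (l j)\<^sup>2 * exp (real j * d j)" for j by simp
  then have N_l: "l j + 1 \<le> real (N j)" and N_b: "real (Suc j) * (l j)\<^sup>2 * exp (real j * d j) \<le> real (N j)" for j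
    using N_ge[of j] l_nonneg[of j] by (smt (verit))+
  have N_pos: "0 < N j" for j using N_l[of j] l_nonneg[of j] by linarith
  define z where "z j s = (CLINT y|lborel. (exp (s * of_real y) - 1) * of_real (g j y))" for j s
  have "\<exists>\<mu>. \<forall>j. real_distribution (\<mu> j) \<and> integrable (\<mu> j) (\<lambda>y. y) \<and> (LINT y|\<mu> j. y) = 0 \<and>
    (\<forall>s. 0 \<le> Re s \<longrightarrow> integrable (\<mu> j) (\<lambda>y. exp (s * of_real y)) \<and>
      norm (1 + z j s / of_nat (N j)) \<le> 1 \<and>
      (CLINT y|\<mu> j. exp (s * of_real y)) = (1 + z j s / of_nat (N j)) ^ N j * exp (- s * of_real (LINT y|lborel. y * g j y)))"
    unfolding z_def
    by (intro choice allI compensated_compound_distribution g_nonneg g_neg int_g int_yg N_pos g_meas)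
      (use N_l l_def in \<open>smt (verit)\<close>)+
  then obtain \<mu> where M: "\<forall>j. real_distribution (\<mu> j) \<and> integrable (\<mu> j) (\<lambda>y. y) \<and> (LINT y|\<mu> j. y) = 0 \<and>
    (\<forall>s. 0 \<le> Re s \<longrightarrow> integrable (\<mu> j) (\<lambda>y. exp (s * of_real y)) \<and>
      norm (1 + z j s / of_nat (N j)) \<le> 1 \<and>
      (CLINT y|\<mu> j. exp (s * of_real y)) = (1 + z j s / of_nat (N j)) ^ N j * exp (- s * of_real (LINT y|lborel. y * g j y)))"
    by (rule exE)
  have \<mu>: "real_distribution (\<mu> j)" "integrable (\<mu> j) (\<lambda>y. y)" "(LINT y|\<mu> j. y) = 0"
    "0 \<le> Re s \<Longrightarrow> integrable (\<mu> j) (\<lambda>y. exp (s * of_real y))"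
    "0 \<le> Re s \<Longrightarrow> norm (1 + z j s / of_nat (N j)) \<le> 1"
    "0 \<le> Re s \<Longrightarrow> (CLINT y|\<mu> j. exp (s * of_real y))
        = (1 + z j s / of_nat (N j)) ^ N j * exp (- s * of_real (LINT y|lborel. y * g j y))" for j s
    using spec[OF M, of j] by (simp_all only: simp_thms)
  have "(\<lambda>j. CLINT y|\<mu> j. exp (s * of_real y))
        \<longlonglongrightarrow> exp (CLINT y|lborel. (exp (s * of_real y) - 1 - s * of_real y) * of_real (h y))"
    if s: "0 \<le> Re s" for s
  proof -
    let ?k = "\<lambda>y. exp (s * of_real y) - 1 - s * complex_of_real y"
    have norm_le: "norm (exp (s * of_real y)) \<le> 1" if "y \<le> 0" for y
      using s that by (simp add: mult_nonneg_nonpos)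
    have k_le: "norm (?k y) \<le> 3 * (norm s)\<^sup>2 * y\<^sup>2" if "y \<le> 0" for y
      using norm_exp_minus_one_minus_le[of "s * of_real y"] s that
      by (simp add: mult_nonneg_nonpos norm_mult power_mult_distrib)
    have int_e: "integrable lborel (\<lambda>y. (exp (s * of_real y) - 1) * of_real (g j y))"
      and z_le: "norm (z j s) \<le> 2 * l j" for j
    proof -
      have pt: "norm ((exp (s * of_real y) - 1) * of_real (g j y)) \<le> 2 * g j y" for y
      proof (cases "0 \<le> y")
        case False
        have "norm (exp (s * of_real y) - 1) \<le> norm (exp (s * of_real y)) + norm (1::complex)"
          by (rule norm_triangle_ineq4)
        also have "\<dots> \<le> 2" using norm_le[of y] False by simp
        finally show ?thesis using g_nonneg[of j y] by (simp add: norm_mult mult_right_mono)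
      qed (simp add: g_neg)
      show i: "integrable lborel (\<lambda>y. (exp (s * of_real y) - 1) * of_real (g j y))"
        by (rule Bochner_Integration.integrable_bound[OF integrable_mult_right[OF int_g, of 2]])
          (use pt g_nonneg in \<open>auto simp: abs_mult\<close>)
      have "norm (z j s) \<le> (LINT y|lborel. norm ((exp (s * of_real y) - 1) * of_real (g j y)))"
        unfolding z_def by (rule integral_norm_bound)
      also have "\<dots> \<le> (LINT y|lborel. 2 * g j y)"
        using pt i int_g[of j] by (intro integral_mono integrable_norm) auto
      finally show "norm (z j s) \<le> 2 * l j" by (simp add: l_def)
    qed
    have z_Re: "Re (z j s) \<le> 0" for j
    proof -
      have "0 \<le> (LINT y|lborel. - Re ((exp (s * of_real y) - 1) * of_real (g j y)))"
      proof (intro integral_nonneg_AE AE_I2)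
        fix y
        have "Re (exp (s * of_real y) - 1) \<le> 0" if "y \<le> 0"
        proof -
          have "Re (exp (s * of_real y)) \<le> 1"
            using norm_le[OF that] complex_Re_le_cmod order.trans by blast
          then show ?thesis by (simp only: minus_complex.simps one_complex.simps)
        qed
        then show "0 \<le> - Re ((exp (s * of_real y) - 1) * of_real (g j y))"
          using g_nonneg[of j y] g_neg[of y j] mult_nonpos_nonneg[of "Re (exp (s * of_real y) - 1)" "g j y"]
          by (cases "0 \<le> y") (simp_all del: Re_exp)
      qed
      also have "\<dots> = - Re (z j s)"
        unfolding z_def by (simp only: Bochner_Integration.integral_minus integral_Re[OF int_e])
      finally show ?thesis by simp
    qed
    define E where "E j = exp (z j s + s * of_real (d j))" for j
    \<comment> \<open>Neither summand on the left need converge as j grows. Together they carry the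
      compensated kernel \<open>?k\<close>, which is of order y^2 and hence dominated uniformly in
      j.\<close>
    have E_eq: "z j s + s * of_real (d j) = (CLINT y|lborel. ?k y * of_real (g j y))" for j
    proof -
      have "integrable lborel (\<lambda>y. complex_of_real (y * g j y))" using int_yg by (rule integrable_of_real)
      then have i2: "integrable lborel (\<lambda>y. s * complex_of_real (y * g j y))" by simp
      have "(CLINT y|lborel. ?k y * of_real (g j y))
          = (CLINT y|lborel. (exp (s * of_real y) - 1) * of_real (g j y) - s * of_real (y * g j y))"
        by (intro Bochner_Integration.integral_cong) (auto simp: algebra_simps)
      also have "\<dots> = z j s - s * of_real (LINT y|lborel. y * g j y)"
        unfolding z_def using int_e[of j] i2 int_yg[of j]
        by (subst Bochner_Integration.integral_diff) (auto simp del: of_real_mult)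
      finally show ?thesis by (simp add: d_def)
    qed
    have E_lim: "E \<longlonglongrightarrow> exp (CLINT y|lborel. ?k y * of_real (h y))"
      unfolding E_def E_eq
    proof (intro tendsto_exp integral_dominated_convergence[where w="\<lambda>y. 3 * (norm s)\<^sup>2 * (y\<^sup>2 * h y)"])
      show "integrable lborel (\<lambda>y. 3 * (norm s)\<^sup>2 * (y\<^sup>2 * h y))" using int by simp
      show "AE y in lborel. (\<lambda>j. ?k y * complex_of_real (g j y)) \<longlonglongrightarrow> ?k y * complex_of_real (h y)"
      proof (intro AE_I2 tendsto_intros)
        fix y
        show "(\<lambda>j. g j y) \<longlonglongrightarrow> h y"
        proof (cases "0 \<le> y")
          case False
          then have "0 < - y" by simp
          then obtain K :: nat where K: "1 < real K * (- y)" using reals_Archimedean3 by blast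
          have "g j y = h y" if "K \<le> j" for j
          proof -
            have "real K * (- y) \<le> real (Suc j) * (- y)" using that False by (intro mult_right_mono) auto
            then have "y \<le> - 1 / real (Suc j)" using K by (subst pos_le_divide_eq) (auto simp: mult.commute)
            then show ?thesis by (simp add: g_def)
          qed
          then show ?thesis by (intro tendsto_eventually eventually_sequentiallyI)
        qed (simp add: g_neg h_neg)
      qed
      show "AE y in lborel. norm (?k y * complex_of_real (g j y)) \<le> 3 * (norm s)\<^sup>2 * (y\<^sup>2 * h y)" for j
      proof (rule AE_I2)
        fix y
        show "norm (?k y * complex_of_real (g j y)) \<le> 3 * (norm s)\<^sup>2 * (y\<^sup>2 * h y)"
        proof (cases "0 \<le> y")
          case False
          have "norm (?k y) * g j y \<le> (3 * (norm s)\<^sup>2 * y\<^sup>2) * h y"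
            using k_le[of y] False g_le[of j y] g_nonneg[of j y] by (intro mult_mono) auto
          then show ?thesis using g_nonneg[of j y] by (simp add: norm_mult mult.assoc)
        qed (simp add: g_neg h_neg)
      qed
    qed auto
    have "(\<lambda>j. (CLINT y|\<mu> j. exp (s * of_real y)) - E j) \<longlonglongrightarrow> 0"
    proof (rule Lim_null_comparison)
      show "\<forall>\<^sub>F j in sequentially. norm ((CLINT y|\<mu> j. exp (s * of_real y)) - E j) \<le> 4 * exp 2 / real (Suc j)"
      \<comment> \<open>From here on \<open>Re s \<le> j\<close>, so the factor exp (Re s d) is at
        most the exp (j d) that was built into \<open>N j\<close>. A single choice of
        \<open>N\<close> thus serves all s.\<close>
      proof (rule eventually_sequentiallyI[of "nat \<lceil>Re s\<rceil>"])
        fix j assume "nat \<lceil>Re s\<rceil> \<le> j"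
        then have j: "Re s \<le> real j" by linarith
        define w where "w = z j s / of_nat (N j)"
        have w_le: "norm w \<le> 2 * l j / real (N j)" using z_le[of j] N_pos[of j]
          by (simp add: w_def norm_divide divide_right_mono)
        also have "\<dots> \<le> 2" using N_l[of j] N_pos[of j] by (simp add: field_simps)
        finally have w2: "\<bar>Re w\<bar> \<le> 2" using abs_Re_le_cmod[of w] by linarith
        have "norm (exp w - (\<Sum>k\<le>1. w ^ k / fact k)) \<le> exp \<bar>Re w\<bar> * norm w ^ Suc 1 / fact 1"
          by (rule Taylor_exp)
        then have "norm (exp w - (1 + w)) \<le> exp \<bar>Re w\<bar> * (norm w)\<^sup>2" by (simp add: power2_eq_square)
        also have "\<dots> \<le> exp 2 * (2 * l j / real (N j))\<^sup>2"
          using w2 w_le by (intro mult_mono power_mono) auto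
        finally have t: "norm ((1 + w) - exp w) \<le> exp 2 * (2 * l j / real (N j))\<^sup>2"
          by (simp add: norm_minus_commute)
        have Ew: "exp (z j s) = exp w ^ N j" using N_pos[of j] by (simp add: exp_of_nat_mult[symmetric] w_def)
        have "norm (exp w) \<le> 1" using z_Re[of j] N_pos[of j] by (simp add: w_def divide_nonpos_pos)
        then have "norm ((1 + w) ^ N j - exp w ^ N j) \<le> real (N j) * norm ((1 + w) - exp w)"
          using \<mu>(5)[OF s, of j] by (intro norm_power_diff) (auto simp: w_def)
        also have "\<dots> \<le> real (N j) * (exp 2 * (2 * l j / real (N j))\<^sup>2)"
          by (intro mult_left_mono t) auto
        also have "\<dots> = 4 * exp 2 * ((l j)\<^sup>2 / real (N j))"
          using N_pos[of j] by (simp add: power2_eq_square field_simps)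
        finally have p: "norm ((1 + w) ^ N j - exp w ^ N j) \<le> 4 * exp 2 * ((l j)\<^sup>2 / real (N j))" .
        have "(CLINT y|\<mu> j. exp (s * of_real y)) - E j = ((1 + w) ^ N j - exp w ^ N j) * exp (s * of_real (d j))"
          unfolding \<mu>(6)[OF s] E_def exp_add Ew w_def d_def by (simp add: algebra_simps)
        then have "norm ((CLINT y|\<mu> j. exp (s * of_real y)) - E j) = norm ((1 + w) ^ N j - exp w ^ N j) * exp (Re s * d j)"
          by (simp add: norm_mult)
        also have "\<dots> \<le> (4 * exp 2 * ((l j)\<^sup>2 / real (N j))) * exp (real j * d j)"
          using p j d_nonneg[of j] by (intro mult_mono) (auto intro: mult_right_mono)
        also have "\<dots> = 4 * exp 2 * ((l j)\<^sup>2 * exp (real j * d j) / real (N j))" by simp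
        also have "\<dots> \<le> 4 * exp 2 * (1 / real (Suc j))"
          using N_b[of j] N_pos[of j] by (intro mult_left_mono) (auto simp: field_simps simp del: of_nat_Suc)
        finally show "norm ((CLINT y|\<mu> j. exp (s * of_real y)) - E j) \<le> 4 * exp 2 / real (Suc j)" by simp
      qed
      show "(\<lambda>j. 4 * exp 2 / real (Suc j)) \<longlonglongrightarrow> 0" by real_asymp
    qed
    from tendsto_add[OF this E_lim] show ?thesis by simp
  qed
  with \<mu>(1-4) that show ?thesis by blast
qed

text \<open>Any weak limit point of the approximations works: Levy continuity identifies its
  characteristic function. For the exponential moment at m, the convergent and hence bounded
  transforms at 2 m supply the uniform integrability.\<close>

theorem infinitely_divisible_exists:
  fixes h :: "real \<Rightarrow> real"
  assumes h[measurable]: "h \<in> borel_measurable borel" and h_nonneg: "\<And>y. 0 \<le> h y"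
    and h_neg: "\<And>y. 0 \<le> y \<Longrightarrow> h y = 0"
    and int: "integrable lborel (\<lambda>y. y\<^sup>2 * h y)"
  obtains \<mu> where "real_distribution \<mu>"
    "\<And>t. char \<mu> t = exp (CLINT y|lborel. (iexp (t * y) - 1 - \<i> * of_real (t * y)) * of_real (h y))"
    "\<And>m::nat. integrable \<mu> (\<lambda>y. exp (real m * y))"
    "\<And>m::nat. (LINT y|\<mu>. exp (real m * y)) = exp (LINT y|lborel. (exp (real m * y) - 1 - real m * y) * h y)"
proof -
  obtain \<mu> where \<mu>: "\<And>j::nat. real_distribution (\<mu> j)" "\<And>j. integrable (\<mu> j) (\<lambda>y. y)" "\<And>j. (LINT y|\<mu> j. y) = 0"
    "\<And>j s. 0 \<le> Re s \<Longrightarrow> integrable (\<mu> j) (\<lambda>y. exp (s * of_real y))"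
    "\<And>s. 0 \<le> Re s \<Longrightarrow> (\<lambda>j. CLINT y|\<mu> j. exp (s * of_real y))
        \<longlonglongrightarrow> exp (CLINT y|lborel. (exp (s * of_real y) - 1 - s * of_real y) * of_real (h y))"
    by (rule infinitely_divisible_approximation[OF assms]) (assumption, rule that)
  define \<psi> where "\<psi> m = (LINT y|lborel. (exp (m * y) - 1 - m * y) * h y)" for m :: real
  have exp_real: "exp (of_real a * of_real y) = complex_of_real (exp (a * y))" for a y :: real
    by (simp only: of_real_mult[symmetric] exp_of_real)
  have int_exp: "integrable (\<mu> j) (\<lambda>y. exp (a * y))" if "0 \<le> a" for a j
    using integrable_Re[OF \<mu>(4)[of "of_real a" j]] that unfolding exp_real by simp
  have exp_lim: "(\<lambda>j. LINT y|\<mu> j. exp (a * y)) \<longlonglongrightarrow> exp (\<psi> a)" if a: "0 \<le> a" for a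
  proof -
    have "(CLINT y|lborel. (exp (of_real a * of_real y) - 1 - of_real a * of_real y) * of_real (h y))
       = (CLINT y|lborel. of_real ((exp (a * y) - 1 - a * y) * h y))"
      unfolding exp_real by simp
    then have "(\<lambda>j. CLINT y|\<mu> j. of_real (exp (a * y))) \<longlonglongrightarrow> exp (of_real (\<psi> a))"
      using \<mu>(5)[of "of_real a"] a unfolding exp_real \<psi>_def integral_complex_of_real by simp
    then have "(\<lambda>j. complex_of_real (LINT y|\<mu> j. exp (a * y))) \<longlonglongrightarrow> of_real (exp (\<psi> a))"
      unfolding integral_complex_of_real exp_of_real .
    then show ?thesis by (simp only: tendsto_of_real_iff)
  qed
  have exp_bdd: "\<exists>B. \<forall>j. (LINT y|\<mu> j. exp (a * y)) \<le> B" if a: "0 \<le> a" for a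
  proof -
    have "Bseq (\<lambda>j. LINT y|\<mu> j. exp (a * y))"
      using exp_lim[OF a] by (intro convergent_imp_Bseq convergentI)
    then obtain B where "\<And>j. norm (LINT y|\<mu> j. exp (a * y)) \<le> B" by (auto simp: Bseq_def)
    then have "\<And>j. (LINT y|\<mu> j. exp (a * y)) \<le> B" by (metis abs_ge_self order.trans real_norm_def)
    then show ?thesis by blast
  qed
  obtain B where B: "\<And>j. (LINT y|\<mu> j. exp (1 * y)) \<le> B" using exp_bdd[of 1] by auto
  \<comment> \<open>Tightness: the means vanish, so \<open>E|Y| = 2 E max Y 0 \<le> 2 E exp Y\<close>.\<close>
  have "(LINT y|\<mu> j. \<bar>y\<bar>) \<le> 2 * B" for j
  proof -
    have "(LINT y|\<mu> j. \<bar>y\<bar>) \<le> (LINT y|\<mu> j. 2 * exp (1 * y) - y)"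
    proof (rule integral_mono)
      show "integrable (\<mu> j) (\<lambda>y. \<bar>y\<bar>)" using \<mu>(2) by simp
      show "integrable (\<mu> j) (\<lambda>y. 2 * exp (1 * y) - y)"
        using \<mu>(2)[of j] int_exp[of 1 j] by simp
      show "\<bar>y\<bar> \<le> 2 * exp (1 * y) - y" for y :: real
        unfolding mult_1_left using exp_ge_add_one_self[of y] exp_ge_zero[of y] by linarith
    qed
    also have "\<dots> = 2 * (LINT y|\<mu> j. exp (1 * y)) - 0"
      using \<mu>(2)[of j] \<mu>(3)[of j] int_exp[of 1 j] by simp
    finally show ?thesis using B[of j] by simp
  qed
  then have "tight \<mu>" by (rule tight_if_abs_moment_bounded[OF \<mu>(1,2)])
  then obtain r M where r: "strict_mono r" and M: "real_distribution M" and weak: "weak_conv_m (\<mu> \<circ> id \<circ> r) M"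
    using tight_imp_convergent_subsubsequence[of \<mu> id] by (auto simp: strict_mono_def)
  define \<mu>' where "\<mu>' n = \<mu> (r n)" for n
  have weak': "weak_conv_m \<mu>' M" using weak by (simp add: \<mu>'_def[abs_def] comp_def)
  have dist': "real_distribution (\<mu>' n)" for n by (simp add: \<mu>'_def \<mu>(1))
  show ?thesis
  proof (rule that[OF M])
    fix t
    have "(\<lambda>n. char (\<mu>' n) t) \<longlonglongrightarrow> char M t" by (rule levy_continuity1[OF dist' M weak'])
    moreover have "(\<lambda>j. char (\<mu> j) t) \<longlonglongrightarrow> exp (CLINT y|lborel. (iexp (t * y) - 1 - \<i> * of_real (t * y)) * of_real (h y))"
      using \<mu>(5)[of "\<i> * of_real t"] by (simp add: char_def mult.assoc)
    then have "(\<lambda>n. char (\<mu>' n) t) \<longlonglongrightarrow> exp (CLINT y|lborel. (iexp (t * y) - 1 - \<i> * of_real (t * y)) * of_real (h y))"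
      unfolding \<mu>'_def using LIMSEQ_subseq_LIMSEQ[OF _ r] by (force simp: comp_def)
    ultimately show "char M t = exp (CLINT y|lborel. (iexp (t * y) - 1 - \<i> * of_real (t * y)) * of_real (h y))"
      by (rule LIMSEQ_unique)
  next
    fix m :: nat
    obtain B where B: "\<And>j. (LINT y|\<mu> j. exp (2 * real m * y)) \<le> B" using exp_bdd[of "2 * real m"] by auto
    have "(\<lambda>n. LINT y|\<mu>' n. exp (real m * y)) \<longlonglongrightarrow> exp (\<psi> (real m))"
      unfolding \<mu>'_def using LIMSEQ_subseq_LIMSEQ[OF exp_lim[of "real m"] r] by (simp add: comp_def)
    then have "integrable M (\<lambda>y. exp (real m * y)) \<and> (LINT y|M. exp (real m * y)) = exp (\<psi> (real m))"
      by (intro weak_conv_exp_moment[OF dist' M weak', where B=B]) (use B int_exp in \<open>auto simp: \<mu>'_def\<close>)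
    then show "integrable M (\<lambda>y. exp (real m * y))"
      "(LINT y|M. exp (real m * y)) = exp (LINT y|lborel. (exp (real m * y) - 1 - real m * y) * h y)"
      by (simp_all add: \<psi>_def)
  qed
qed

section \<open>Measures on the unit interval and polynomials\<close>

lemma real_polynomial_function_eq_poly:
  assumes "real_polynomial_function f"
  obtains q where "f = poly q"
proof -
  obtain a n where "f = (\<lambda>x. \<Sum>i\<le>n. a i * x ^ i)"
    using assms real_polynomial_function_iff_sum by blast
  then have "f = poly (\<Sum>i\<le>n. monom (a i) i)"
    by (auto simp: poly_sum poly_monom)
  with that show ?thesis by blast
qed

text \<open>Only squares of polynomials can be tested, so it is the square root of g that is
  approximated uniformly on the unit interval. Its approximants stay below 2 in modulus, whence the
  dominating constant 4.\<close>

lemma unit_interval_integral_mono: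
  fixes \<alpha> \<beta> :: "real measure" and g :: "real \<Rightarrow> real"
  assumes \<alpha>: "finite_measure \<alpha>" "sets \<alpha> = sets borel" "AE x in \<alpha>. x \<in> {0..1}"
    and \<beta>: "finite_measure \<beta>" "sets \<beta> = sets borel" "AE x in \<beta>. x \<in> {0..1}"
    and squares: "\<And>q. (LINT x|\<alpha>. (poly q x)\<^sup>2) \<le> (LINT x|\<beta>. (poly q x)\<^sup>2)"
    and g: "continuous_on UNIV g" "\<And>x. 0 \<le> g x" "\<And>x. g x \<le> 1"
  shows "integral\<^sup>L \<alpha> g \<le> integral\<^sup>L \<beta> g"
proof -
  have "\<exists>q. \<forall>x\<in>{0..1}. \<bar>sqrt (g x) - poly q x\<bar> < 1 / real (Suc k)" for k
  proof -
    have "continuous_on {0..1} (\<lambda>x. sqrt (g x))"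
      using g(1) by (intro continuous_intros continuous_on_subset[OF g(1)]) auto
    then obtain f where "real_polynomial_function f" "\<And>x. x \<in> {0..1} \<Longrightarrow> \<bar>sqrt (g x) - f x\<bar> < 1 / real (Suc k)"
      using Stone_Weierstrass_real_polynomial_function[of "{0..1}" "\<lambda>x. sqrt (g x)" "1 / real (Suc k)"] by auto
    then show ?thesis by (metis real_polynomial_function_eq_poly)
  qed
  then obtain q where q: "\<And>k x. x \<in> {0..1} \<Longrightarrow> \<bar>sqrt (g x) - poly (q k) x\<bar> < 1 / real (Suc k)"
    by metis
  have lim: "(\<lambda>k. (poly (q k) x)\<^sup>2) \<longlonglongrightarrow> g x" if x: "x \<in> {0..1}" for x
  proof -
    have "(\<lambda>k. sqrt (g x) - poly (q k) x) \<longlonglongrightarrow> 0"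
      using q[OF x] by (intro Lim_null_comparison[OF _ LIMSEQ_Suc[OF lim_1_over_n]] always_eventually) (auto intro: less_imp_le)
    then have "(\<lambda>k. sqrt (g x) - (sqrt (g x) - poly (q k) x)) \<longlonglongrightarrow> sqrt (g x) - 0"
      by (intro tendsto_intros)
    then have "(\<lambda>k. (poly (q k) x)\<^sup>2) \<longlonglongrightarrow> (sqrt (g x))\<^sup>2"
      by (intro tendsto_power) simp
    then show ?thesis using g(2)[of x] by simp
  qed
  have bound: "(poly (q k) x)\<^sup>2 \<le> 4" if x: "x \<in> {0..1}" for k x
  proof -
    have "1 / real (Suc k) \<le> 1" by simp
    moreover have "0 \<le> sqrt (g x)" "sqrt (g x) \<le> 1" using g(2,3)[of x] by auto
    ultimately have "\<bar>poly (q k) x\<bar> \<le> 2" using q[OF x, of k] by linarith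
    then have "\<bar>poly (q k) x\<bar>\<^sup>2 \<le> 2\<^sup>2" by (intro power_mono) auto
    then show ?thesis by simp
  qed
  have conv: "(\<lambda>k. LINT x|\<mu>. (poly (q k) x)\<^sup>2) \<longlonglongrightarrow> integral\<^sup>L \<mu> g"
    if \<mu>: "finite_measure \<mu>" "sets \<mu> = sets borel" "AE x in \<mu>. x \<in> {0..1}" for \<mu>
  proof (rule integral_dominated_convergence[where w="\<lambda>_. 4"])
    note [measurable_cong] = \<mu>(2)
    show "g \<in> borel_measurable \<mu>" using borel_measurable_continuous_onI[OF g(1)] by simp
    have "(\<lambda>x. (poly (q k) x)\<^sup>2) \<in> borel_measurable borel" for k
      by (intro borel_measurable_continuous_onI continuous_intros)
    then show "(\<lambda>x. (poly (q k) x)\<^sup>2) \<in> borel_measurable \<mu>" for k by simp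
    show "integrable \<mu> (\<lambda>_. 4::real)" using \<mu>(1) by (simp add: finite_measure.integrable_const)
    show "AE x in \<mu>. (\<lambda>k. (poly (q k) x)\<^sup>2) \<longlonglongrightarrow> g x"
      using \<mu>(3) by eventually_elim (rule lim)
    show "AE x in \<mu>. norm ((poly (q k) x)\<^sup>2) \<le> 4" for k
      using \<mu>(3) by eventually_elim (simp add: bound)
  qed
  show ?thesis
    by (rule LIMSEQ_le[OF conv[OF \<alpha>] conv[OF \<beta>]]) (use squares in auto)
qed

text \<open>Indicators of open sets are limits of continuous functions with values in [0, 1]; outer
  regularity of \<beta> carries the inequality from open sets to Borel sets.\<close>

lemma unit_interval_measure_mono:
  fixes \<alpha> \<beta> :: "real measure"
  assumes \<alpha>: "finite_measure \<alpha>" "sets \<alpha> = sets borel" "AE x in \<alpha>. x \<in> {0..1}"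
    and \<beta>: "finite_measure \<beta>" "sets \<beta> = sets borel" "AE x in \<beta>. x \<in> {0..1}"
    and squares: "\<And>q. (LINT x|\<alpha>. (poly q x)\<^sup>2) \<le> (LINT x|\<beta>. (poly q x)\<^sup>2)"
    and E: "E \<in> sets borel"
  shows "emeasure \<alpha> E \<le> emeasure \<beta> E"
proof -
  have open_le: "emeasure \<alpha> U \<le> emeasure \<beta> U" if U: "open U" for U
  proof -
    \<comment> \<open>The whole line is separated because \<open>infdist\<close> to the empty set is
      0 by convention.\<close>
    define g where "g k x = (if U = UNIV then 1 else min 1 (real k * infdist x (- U)))" for k x
    have g_cont: "continuous_on UNIV (g k)" for k
      unfolding g_def[abs_def] by (cases "U = UNIV") (auto intro!: continuous_intros)
    have g_range: "0 \<le> g k x" "g k x \<le> 1" for k x by (auto simp: g_def infdist_nonneg)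
    have g_lim: "(\<lambda>k. g k x) \<longlonglongrightarrow> indicator U x" for x
    proof (cases "U = UNIV \<or> x \<notin> U")
      case True
      then show ?thesis
        by (cases "U = UNIV") (simp_all add: g_def)
    next
      case False
      then have "0 < infdist x (- U)"
        using U infdist_pos_not_in_closed[of "- U" x] by auto
      then obtain N :: nat where N: "1 \<le> real N * infdist x (- U)"
        using reals_Archimedean3[of "infdist x (- U)"] less_imp_le by blast
      have "g k x = 1" if "k \<ge> N" for k
      proof -
        have "real N * infdist x (- U) \<le> real k * infdist x (- U)"
          using that by (intro mult_right_mono infdist_nonneg) auto
        with N show ?thesis by (simp add: g_def)
      qed
      then have "eventually (\<lambda>k. g k x = 1) sequentially"
        by (rule eventually_sequentiallyI)
      moreover have "indicator U x = (1::real)" using False by simp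
      ultimately show ?thesis by (simp only: tendsto_eventually)
    qed
    have conv: "(\<lambda>k. integral\<^sup>L \<mu> (g k)) \<longlonglongrightarrow> measure \<mu> U"
      if \<mu>: "finite_measure \<mu>" "sets \<mu> = sets borel" for \<mu>
    proof -
      note [measurable_cong] = \<mu>(2)
      have [measurable]: "U \<in> sets borel" using U by simp
      have "(\<lambda>k. integral\<^sup>L \<mu> (g k)) \<longlonglongrightarrow> integral\<^sup>L \<mu> (indicator U :: real \<Rightarrow> real)"
      proof (rule integral_dominated_convergence[where w="\<lambda>_. 1"])
        show "g k \<in> borel_measurable \<mu>" for k using borel_measurable_continuous_onI[OF g_cont] by simp
        show "integrable \<mu> (\<lambda>_. 1::real)" using \<mu>(1) by (simp add: finite_measure.integrable_const)
      qed (use g_lim g_range in auto)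
      then show ?thesis using \<mu> sets_eq_imp_space_eq[OF \<mu>(2)] by simp
    qed
    have "measure \<alpha> U \<le> measure \<beta> U"
      by (rule LIMSEQ_le[OF conv[OF \<alpha>(1,2)] conv[OF \<beta>(1,2)]])
        (use unit_interval_integral_mono[OF \<alpha> \<beta> squares g_cont g_range] in blast)
    then show ?thesis
      using \<alpha>(1) \<beta>(1) by (simp add: finite_measure.emeasure_eq_measure)
  qed
  have fin: "emeasure \<alpha> (space \<alpha>) \<noteq> \<infinity>" "emeasure \<beta> (space \<beta>) \<noteq> \<infinity>"
    using \<alpha>(1) \<beta>(1) by (simp_all add: finite_measure.emeasure_finite)
  show ?thesis
    unfolding outer_regular[OF \<beta>(2) fin(2) E]
  proof (rule INF_greatest)
    fix U assume U: "U \<in> {U. E \<subseteq> U \<and> open U}"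
    then have "emeasure \<alpha> E \<le> emeasure \<alpha> U" using \<alpha>(2) by (intro emeasure_mono) auto
    also have "\<dots> \<le> emeasure \<beta> U" using U open_le by auto
    finally show "emeasure \<alpha> E \<le> emeasure \<beta> U" .
  qed
qed

text \<open>The Riesz functional of a sequence: linear, sending x^j to \<open>L j\<close>. It also
  applies to sequences such as logarithms of moments, which need not come from a measure.\<close>

definition poly_functional :: "(nat \<Rightarrow> real) \<Rightarrow> real poly \<Rightarrow> real" where
  "poly_functional L p = (\<Sum>j\<le>degree p. coeff p j * L j)"

lemma poly_functional_eq:
  assumes "degree p \<le> N"
  shows "poly_functional L p = (\<Sum>j\<le>N. coeff p j * L j)"
  unfolding poly_functional_def
  using assms by (intro sum.mono_neutral_left) (auto simp: coeff_eq_0)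

lemma poly_functional_add: "poly_functional L (p + q) = poly_functional L p + poly_functional L q"
proof -
  let ?N = "max (degree p) (degree q)"
  have "degree (p + q) \<le> ?N" by (rule degree_add_le) auto
  then show ?thesis
    by (simp add: poly_functional_eq[of _ ?N] sum.distrib distrib_right)
qed

lemma poly_functional_pCons: "poly_functional L (pCons a p) = a * L 0 + poly_functional (\<lambda>j. L (Suc j)) p"
proof -
  have "degree (pCons a p) \<le> Suc (degree p)" by (rule degree_pCons_le)
  then have "poly_functional L (pCons a p) = (\<Sum>j\<le>Suc (degree p). coeff (pCons a p) j * L j)"
    by (rule poly_functional_eq)
  also have "\<dots> = a * L 0 + (\<Sum>j\<le>degree p. coeff p j * L (Suc j))"
    by (subst sum.atMost_Suc_shift) simp
  finally show ?thesis by (simp add: poly_functional_def)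
qed

text \<open>The polynomial \<open>[:1, -2, 1:]\<close> is (x - 1)^2, and multiplication by x acts on
  the sequence as the shift.\<close>

lemma poly_functional_second_difference:
  "poly_functional L ([:1, -2, 1:] * p) = poly_functional (\<lambda>j. L (j + 2) - 2 * L (j + 1) + L j) p"
proof (induction p arbitrary: L)
  case 0
  show ?case by (simp add: poly_functional_def)
next
  case (pCons a p)
  have "[:1, -2, 1:] * pCons a p = smult a [:1, -2, 1:] + pCons 0 ([:1, -2, 1:] * p)"
    by (rule mult_pCons_right)
  then have "poly_functional L ([:1, -2, 1:] * pCons a p)
    = poly_functional L (smult a [:1, -2, 1:]) + poly_functional (\<lambda>j. L (Suc j)) ([:1, -2, 1:] * p)"
    by (simp only: poly_functional_add poly_functional_pCons mult_zero_left add_0)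
  also have "poly_functional L (smult a [:1, -2, 1:]) = a * (L 2 - 2 * L 1 + L 0)"
    by (simp add: poly_functional_pCons poly_functional_def algebra_simps eval_nat_numeral)
  finally show ?case
    by (simp only: pCons.IH poly_functional_pCons) (simp add: eval_nat_numeral)
qed

lemma poly_functional_moments:
  fixes D :: "real measure"
  assumes D: "sets D = sets borel" "AE x in D. 0 \<le> x"
    and L: "\<And>j. 0 \<le> L j" "\<And>j. (\<integral>\<^sup>+x. ennreal (x ^ j) \<partial>D) = ennreal (L j)"
  shows "integrable D (\<lambda>x. x ^ j)" "(LINT x|D. x ^ j) = L j"
    "integrable D (poly p)" "(LINT x|D. poly p x) = poly_functional L p"
proof -
  note [measurable_cong] = D(1)
  show i: "integrable D (\<lambda>x. x ^ j)" for j
    using L(2)[of j] D(2) by (intro integrableI_nonneg) (auto elim!: eventually_mono)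
  have "ennreal (LINT x|D. x ^ j) = ennreal (L j)" for j
  proof -
    have "AE x in D. 0 \<le> x ^ j" using D(2) by eventually_elim simp
    from nn_integral_eq_integral[OF i this] show ?thesis using L(2)[of j] by simp
  qed
  moreover have "0 \<le> (LINT x|D. x ^ j)" for j
    using D(2) by (intro integral_nonneg_AE) (auto elim!: eventually_mono)
  ultimately show l: "(LINT x|D. x ^ j) = L j" for j
    using ennreal_inj[OF _ L(1)] by blast
  have p: "poly p = (\<lambda>x. \<Sum>j\<le>degree p. coeff p j * x ^ j)" by (rule ext) (rule poly_altdef)
  show "integrable D (poly p)" unfolding p using i by simp
  show "(LINT x|D. poly p x) = poly_functional L p"
    unfolding poly_altdef poly_functional_def using i l by simp
qed

lemma powr_inverse_nat_limit:
  fixes a :: real assumes "0 < a"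
  shows "(\<lambda>n. real n * (a powr (1 / real n) - 1)) \<longlonglongrightarrow> ln a"
  using assms by real_asymp

text \<open>The coefficients of \<open>p\<close> sum to \<open>poly p 1 = 0\<close>, so each root
  may be lowered by 1 at no cost. Multiplied by n, these differences tend to the logarithms.\<close>

lemma poly_functional_ln_nonneg:
  assumes pos: "\<And>j. 0 < L j" and p1: "poly p 1 = 0"
    and nonneg: "\<And>n. 2 \<le> n \<Longrightarrow> 0 \<le> poly_functional (\<lambda>j. L j powr (1 / real n)) p"
  shows "0 \<le> poly_functional (\<lambda>j. ln (L j)) p"
proof (rule tendsto_lowerbound)
  show "(\<lambda>n. poly_functional (\<lambda>j. real n * (L j powr (1 / real n) - 1)) p) \<longlonglongrightarrow> poly_functional (\<lambda>j. ln (L j)) p"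
    unfolding poly_functional_def by (intro tendsto_intros powr_inverse_nat_limit pos)
  show "\<forall>\<^sub>F n in sequentially. 0 \<le> poly_functional (\<lambda>j. real n * (L j powr (1 / real n) - 1)) p"
    using eventually_ge_at_top[of 2]
  proof eventually_elim
    case (elim n)
    have "(\<Sum>j\<le>degree p. coeff p j) = 0" using p1 by (simp add: poly_altdef)
    then have "poly_functional (\<lambda>j. real n * (L j powr (1 / real n) - 1)) p
      = real n * poly_functional (\<lambda>j. L j powr (1 / real n)) p"
      by (simp add: poly_functional_def sum_distrib_left right_diff_distrib sum_subtractf mult_ac sum_distrib_right[symmetric])
        (simp add: sum_distrib_left[symmetric] mult.left_commute)
    then show ?case using nonneg[OF elim] by simp
  qed
qed simp

lemma density_le_lborel_imp_AE_le_1: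
  fixes f :: "real \<Rightarrow> ennreal"
  assumes f[measurable]: "f \<in> borel_measurable borel"
    and le: "\<And>A. A \<in> sets borel \<Longrightarrow> emeasure (density lborel f) A \<le> emeasure lborel A"
  shows "AE x in lborel. f x \<le> 1"
proof -
  \<comment> \<open>Boundedness gives the set finite Lebesgue measure, which can then be cancelled;
    the gap above 1 leaves a strictly positive multiple of it.\<close>
  define A where "A j = {x \<in> {- real j..real j}. 1 + ennreal (1 / real (Suc j)) \<le> f x}" for j
  have A_meas[measurable]: "A j \<in> sets borel" for j
  proof -
    have "A j = {- real j..real j} \<inter> f -` {1 + ennreal (1 / real (Suc j))..} \<inter> space borel" by (auto simp: A_def)
    also have "\<dots> \<in> sets borel" unfolding Int_assoc by (intro sets.Int measurable_sets[OF f]) auto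
    finally show ?thesis .
  qed
  have "A j \<in> null_sets lborel" for j
  proof -
    have "emeasure lborel (A j) \<le> emeasure lborel {- real j..real j}"
      by (intro emeasure_mono) (auto simp: A_def)
    then have fin: "emeasure lborel (A j) < \<infinity>" by (auto intro: le_less_trans)
    have "(1 + ennreal (1 / real (Suc j))) * emeasure lborel (A j)
       = (\<integral>\<^sup>+x. (1 + ennreal (1 / real (Suc j))) * indicator (A j) x \<partial>lborel)"
      by (subst nn_integral_cmult_indicator) auto
    also have "\<dots> \<le> (\<integral>\<^sup>+x. f x * indicator (A j) x \<partial>lborel)"
      by (intro nn_integral_mono) (auto simp: A_def indicator_def)
    also have "\<dots> = emeasure (density lborel f) (A j)" by (simp add: emeasure_density)
    also have "\<dots> \<le> emeasure lborel (A j)" by (rule le) simp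
    finally have "emeasure lborel (A j) + ennreal (1 / real (Suc j)) * emeasure lborel (A j) \<le> emeasure lborel (A j) + 0"
      by (simp add: distrib_right)
    then have "ennreal (1 / real (Suc j)) * emeasure lborel (A j) = 0"
      using fin by (subst (asm) ennreal_add_left_cancel_le) auto
    then have "emeasure lborel (A j) = 0" by simp
    then show ?thesis by (auto simp: null_sets_def)
  qed
  then have "(\<Union>j. A j) \<in> null_sets lborel" by (intro null_sets_UN)
  moreover have "x \<in> (\<Union>j. A j)" if "\<not> f x \<le> 1" for x
  proof -
    have "\<exists>c>1. ennreal c \<le> f x"
    proof (cases "f x")
      case (real r)
      with that have "1 < r" by (metis ennreal_1 ennreal_leI not_le)
      with real show ?thesis by auto
    next
      case top
      then show ?thesis by (intro exI[of _ 2]) auto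
    qed
    then obtain c where c: "1 < c" "ennreal c \<le> f x" by auto
    obtain j1 :: nat where j1: "\<bar>x\<bar> \<le> real j1" using real_arch_simple by blast
    obtain j2 :: nat where j2: "1 / (c - 1) \<le> real j2" using real_arch_simple by blast
    define j where "j = max j1 j2"
    have "1 / (c - 1) \<le> real (Suc j)" using j2 by (simp add: j_def)
    then have "1 / real (Suc j) \<le> c - 1" using c by (simp add: field_simps)
    then have "1 + ennreal (1 / real (Suc j)) \<le> ennreal c"
      using ennreal_leI[of "1 + 1 / real (Suc j)" c] ennreal_plus[of 1 "1 / real (Suc j)"]
      by (simp del: of_nat_Suc)
    then show ?thesis using c j1 by (intro UN_I[of j]) (auto simp: A_def j_def)
  qed
  ultimately show ?thesis by (auto intro!: AE_I'[of "\<Union>j. A j"])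
qed

section \<open>Divisibility forces domination by Lebesgue measure\<close>

text \<open>The integral of exp (- s x) over s in [1, 2]. Its value 1 at x = 0 makes it positive there,
  so that comparing the weighted measures also excludes an atom of \<kappa> at 0.\<close>

definition kernel :: "real \<Rightarrow> real" where
  "kernel x = (if x = 0 then 1 else (exp (- x) - exp (- 2 * x)) / x)"

lemma kernel_measurable[measurable]: "kernel \<in> borel_measurable borel"
  unfolding kernel_def by measurable

lemma kernel_pos: "0 < kernel x"
proof (cases x "0::real" rule: linorder_cases)
  case less
  then show ?thesis by (auto simp: kernel_def divide_neg_neg)
next
  case greater
  then show ?thesis by (auto simp: kernel_def)
qed (simp add: kernel_def)

text \<open>Integrate the transform over s in [m + 1, m + 2] in both orders. It is used twice: for
  \<kappa> with F = ln \<Phi>, and for Lebesgue measure with F = ln. Starting at m + 1 keeps s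
  positive even for m = 0.\<close>

lemma laplace_transform_increment:
  fixes \<kappa> :: "real measure"
  assumes sets: "sets \<kappa> = sets borel"
    and laplace: "\<And>s. 0 < s \<Longrightarrow> (\<integral>\<^sup>+x. ennreal (exp (- s * x)) \<partial>\<kappa>) = ennreal (F' s)"
    and F': "\<And>s. 0 < s \<Longrightarrow> 0 \<le> F' s"
    and F: "\<And>s. 0 < s \<Longrightarrow> (F has_real_derivative F' s) (at s)"
    and m: "0 \<le> m"
  shows "(\<integral>\<^sup>+x. ennreal (exp (- m * x) * kernel x) \<partial>\<kappa>) = ennreal (F (m + 2) - F (m + 1))"
proof -
  note [measurable_cong] = sets
  \<comment> \<open>Tonelli needs \<kappa> to be sigma-finite. This follows from finiteness of the
    transform at s = 1, as exp (- x) is at least exp (- n) on \<open>{..real n}\<close>.\<close>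
  have fin: "emeasure \<kappa> {..real n} \<noteq> \<infinity>" for n
  proof -
    have "ennreal (exp (- real n)) * emeasure \<kappa> {..real n} = (\<integral>\<^sup>+x. ennreal (exp (- real n)) * indicator {..real n} x \<partial>\<kappa>)"
      by (subst nn_integral_cmult_indicator) (simp_all add: sets)
    also have "\<dots> \<le> (\<integral>\<^sup>+x. ennreal (exp (- 1 * x)) \<partial>\<kappa>)"
      by (intro nn_integral_mono) (auto simp: indicator_def)
    also have "\<dots> < \<infinity>" using laplace[of 1] by simp
    finally show ?thesis by (auto simp: ennreal_mult_eq_top_iff ennreal_mult_less_top)
  qed
  interpret \<kappa>: sigma_finite_measure \<kappa>
  proof
    show "\<exists>A. countable A \<and> A \<subseteq> sets \<kappa> \<and> \<Union> A = space \<kappa> \<and> (\<forall>a\<in>A. emeasure \<kappa> a \<noteq> \<infinity>)"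
    proof (intro exI conjI)
      show "countable (range (\<lambda>n. {..real n}))" by simp
      show "range (\<lambda>n. {..real n}) \<subseteq> sets \<kappa>" by (auto simp: sets)
      have "\<exists>n. x \<le> real n" for x using real_arch_simple by blast
      then show "\<Union> (range (\<lambda>n. {..real n})) = space \<kappa>"
        using sets_eq_imp_space_eq[OF sets] by auto
      show "\<forall>a\<in>range (\<lambda>n. {..real n}). emeasure \<kappa> a \<noteq> \<infinity>" using fin by auto
    qed
  qed
  interpret P: pair_sigma_finite lborel \<kappa> ..
  let ?I = "{m + 1..m + 2}"
  have kernel: "(\<integral>\<^sup>+s. ennreal (exp (- s * x)) * indicator ?I s \<partial>lborel) = ennreal (exp (- m * x) * kernel x)" for x
  proof (cases "x = 0")
    case True
    then show ?thesis by (simp add: kernel_def)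
  next
    case False
    have "(\<integral>\<^sup>+s. ennreal (exp (- s * x)) * indicator ?I s \<partial>lborel)
      = ennreal (- exp (- (m + 2) * x) / x - - exp (- (m + 1) * x) / x)"
      using False by (intro nn_integral_FTC_Icc) (auto intro!: derivative_eq_intros)
    also have "- exp (- (m + 2) * x) / x - - exp (- (m + 1) * x) / x = exp (- m * x) * kernel x"
      using False by (simp add: kernel_def field_simps mult_exp_exp[symmetric] exp_add[symmetric])
    finally show ?thesis .
  qed
  have I: "indicator ?I s = (if m + 1 \<le> s \<and> s \<le> m + 2 then 1 else (0::ennreal))" for s by (simp add: indicator_def)
  have "(\<integral>\<^sup>+x. ennreal (exp (- m * x) * kernel x) \<partial>\<kappa>)
     = (\<integral>\<^sup>+x. (\<integral>\<^sup>+s. ennreal (exp (- s * x)) * indicator ?I s \<partial>lborel) \<partial>\<kappa>)"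
    by (simp only: kernel)
  also have "\<dots> = (\<integral>\<^sup>+s. (\<integral>\<^sup>+x. ennreal (exp (- s * x)) * indicator ?I s \<partial>\<kappa>) \<partial>lborel)"
    unfolding I by (rule P.Fubini') measurable
  \<comment> \<open>\<open>F'\<close> is constrained for positive s only and is not known to be
    Borel on the line. In this form the integrand is measurable everywhere and agrees with
    \<open>F'\<close> on the interval.\<close>
  also have "\<dots> = (\<integral>\<^sup>+s. ennreal (enn2real (\<integral>\<^sup>+x. ennreal (exp (- s * x)) \<partial>\<kappa>)) * indicator ?I s \<partial>lborel)"
    using laplace m by (intro nn_integral_cong) (auto simp: nn_integral_multc indicator_def)
  also have "\<dots> = ennreal (F (m + 2) - F (m + 1))"
    using laplace m F F' by (intro nn_integral_FTC_Icc) auto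
  finally show ?thesis .
qed

text \<open>Lebesgue measure on the half line has Laplace transform 1/s, the derivative of
  ln.\<close>

lemma nn_integral_exp_kernel_lborel:
  assumes m: "0 \<le> m"
  shows "(\<integral>\<^sup>+x. ennreal (exp (- m * x) * kernel x) * indicator {0..} x \<partial>lborel) = ennreal (ln (m + 2) - ln (m + 1))"
proof -
  have "(\<integral>\<^sup>+x. ennreal (exp (- s * x)) \<partial>density lborel (indicator {0..})) = ennreal (1 / s)" if s: "0 < s" for s :: real
  proof -
    have lim: "((\<lambda>x. - exp (- s * x) / s) \<longlongrightarrow> - 0 / s) at_top"
      using s by (intro tendsto_intros; (real_asymp | simp))
    show ?thesis
      using s lim
      by (subst nn_integral_density, simp, simp)
        (subst mult.commute, subst nn_integral_FTC_atLeast[where F="\<lambda>x. - exp (- s * x) / s" and T="- 0 / s"],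
          auto intro!: derivative_eq_intros)
  qed
  then have "(\<integral>\<^sup>+x. ennreal (exp (- m * x) * kernel x) \<partial>density lborel (indicator {0..})) = ennreal (ln (m + 2) - ln (m + 1))"
    by (intro laplace_transform_increment[where F'="\<lambda>s. 1 / s"]) (auto intro!: derivative_eq_intros simp: m)
  then show ?thesis by (simp add: nn_integral_density mult.commute)
qed

section \<open>The two moment sequences and their measures on the unit interval\<close>

locale subordinator_kappa = nonzero_subordinator +
  fixes \<kappa> :: "real measure"
  assumes kappa_sets: "sets \<kappa> = sets borel"
    and kappa_supp: "emeasure \<kappa> {..<0} = 0"
    and kappa_laplace: "\<forall>s>0. (\<integral>\<^sup>+x. ennreal (exp (- s * x)) \<partial>\<kappa>) = ennreal (deriv \<Phi> s / \<Phi> s)"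
begin

text \<open>The contribution of the exponents to the second difference of
  \<open>ln (moment m)\<close>; \<open>lborel_part\<close> is that of the factorials. Both are
  moment sequences of finite measures on the unit interval, \<open>kappa_image\<close> and
  \<open>lborel_image\<close>.\<close>

definition kappa_part :: "nat \<Rightarrow> real" where
  "kappa_part m = ln (\<Phi> (real m + 2)) - ln (\<Phi> (real m + 1))"

definition lborel_part :: "nat \<Rightarrow> real" where
  "lborel_part m = ln (real m + 2) - ln (real m + 1)"

lemma Phi_mono: "0 \<le> a \<Longrightarrow> a \<le> b \<Longrightarrow> \<Phi> a \<le> \<Phi> b"
proof -
  assume "0 \<le> a" "a \<le> b"
  then have "exp (- \<Phi> b) \<le> exp (- \<Phi> a)"
    unfolding exp_minus_Phi[OF \<open>0 \<le> a\<close>] exp_minus_Phi[OF order.trans[OF \<open>0 \<le> a\<close> \<open>a \<le> b\<close>]]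
    by (intro integral_mono integrable_exp_xi) (auto intro!: mult_right_mono simp: xi_nonneg)
  then show ?thesis by simp
qed

lemma kappa_part_nonneg: "0 \<le> kappa_part m"
  using Phi_mono[of "real m + 1" "real m + 2"] Phi_pos[of "real m + 1"] by (simp add: kappa_part_def)

lemma lborel_part_nonneg: "0 \<le> lborel_part m"
  by (simp add: lborel_part_def)

lemma nn_integral_kappa: "(\<integral>\<^sup>+x. ennreal (exp (- real m * x) * kernel x) \<partial>\<kappa>) = ennreal (kappa_part m)"
  unfolding kappa_part_def
proof (rule laplace_transform_increment[where F="\<lambda>s. ln (\<Phi> s)" and F'="\<lambda>s. deriv \<Phi> s / \<Phi> s"])
  show "((\<lambda>s. ln (\<Phi> s)) has_real_derivative deriv \<Phi> s / \<Phi> s) (at s)" if "0 < s" for s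
    using DERIV_chain2[OF DERIV_ln[OF Phi_pos[OF that]] Phi_has_derivative(1)[OF that]]
    by (simp add: divide_inverse mult.commute)
qed (use kappa_sets kappa_laplace Phi_has_derivative(2) Phi_pos in \<open>auto intro!: divide_nonneg_pos\<close>)

lemma moment_zero: "moment 0 = 1"
  by (simp add: moment_def)

lemma moment_second_difference:
  "ln (moment (j + 2)) - 2 * ln (moment (j + 1)) + ln (moment j) = lborel_part j - kappa_part j"
proof -
  have step: "ln (moment (Suc n)) = ln (moment n) + ln (real (Suc n)) - ln (\<Phi> (real (Suc n)))" for n
  proof -
    have "moment (Suc n) = moment n * real (Suc n) / \<Phi> (real (Suc n))"
      by (simp add: moment_def field_simps)
    then show ?thesis
      using moment_pos[of n] Phi_pos[of "real (Suc n)"] by (simp add: ln_mult ln_div)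
  qed
  show ?thesis
    using step[of j] step[of "Suc j"] by (simp add: lborel_part_def kappa_part_def add.commute)
qed

text \<open>The weight makes a possibly infinite \<kappa> finite. The map x to exp (- x) sends the
  half line into a compact interval and exp (- m x) to the monomial u^m, so polynomial approximation
  becomes available.\<close>

definition kappa_image :: "real measure" where
  "kappa_image = distr (density \<kappa> (\<lambda>x. ennreal (kernel x))) borel (\<lambda>x. exp (- x))"

definition lborel_image :: "real measure" where
  "lborel_image = distr (density (density lborel (indicator {0..})) (\<lambda>x. ennreal (kernel x))) borel (\<lambda>x. exp (- x))"

lemma exp_distr_moment:
  fixes \<mu> :: "real measure"
  assumes \<mu>: "sets \<mu> = sets borel"
  shows "(\<integral>\<^sup>+u. ennreal (u ^ m) \<partial>distr (density \<mu> (\<lambda>x. ennreal (kernel x))) borel (\<lambda>x. exp (- x)))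
     = (\<integral>\<^sup>+x. ennreal (exp (- real m * x) * kernel x) \<partial>\<mu>)"
proof -
  note [measurable_cong] = \<mu>
  have "(\<integral>\<^sup>+u. ennreal (u ^ m) \<partial>distr (density \<mu> (\<lambda>x. ennreal (kernel x))) borel (\<lambda>x. exp (- x)))
     = (\<integral>\<^sup>+x. ennreal (kernel x) * ennreal (exp (- x) ^ m) \<partial>\<mu>)"
    by (subst nn_integral_distr, simp, simp, subst nn_integral_density) auto
  also have "\<dots> = (\<integral>\<^sup>+x. ennreal (exp (- real m * x) * kernel x) \<partial>\<mu>)"
    by (intro nn_integral_cong)
      (simp add: ennreal_mult'[OF less_imp_le[OF kernel_pos], symmetric] exp_of_nat_mult[symmetric] mult.commute)
  finally show ?thesis .
qed

lemma exp_distr_unit_interval: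
  fixes \<mu> :: "real measure"
  assumes \<mu>: "sets \<mu> = sets borel" "AE x in \<mu>. 0 \<le> x"
  shows "AE u in distr (density \<mu> (\<lambda>x. ennreal (kernel x))) borel (\<lambda>x. exp (- x)). u \<in> {0..1}"
proof -
  note [measurable_cong] = \<mu>(1)
  have "AE x in \<mu>. exp (- x) \<in> {0..1}" using \<mu>(2) by eventually_elim auto
  then show ?thesis
    by (subst AE_distr_iff) (auto simp: AE_density elim!: eventually_mono)
qed

lemma kappa_AE_nonneg: "AE x in \<kappa>. 0 \<le> x"
  using kappa_supp kappa_sets by (intro AE_I[of _ _ "{..<0}"]) auto

lemma kappa_image_moment: "(\<integral>\<^sup>+u. ennreal (u ^ m) \<partial>kappa_image) = ennreal (kappa_part m)"
  unfolding kappa_image_def exp_distr_moment[OF kappa_sets] by (rule nn_integral_kappa)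

lemma lborel_image_moment: "(\<integral>\<^sup>+u. ennreal (u ^ m) \<partial>lborel_image) = ennreal (lborel_part m)"
proof -
  have "(\<integral>\<^sup>+u. ennreal (u ^ m) \<partial>lborel_image) = (\<integral>\<^sup>+x. ennreal (exp (- real m * x) * kernel x) \<partial>density lborel (indicator {0..}))"
    unfolding lborel_image_def by (rule exp_distr_moment) simp
  also have "\<dots> = (\<integral>\<^sup>+x. ennreal (exp (- real m * x) * kernel x) * indicator {0..} x \<partial>lborel)"
    by (subst nn_integral_density) (auto simp: mult.commute)
  also have "\<dots> = ennreal (lborel_part m)"
    unfolding lborel_part_def by (rule nn_integral_exp_kernel_lborel) simp
  finally show ?thesis .
qed

lemma kappa_image: "finite_measure kappa_image" "sets kappa_image = sets borel" "AE u in kappa_image. u \<in> {0..1}"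
proof -
  show "finite_measure kappa_image" using kappa_image_moment[of 0] by (intro finite_measureI) simp
  show "sets kappa_image = sets borel" by (simp add: kappa_image_def)
  show "AE u in kappa_image. u \<in> {0..1}"
    unfolding kappa_image_def by (rule exp_distr_unit_interval[OF kappa_sets kappa_AE_nonneg])
qed

lemma lborel_image: "finite_measure lborel_image" "sets lborel_image = sets borel" "AE u in lborel_image. u \<in> {0..1}"
proof -
  show "finite_measure lborel_image" using lborel_image_moment[of 0] by (intro finite_measureI) simp
  show "sets lborel_image = sets borel" by (simp add: lborel_image_def)
  show "AE u in lborel_image. u \<in> {0..1}"
    unfolding lborel_image_def
    by (rule exp_distr_unit_interval) (auto simp: AE_density indicator_def intro!: AE_I2)
qed

text \<open>Nothing is lost in passing to the images: exp is injective, so every Borel set is the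
  preimage of a Borel set, and the strictly positive weight is removed by integrating its
  reciprocal.\<close>

lemma kappa_image_le_imp_kappa_le:
  assumes le: "\<And>E. E \<in> sets borel \<Longrightarrow> emeasure kappa_image E \<le> emeasure lborel_image E" and A: "A \<in> sets borel"
  shows "emeasure \<kappa> A \<le> emeasure lborel A"
proof -
  note [measurable_cong] = kappa_sets
  let ?K = "density \<kappa> (\<lambda>x. ennreal (kernel x))"
  let ?L = "density (density lborel (indicator {0..})) (\<lambda>x. ennreal (kernel x))"
  have "?K \<le> ?L"
  proof (subst le_measure)
    show "\<forall>A\<in>sets ?K. emeasure ?K A \<le> emeasure ?L A"
    proof
      fix A assume "A \<in> sets ?K"
      then have [measurable]: "A \<in> sets borel" by (simp add: kappa_sets)
      define E where "E = {u. - ln u \<in> A} \<inter> space (borel :: real measure)"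
      have E: "E \<in> sets borel" unfolding E_def by measurable
      have pre: "(\<lambda>x. exp (- x)) -` E = A" by (auto simp: E_def)
      have "emeasure kappa_image E = emeasure ?K A" "emeasure lborel_image E = emeasure ?L A"
        unfolding kappa_image_def lborel_image_def using E sets_eq_imp_space_eq[OF kappa_sets]
        by (subst emeasure_distr; simp add: pre)+
      then show "emeasure ?K A \<le> emeasure ?L A" using le[OF E] by simp
    qed
  qed (simp add: kappa_sets)
  have inv: "ennreal (kernel x) * (ennreal (1 / kernel x) * indicator A x) = indicator A x" for x
    using kernel_pos[of x] by (simp add: mult.assoc[symmetric] ennreal_mult'[OF less_imp_le[OF kernel_pos], symmetric])
  have "emeasure \<kappa> A = (\<integral>\<^sup>+x. ennreal (1 / kernel x) * indicator A x \<partial>?K)"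
    using A by (subst nn_integral_density) (auto simp: inv kappa_sets)
  also have "\<dots> \<le> (\<integral>\<^sup>+x. ennreal (1 / kernel x) * indicator A x \<partial>?L)"
    by (rule nn_integral_mono_measure) (use \<open>?K \<le> ?L\<close> in \<open>auto simp: kappa_sets\<close>)
  also have "\<dots> = emeasure (density lborel (indicator {0..})) A"
    using A by (subst nn_integral_density) (auto simp: inv)
  also have "\<dots> = (\<integral>\<^sup>+x. indicator {0..} x * indicator A x \<partial>lborel)"
    using A by (simp add: emeasure_density)
  also have "\<dots> \<le> (\<integral>\<^sup>+x. indicator A x \<partial>lborel)"
    by (intro nn_integral_mono) (auto simp: indicator_def)
  finally show ?thesis using A by simp
qed

text \<open>The functional is the expectation of p under the law \<open>D\<close> of one factor: by
  independence the n-th power of its j-th moment is \<open>moment j\<close>.\<close>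

lemma mult_inf_div_root:
  assumes mid: "mult_inf_div M (exp_functional \<xi>)" and n: "2 \<le> n" and p: "\<And>x. 0 \<le> poly p x"
  shows "0 \<le> poly_functional (\<lambda>j. moment j powr (1 / real n)) p"
proof -
  obtain N :: "(nat \<Rightarrow> real) measure" and Y where N: "prob_space N"
    and Y: "\<forall>i<n. Y i \<in> borel_measurable N \<and> (AE \<omega> in N. Y i \<omega> > 0)"
    and indep: "prob_space.indep_vars N (\<lambda>_. borel) Y {..<n}"
    and eq: "\<forall>i<n. distr N borel (Y i) = distr N borel (Y 0)"
    and law: "distr N borel (\<lambda>\<omega>. \<Prod>i<n. Y i \<omega>) = distr M borel (exp_functional \<xi>)"
    using mid n unfolding mult_inf_div_def by blast
  interpret N: prob_space N by fact
  have Y_meas: "Y i \<in> borel_measurable N" if "i < n" for i using Y that by blast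
  then have prod_meas: "(\<lambda>\<omega>. \<Prod>i<n. Y i \<omega>) \<in> borel_measurable N" by (intro borel_measurable_prod) auto
  define D where "D = distr N borel (Y 0)"
  have D_sets: "sets D = sets borel" by (simp add: D_def)
  have D_pos: "AE x in D. 0 < x"
    unfolding D_def using Y n by (subst AE_distr_iff) auto
  have D_mom: "(\<integral>\<^sup>+x. ennreal (x ^ j) \<partial>D) = ennreal (moment j powr (1 / real n))" for j
  proof -
    \<comment> \<open>The factors are positive only almost surely and \<open>ennreal\<close> cuts
      negative numbers to 0. With absolute values the product formula holds at every point.\<close>
    define a where "a = (\<integral>\<^sup>+x. ennreal (\<bar>x\<bar> ^ j) \<partial>D)"
    have "N.indep_vars (\<lambda>_. borel) (\<lambda>i \<omega>. ennreal (\<bar>Y i \<omega>\<bar> ^ j)) {..<n}"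
      using indep by (rule N.indep_vars_compose2[where Y="\<lambda>i x. ennreal (\<bar>x\<bar> ^ j)"]) measurable
    then have "(\<integral>\<^sup>+\<omega>. (\<Prod>i<n. ennreal (\<bar>Y i \<omega>\<bar> ^ j)) \<partial>N) = (\<Prod>i<n. \<integral>\<^sup>+\<omega>. ennreal (\<bar>Y i \<omega>\<bar> ^ j) \<partial>N)"
      by (intro N.indep_vars_nn_integral) auto
    also have "\<dots> = (\<Prod>i<n. a)"
    proof (intro prod.cong refl)
      fix i assume "i \<in> {..<n}"
      then have i: "i < n" by simp
      have "(\<integral>\<^sup>+\<omega>. ennreal (\<bar>Y i \<omega>\<bar> ^ j) \<partial>N) = (\<integral>\<^sup>+x. ennreal (\<bar>x\<bar> ^ j) \<partial>distr N borel (Y i))"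
        using Y_meas[OF i] by (subst nn_integral_distr) auto
      also have "distr N borel (Y i) = D" using eq i unfolding D_def by blast
      finally show "(\<integral>\<^sup>+\<omega>. ennreal (\<bar>Y i \<omega>\<bar> ^ j) \<partial>N) = a" by (simp only: a_def)
    qed
    also have "(\<integral>\<^sup>+\<omega>. (\<Prod>i<n. ennreal (\<bar>Y i \<omega>\<bar> ^ j)) \<partial>N) = (\<integral>\<^sup>+\<omega>. ennreal (\<bar>\<Prod>i<n. Y i \<omega>\<bar> ^ j) \<partial>N)"
      by (intro nn_integral_cong) (simp add: prod_ennreal abs_prod prod_power_distrib)
    also have "\<dots> = (\<integral>\<^sup>+x. ennreal (\<bar>x\<bar> ^ j) \<partial>distr N borel (\<lambda>\<omega>. \<Prod>i<n. Y i \<omega>))"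
      using prod_meas by (subst nn_integral_distr) auto
    also have "\<dots> = (\<integral>\<^sup>+\<omega>. ennreal (\<bar>exp_functional \<xi> \<omega>\<bar> ^ j) \<partial>M)"
      unfolding law by (subst nn_integral_distr) auto
    also have "\<dots> = (\<integral>\<^sup>+\<omega>. ennreal (exp_functional \<xi> \<omega> ^ j) \<partial>M)"
      using exp_functional_pos by (intro nn_integral_cong_AE) (auto elim!: eventually_mono)
    also have "\<dots> = ennreal (moment j)" by (rule exp_functional_moment)
    finally have pow: "a ^ n = ennreal (moment j)" by simp
    then have "a \<noteq> \<infinity>" using n by (auto simp: ennreal_top_eq_mult_iff power_eq_top_ennreal)
    then obtain r where r: "0 \<le> r" "a = ennreal r" by (cases a) auto
    then have rn: "r ^ n = moment j" using pow moment_pos[of j] by (simp add: ennreal_power)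
    then have "0 < r" using r moment_pos[of j] n by (metis less_eq_real_def neq0_conv not_numeral_le_zero power_0_left less_irrefl)
    then have "moment j powr (1 / real n) = r"
      using n by (simp add: rn[symmetric] powr_realpow[symmetric] powr_powr)
    moreover have "(\<integral>\<^sup>+x. ennreal (x ^ j) \<partial>D) = a"
      unfolding a_def using D_pos by (intro nn_integral_cong_AE) (auto elim!: eventually_mono)
    ultimately show ?thesis using r by simp
  qed
  have "AE x in D. 0 \<le> x" using D_pos by eventually_elim simp
  then have "poly_functional (\<lambda>j. moment j powr (1 / real n)) p = (LINT x|D. poly p x)"
    using D_mom by (intro poly_functional_moments(4)[OF D_sets, symmetric]) auto
  also have "0 \<le> \<dots>" using p by (intro integral_nonneg_AE) auto
  finally show ?thesis .
qed

text \<open>Testing with the polynomials (x - 1)^2 q(x)^2, which are nonnegative on the whole line and vanish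
  at 1, turns n (E Y^j - 1) into the logarithm of the j-th moment as n tends to infinity.\<close>

lemma mult_inf_div_imp_kappa_le:
  assumes mid: "mult_inf_div M (exp_functional \<xi>)" and A: "A \<in> sets borel"
  shows "emeasure \<kappa> A \<le> emeasure lborel A"
proof (rule kappa_image_le_imp_kappa_le[OF _ A], rule unit_interval_measure_mono[OF kappa_image lborel_image])
  fix q :: "real poly"
  have nonneg: "AE u in kappa_image. 0 \<le> u" "AE u in lborel_image. 0 \<le> u"
    using kappa_image(3) lborel_image(3) by (auto elim!: eventually_mono)
  let ?p = "[:1, -2, 1:] * q\<^sup>2"
  have p_eq: "poly ?p x = (x - 1)\<^sup>2 * (poly q x)\<^sup>2" for x
    by (simp add: power2_eq_square algebra_simps)
  have "0 \<le> poly_functional (\<lambda>j. ln (moment j)) ?p"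
    by (intro poly_functional_ln_nonneg moment_pos mult_inf_div_root[OF mid]) (simp_all only: p_eq, simp_all)
  also have "\<dots> = poly_functional (\<lambda>j. lborel_part j - kappa_part j) (q\<^sup>2)"
    unfolding poly_functional_second_difference moment_second_difference ..
  also have "\<dots> = poly_functional lborel_part (q\<^sup>2) - poly_functional kappa_part (q\<^sup>2)"
    by (simp add: poly_functional_def right_diff_distrib sum_subtractf)
  also have "poly_functional lborel_part (q\<^sup>2) = (LINT u|lborel_image. (poly q u)\<^sup>2)"
    using poly_functional_moments(4)[OF lborel_image(2) nonneg(2) lborel_part_nonneg lborel_image_moment, of "q\<^sup>2"] by simp
  also have "poly_functional kappa_part (q\<^sup>2) = (LINT u|kappa_image. (poly q u)\<^sup>2)"
    using poly_functional_moments(4)[OF kappa_image(2) nonneg(1) kappa_part_nonneg kappa_image_moment, of "q\<^sup>2"] by simp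
  finally show "(LINT u|kappa_image. (poly q u)\<^sup>2) \<le> (LINT u|lborel_image. (poly q u)\<^sup>2)" by simp
qed

end

section \<open>Domination implies divisibility\<close>

text \<open>The coordinates of a finite power of \<rho> are independent copies living on functions
  from \<open>nat\<close> to \<open>real\<close>, the type of sample space asked for by
  \<open>mult_inf_div\<close>.\<close>

lemma iid_coordinates:
  fixes \<rho> :: "real measure" and n :: nat
  assumes \<rho>: "real_distribution \<rho>" and n: "0 < n"
  defines "N \<equiv> PiM {..<n} (\<lambda>_. \<rho>)"
  shows "prob_space N" "\<And>i. i < n \<Longrightarrow> (\<lambda>\<omega>. \<omega> i) \<in> borel_measurable N"
    "\<And>i. i < n \<Longrightarrow> distr N borel (\<lambda>\<omega>. \<omega> i) = \<rho>"
    "prob_space.indep_vars N (\<lambda>_. borel) (\<lambda>i \<omega>. \<omega> i) {..<n}"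
proof -
  interpret \<rho>: real_distribution \<rho> by fact
  show prob: "prob_space N" unfolding N_def by (rule prob_space_PiM) (rule \<rho>.prob_space_axioms)
  show meas: "(\<lambda>\<omega>. \<omega> i) \<in> borel_measurable N" if "i < n" for i
    using that measurable_component_singleton[of i "{..<n}" "\<lambda>_. \<rho>"] by (simp add: N_def measurable_cong_sets[OF refl \<rho>.events_eq_borel])
  show distr: "distr N borel (\<lambda>\<omega>. \<omega> i) = \<rho>" if "i < n" for i
  proof -
    have "distr N borel (\<lambda>\<omega>. \<omega> i) = distr N \<rho> (\<lambda>\<omega>. \<omega> i)"
      by (rule distr_cong) simp_all
    also have "\<dots> = \<rho>"
      unfolding N_def using that \<rho>.prob_space_axioms by (intro distr_PiM_component) auto
    finally show ?thesis .
  qed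
  show "prob_space.indep_vars N (\<lambda>_. borel) (\<lambda>i \<omega>. \<omega> i) {..<n}"
  proof (subst prob_space.indep_vars_iff_distr_eq_PiM'[OF prob])
    have "distr N (PiM {..<n} (\<lambda>_. borel)) (\<lambda>x. \<lambda>i\<in>{..<n}. x i) = distr N N (\<lambda>x. x)"
      by (rule distr_cong) (auto simp: N_def space_PiM PiE_def extensional_restrict intro!: sets_PiM_cong)
    also have "\<dots> = N" by (rule distr_id)
    also have "N = PiM {..<n} (\<lambda>i. distr N borel (\<lambda>\<omega>. \<omega> i))"
      using distr by (subst N_def) (intro PiM_cong, auto)
    finally show "distr N (PiM {..<n} (\<lambda>_. borel)) (\<lambda>x. \<lambda>i\<in>{..<n}. x i) = PiM {..<n} (\<lambda>i. distr N borel (\<lambda>\<omega>. \<omega> i))" .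
  qed (use n meas in auto)
qed

lemma reflect_integral:
  fixes f :: "real \<Rightarrow> real"
  assumes "integrable lborel f"
  shows "integrable lborel (\<lambda>y. f (- y))" "(LINT y|lborel. f (- y)) = (LINT x|lborel. f x)"
  using lborel_integrable_real_affine[OF assms, of "-1" 0] lborel_integral_real_affine[of "-1" f 0] by simp_all

lemma integrable_exp_half_line: "integrable lborel (\<lambda>x. indicator {0..} x * exp (- x / 2) :: real)"
proof (rule integrableI_nonneg)
  have lim: "((\<lambda>x::real. - 2 * exp (- x / 2)) \<longlongrightarrow> 0) at_top" by real_asymp
  have "(\<integral>\<^sup>+x. ennreal (indicator {0..} x * exp (- x / 2)) \<partial>lborel) = (\<integral>\<^sup>+x. ennreal (exp (- x / 2)) * indicator {0..} x \<partial>lborel)"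
    by (intro nn_integral_cong) (auto simp: indicator_def)
  also have "\<dots> = ennreal (0 - - 2 * exp (- 0 / 2))"
    by (rule nn_integral_FTC_atLeast[OF _ _ _ lim]) (auto intro!: derivative_eq_intros)
  finally show "(\<integral>\<^sup>+x. ennreal (indicator {0..} x * exp (- x / 2)) \<partial>lborel) < \<infinity>" by simp
qed auto

text \<open>A density of \<kappa> is at most 1 only almost everywhere, so the formula may turn
  negative on a null set. The maximum with 0 makes it nonnegative everywhere and agrees with the
  truncation that \<open>ennreal\<close> performs in the theorem.\<close>

definition levy_density :: "(real \<Rightarrow> real) \<Rightarrow> real \<Rightarrow> real" where
  "levy_density k y = max 0 (indicator {..<0} y * (1 / y) * (1 / (1 - exp (- y))) * (1 - k (- y)))"

lemma levy_density_measurable[measurable]: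
  assumes [measurable]: "k \<in> borel_measurable borel"
  shows "levy_density k \<in> borel_measurable borel"
  unfolding levy_density_def[abs_def] by measurable

lemma levy_density_nonneg: "0 \<le> levy_density k y"
  by (simp add: levy_density_def)

lemma levy_density_zero: "0 \<le> y \<Longrightarrow> levy_density k y = 0"
  by (simp add: levy_density_def)

lemma levy_density_neg:
  assumes "0 < x"
  shows "levy_density k (- x) = max 0 (1 - k x) / (x * (exp x - 1))"
proof -
  have "0 < x * (exp x - 1)" using assms by simp
  moreover have "indicator {..<0} (- x) * (1 / - x) * (1 / (1 - exp x)) * (1 - k x) = (1 - k x) / (x * (exp x - 1))"
    using assms by (simp add: divide_simps) (simp add: algebra_simps)
  ultimately show ?thesis by (simp add: levy_density_def max_def zero_le_divide_iff divide_le_0_iff)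
qed

text \<open>The identity that dictates the Levy density: \<open>kernel x\<close> is (exp (- x) -
  1)^2 / (x (exp x - 1)), so the square coming from the second difference of exponentials
  cancels.\<close>

lemma levy_density_kernel:
  assumes x: "0 < x"
  shows "exp (m * - x) * (exp (- x) - 1)\<^sup>2 * levy_density k (- x) = exp (- m * x) * kernel x * max 0 (1 - k x)"
proof -
  have "exp x - 1 \<noteq> 0" using x by simp
  moreover have "exp (- 2 * x) = exp (- x) * exp (- x)" by (simp add: mult_exp_exp)
  ultimately have K: "kernel x = (exp (- x) - 1)\<^sup>2 / (x * (exp x - 1))"
    using x unfolding kernel_def by (simp add: field_simps power2_eq_square exp_minus)
  show ?thesis by (simp add: levy_density_neg[OF x] K)
qed

text \<open>Factoring exp x - 1 as (exp (x/2) - 1) (exp (x/2) + 1) bounds it below by (x/2) exp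
  (x/2). This handles the singularity at 0 and the decay at infinity at once. The bound is written
  in \<open>- y\<close> so that it is a reflected half-line exponential.\<close>

lemma levy_density_sq_le:
  assumes k: "\<And>x. 0 \<le> k x"
  shows "y\<^sup>2 * levy_density k y \<le> 2 * (indicator {0..} (- y) * exp (- (- y) / 2))"
proof (cases "y < 0")
  case True
  define x where "x = - y"
  have x: "0 < x" using True by (simp add: x_def)
  have "exp x = exp (x / 2) * exp (x / 2)" by (simp add: mult_exp_exp)
  then have "exp x - 1 = (exp (x / 2) - 1) * (exp (x / 2) + 1)" by (simp add: algebra_simps)
  also have "\<dots> \<ge> x / 2 * exp (x / 2)"
    using x exp_ge_add_one_self[of "x / 2"] by (intro mult_mono) (linarith, simp_all)
  finally have le: "x / 2 * exp (x / 2) \<le> exp x - 1" .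
  have pos: "0 < exp x - 1" "0 < exp (x / 2)" using x by simp_all
  have "x\<^sup>2 * levy_density k (- x) = x / (exp x - 1) * max 0 (1 - k x)"
    using x by (simp add: levy_density_neg power2_eq_square)
  also have "\<dots> \<le> x / (exp x - 1) * 1"
    using x k[of x] pos by (intro mult_left_mono) auto
  also have "\<dots> \<le> 2 * exp (- x / 2)"
    using le pos by (simp add: exp_minus field_simps)
  finally show ?thesis using x by (simp add: x_def)
next
  case False
  then show ?thesis by (simp add: levy_density_zero)
qed

lemma levy_density_sq_integrable:
  assumes k[measurable]: "k \<in> borel_measurable borel" and "\<And>x. 0 \<le> k x"
  shows "integrable lborel (\<lambda>y. y\<^sup>2 * levy_density k y)"
proof (rule Bochner_Integration.integrable_bound)
  show "integrable lborel (\<lambda>y::real. 2 * (indicator {0..} (- y) * exp (- (- y) / 2)))"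
    using reflect_integral(1)[OF integrable_exp_half_line] by (intro integrable_mult_right)
  show "AE y in lborel. norm (y\<^sup>2 * levy_density k y) \<le> norm (2 * (indicator {0..} (- y) * exp (- (- y) / 2)) :: real)"
    using levy_density_sq_le[OF assms(2)] levy_density_nonneg by (intro AE_I2) (simp add: abs_mult)
qed auto

lemma exp_second_order_integrable:
  assumes k[measurable]: "k \<in> borel_measurable borel" and k0: "\<And>x. 0 \<le> k x"
  shows "integrable lborel (\<lambda>y. (exp (real m * y) - 1 - real m * y) * levy_density k y)"
proof (rule Bochner_Integration.integrable_bound)
  show "integrable lborel (\<lambda>y. 3 * (real m)\<^sup>2 * (y\<^sup>2 * levy_density k y))"
    using levy_density_sq_integrable[OF assms] by (intro integrable_mult_right)
  show "AE y in lborel. norm ((exp (real m * y) - 1 - real m * y) * levy_density k y) \<le> norm (3 * (real m)\<^sup>2 * (y\<^sup>2 * levy_density k y))"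
  proof (rule AE_I2)
    fix y
    show "norm ((exp (real m * y) - 1 - real m * y) * levy_density k y) \<le> norm (3 * (real m)\<^sup>2 * (y\<^sup>2 * levy_density k y))"
    proof (cases "0 \<le> y")
      case False
      have "norm (exp (of_real (real m * y)) - 1 - complex_of_real (real m * y)) \<le> 3 * (norm (complex_of_real (real m * y)))\<^sup>2"
        using False by (intro norm_exp_minus_one_minus_le) (simp add: mult_nonneg_nonpos)
      moreover have "exp (of_real (real m * y)) - 1 - complex_of_real (real m * y) = of_real (exp (real m * y) - 1 - real m * y)"
        by (simp only: exp_of_real of_real_diff of_real_1)
      ultimately have "\<bar>exp (real m * y) - 1 - real m * y\<bar> \<le> 3 * (real m)\<^sup>2 * y\<^sup>2"
        by (simp only: norm_of_real) (simp add: power_mult_distrib)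
      from mult_right_mono[OF this levy_density_nonneg[of k y]] show ?thesis
        using levy_density_nonneg[of k y] by (simp add: abs_mult mult.assoc)
    qed (simp add: levy_density_zero)
  qed
qed auto

section \<open>Uniqueness of the law with the given moments\<close>

context subordinator_kappa
begin

lemma moment_le: "moment n \<le> fact n / \<Phi> 1 ^ n"
proof -
  have "(\<Prod>j=1..n. \<Phi> 1) \<le> (\<Prod>j=1..n. \<Phi> (real j))"
    using Phi_pos[of 1] by (intro prod_mono) (auto intro!: Phi_mono)
  then have "\<Phi> 1 ^ n \<le> (\<Prod>j=1..n. \<Phi> (real j))" by simp
  then show ?thesis
    using Phi_pos[of 1] unfolding moment_def by (intro divide_left_mono mult_pos_pos prod_pos) (auto intro: Phi_pos)
qed

text \<open>By \<open>moment_le\<close> the j-th moment is at most fact j / (\<Phi> 1)^j. At half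
  the rate \<open>\<Phi> 1\<close> the exponential series is therefore dominated by the geometric
  series of ratio 1/2.\<close>

lemma moment_exp_integrable:
  assumes D: "real_distribution D" "AE x in D. 0 \<le> x" "\<And>j. (\<integral>\<^sup>+x. ennreal (x ^ j) \<partial>D) = ennreal (moment j)"
  shows "integrable D (\<lambda>x. exp (\<Phi> 1 / 2 * \<bar>x\<bar>))"
proof -
  interpret D: real_distribution D by fact
  define d where "d = \<Phi> 1 / 2"
  have d: "0 < d" using Phi_pos[of 1] by (simp add: d_def)
  have "(\<integral>\<^sup>+x. ennreal (exp (d * \<bar>x\<bar>)) \<partial>D) = (\<integral>\<^sup>+x. (\<Sum>j. ennreal (d ^ j / fact j) * ennreal (x ^ j)) \<partial>D)"
  proof (rule nn_integral_cong_AE)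
    show "AE x in D. ennreal (exp (d * \<bar>x\<bar>)) = (\<Sum>j. ennreal (d ^ j / fact j) * ennreal (x ^ j))"
      using D(2)
    proof eventually_elim
      case (elim x)
      have "(\<lambda>j. (d * x) ^ j /\<^sub>R fact j) sums exp (d * x)" by (rule exp_converges)
      then have "(\<Sum>j. ennreal ((d * x) ^ j /\<^sub>R fact j)) = ennreal (exp (d * x))"
        using d elim by (intro suminf_ennreal_eq) auto
      moreover have "ennreal ((d * x) ^ j /\<^sub>R fact j) = ennreal (d ^ j / fact j) * ennreal (x ^ j)" for j
      proof -
        have "(d * x) ^ j /\<^sub>R fact j = (d ^ j / fact j) * x ^ j" by (simp add: power_mult_distrib field_simps)
        moreover have "0 \<le> d ^ j / fact j" using d by simp
        ultimately show ?thesis by (simp only: ennreal_mult')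
      qed
      ultimately show ?case using elim by simp
    qed
  qed
  also have "\<dots> = (\<Sum>j. \<integral>\<^sup>+x. ennreal (d ^ j / fact j) * ennreal (x ^ j) \<partial>D)"
    by (rule nn_integral_suminf) measurable
  also have "\<dots> = (\<Sum>j. ennreal (d ^ j / fact j) * ennreal (moment j))"
    by (subst nn_integral_cmult) (simp_all add: D(3))
  also have "\<dots> \<le> (\<Sum>j. ennreal ((1 / 2) ^ j))"
  proof (intro suminf_le allI)
    fix j
    have "d ^ j / fact j * moment j \<le> d ^ j / fact j * (fact j / \<Phi> 1 ^ j)"
      using d by (intro mult_left_mono moment_le) auto
    also have "\<dots> = (1 / 2) ^ j" using Phi_pos[of 1] by (simp add: d_def power_divide)
    finally show "ennreal (d ^ j / fact j) * ennreal (moment j) \<le> ennreal ((1 / 2) ^ j)"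
      using d by (subst ennreal_mult'[symmetric]) (auto intro: ennreal_leI)
  qed auto
  also have "\<dots> = ennreal 2" by (intro suminf_ennreal_eq) (use geometric_sums[of "1/2::real"] in auto)
  finally have "(\<integral>\<^sup>+x. ennreal (exp (d * \<bar>x\<bar>)) \<partial>D) < \<infinity>" by (rule le_less_trans) simp
  then show ?thesis unfolding d_def by (intro integrableI_nonneg) auto
qed

lemma moment_distribution_unique:
  assumes D: "real_distribution D" "AE x in D. 0 \<le> x" "\<And>j. (\<integral>\<^sup>+x. ennreal (x ^ j) \<partial>D) = ennreal (moment j)"
    and D': "real_distribution D'" "AE x in D'. 0 \<le> x" "\<And>j. (\<integral>\<^sup>+x. ennreal (x ^ j) \<partial>D') = ennreal (moment j)"
  shows "D = D'"
proof (rule moments_determine_distribution[OF D(1) moment_exp_integrable[OF D] D'(1) moment_exp_integrable[OF D']])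
  have "sets D = sets borel" "sets D' = sets borel"
    using D(1) D'(1) by (simp_all add: real_distribution.events_eq_borel)
  then have "(LINT x|D. x ^ n) = moment n" "(LINT x|D'. x ^ n) = moment n" for n
    using D(2,3) D'(2,3) by (intro poly_functional_moments(2) less_imp_le[OF moment_pos]; simp)+
  then show "(LINT x|D. x ^ n) = (LINT x|D'. x ^ n)" for n by simp
qed (use Phi_pos[of 1] in simp)

end

section \<open>The law of the logarithm when the density is at most 1\<close>

locale kappa_density = subordinator_kappa +
  fixes k :: "real \<Rightarrow> real"
  assumes k_measurable[measurable]: "k \<in> borel_measurable borel" and k_nonneg: "\<And>x. 0 \<le> k x"
    and k_density: "\<kappa> = density lborel (\<lambda>x. ennreal (k x))"
    and k_le_1: "AE x in lborel. k x \<le> 1"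
begin

abbreviation "h \<equiv> levy_density k"

lemma k_zero_AE: "AE x in lborel. x < 0 \<longrightarrow> k x = 0"
proof -
  have "(\<integral>\<^sup>+x. ennreal (k x) * indicator {..<0} x \<partial>lborel) = 0"
    using kappa_supp unfolding k_density by (subst (asm) emeasure_density) auto
  then have "AE x in lborel. ennreal (k x) * indicator {..<0} x = 0"
    by (subst (asm) nn_integral_0_iff_AE) auto
  then show ?thesis
    by eventually_elim (use k_nonneg in \<open>auto simp: indicator_def split: if_splits intro: antisym\<close>)
qed

lemma levy_density_second_difference:
  "(LINT y|lborel. exp (real m * y) * (exp y - 1)\<^sup>2 * h y) = lborel_part m - kappa_part m"
proof -
  define w where "w x = exp (- real m * x) * kernel x" for x
  have w_meas[measurable]: "w \<in> borel_measurable borel" unfolding w_def[abs_def] by measurable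
  have w_nonneg: "0 \<le> w x" for x using kernel_pos[of x] by (simp add: w_def)
  have "(\<integral>\<^sup>+x. ennreal (indicator {0..} x * w x) \<partial>lborel) = (\<integral>\<^sup>+x. ennreal (w x) * indicator {0..} x \<partial>lborel)"
    by (intro nn_integral_cong) (auto simp: indicator_def)
  also have "\<dots> = ennreal (lborel_part m)"
    unfolding w_def lborel_part_def by (rule nn_integral_exp_kernel_lborel) simp
  finally have P1: "integrable lborel (\<lambda>x. indicator {0..} x * w x) \<and> (LINT x|lborel. indicator {0..} x * w x) = lborel_part m"
    using w_nonneg lborel_part_nonneg by (subst (asm) nn_integral_eq_integrable) auto
  have "(\<integral>\<^sup>+x. ennreal (k x * w x) \<partial>lborel) = (\<integral>\<^sup>+x. ennreal (w x) \<partial>\<kappa>)"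
    unfolding k_density using k_nonneg by (subst nn_integral_density) (auto simp: ennreal_mult')
  also have "\<dots> = ennreal (kappa_part m)" unfolding w_def by (rule nn_integral_kappa)
  finally have P2: "integrable lborel (\<lambda>x. k x * w x) \<and> (LINT x|lborel. k x * w x) = kappa_part m"
    using w_nonneg k_nonneg kappa_part_nonneg by (subst (asm) nn_integral_eq_integrable) auto
  let ?f = "\<lambda>x. indicator {0..} x * w x - k x * w x"
  have f: "integrable lborel ?f" "(LINT x|lborel. ?f x) = lborel_part m - kappa_part m"
    using P1 P2 by (simp_all add: Bochner_Integration.integral_diff)
  \<comment> \<open>Three null sets are discarded: where k exceeds 1 and \<open>max 0\<close> would
    act, where k is nonzero on the negative half line, and the point 0, where \<open>h\<close>
    vanishes but \<open>kernel\<close> is 1.\<close>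
  have ae: "AE x in lborel. exp (real m * - x) * (exp (- x) - 1)\<^sup>2 * h (- x) = ?f x"
    using k_le_1 k_zero_AE AE_lborel_singleton[of 0]
  proof eventually_elim
    case (elim x)
    show ?case
    proof (cases "0 < x")
      case True
      then show ?thesis
        unfolding levy_density_kernel[OF True] using elim by (simp add: w_def algebra_simps)
    next
      case False
      then show ?thesis using elim by (simp add: levy_density_zero indicator_def)
    qed
  qed
  let ?g = "\<lambda>y. exp (real m * y) * (exp y - 1)\<^sup>2 * h y"
  have g_meas: "(\<lambda>x. ?g (- x)) \<in> borel_measurable lborel" by measurable
  have "integrable lborel (\<lambda>x. ?g (- x))"
    by (subst integrable_cong_AE[OF g_meas _ ae]) (use f in auto)
  then have "(LINT y|lborel. ?g (- (- y))) = (LINT x|lborel. ?g (- x))"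
    by (rule reflect_integral(2))
  also have "\<dots> = (LINT x|lborel. ?f x)"
    by (rule integral_cong_AE[OF g_meas _ ae]) (use f(1) in auto)
  finally show ?thesis using f(2) by simp
qed

definition Psi :: "nat \<Rightarrow> real" where
  "Psi m = (LINT y|lborel. (exp (real m * y) - 1 - real m * y) * h y)"

text \<open>Two sequences with equal second differences agree once they agree at 0 and 1. At 0 both
  logarithms vanish; this shift makes them agree at 1.\<close>

definition drift :: real where
  "drift = ln (moment 1) - Psi 1"

lemma Psi_second_difference: "Psi (m + 2) - 2 * Psi (m + 1) + Psi m = lborel_part m - kappa_part m"
proof -
  let ?g = "\<lambda>m y. (exp (real m * y) - 1 - real m * y) * h y"
  have int: "integrable lborel (?g m)" for m
    by (rule exp_second_order_integrable[OF k_measurable k_nonneg])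
  have "Psi (m + 2) - 2 * Psi (m + 1) + Psi m = (LINT y|lborel. ?g (m + 2) y - 2 * ?g (m + 1) y + ?g m y)"
    unfolding Psi_def
    by (subst Bochner_Integration.integral_add[OF Bochner_Integration.integrable_diff[OF int integrable_mult_right[OF int]] int],
        subst Bochner_Integration.integral_diff[OF int integrable_mult_right[OF int]], subst integral_mult_right_zero) rule
  also have "\<dots> = (LINT y|lborel. exp (real m * y) * (exp y - 1)\<^sup>2 * h y)"
  proof (intro Bochner_Integration.integral_cong refl)
    fix y
    have e: "exp (real (m + 2) * y) = exp (real m * y) * (exp y)\<^sup>2" "exp (real (m + 1) * y) = exp (real m * y) * exp y"
      by (simp_all add: power2_eq_square mult_exp_exp algebra_simps)
    show "?g (m + 2) y - 2 * ?g (m + 1) y + ?g m y = exp (real m * y) * (exp y - 1)\<^sup>2 * h y"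
      unfolding e by (simp add: power2_eq_square algebra_simps)
  qed
  finally show ?thesis by (simp only: levy_density_second_difference)
qed

lemma ln_moment: "drift * real m + Psi m = ln (moment m)"
proof -
  have "drift * real m + Psi m = ln (moment m) \<and> drift * real (Suc m) + Psi (Suc m) = ln (moment (Suc m))"
  proof (induction m)
    case 0
    then show ?case by (simp add: drift_def moment_zero) (simp add: Psi_def)
  next
    case (Suc m)
    then show ?case
      using Psi_second_difference[of m] moment_second_difference[of m] by (simp add: algebra_simps)
  qed
  then show ?thesis ..
qed

text \<open>Scaling the Levy density and the drift by \<theta> multiplies the exponent by \<theta>.
  The case \<theta> = 1 gives the law of the logarithm of the functional, and \<theta> = 1/n its
  n-th convolution root.\<close>

lemma convolution_root_exists:
  assumes \<theta>: "0 \<le> \<theta>"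
  obtains \<rho> where "real_distribution \<rho>"
    "\<And>t. char \<rho> t = exp (of_real \<theta> * (\<i> * of_real (drift * t)
       + (CLINT y|lborel. (iexp (t * y) - 1 - \<i> * of_real (t * y)) * of_real (h y))))"
    "\<And>m::nat. integrable \<rho> (\<lambda>y. exp (real m * y))"
    "\<And>m::nat. (LINT y|\<rho>. exp (real m * y)) = moment m powr \<theta>"
proof -
  have int: "integrable lborel (\<lambda>y. y\<^sup>2 * (\<theta> * h y))"
    using integrable_mult_right[OF levy_density_sq_integrable[OF k_measurable k_nonneg], of \<theta>]
    by (simp add: mult.left_commute)
  obtain \<mu> where \<mu>: "real_distribution \<mu>"
    "\<And>t. char \<mu> t = exp (CLINT y|lborel. (iexp (t * y) - 1 - \<i> * of_real (t * y)) * of_real (\<theta> * h y))"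
    "\<And>m::nat. integrable \<mu> (\<lambda>y. exp (real m * y))"
    "\<And>m::nat. (LINT y|\<mu>. exp (real m * y)) = exp (LINT y|lborel. (exp (real m * y) - 1 - real m * y) * (\<theta> * h y))"
    by (rule infinitely_divisible_exists[of "\<lambda>y. \<theta> * h y"])
      (use \<theta> levy_density_nonneg[of k] levy_density_zero[of _ k] int that in \<open>simp_all (no_asm_simp)\<close>)
  interpret \<mu>: real_distribution \<mu> by fact
  define \<rho> where "\<rho> = distr \<mu> borel (\<lambda>y. y + \<theta> * drift)"
  have exp_shift: "exp (real m * (y + \<theta> * drift)) = exp (real m * \<theta> * drift) * exp (real m * y)" for m y
    by (simp add: mult_exp_exp algebra_simps)
  show ?thesis
  proof (rule that)
    show "real_distribution \<rho>" unfolding \<rho>_def by (rule \<mu>.real_distribution_distr) simp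
    fix t
    have "char \<rho> t = (CLINT y|\<mu>. iexp (t * (y + \<theta> * drift)))"
      unfolding \<rho>_def char_def by (subst integral_distr) auto
    also have "\<dots> = (CLINT y|\<mu>. exp (\<i> * of_real (t * \<theta> * drift)) * iexp (t * y))"
      by (intro Bochner_Integration.integral_cong refl) (simp add: mult_exp_exp algebra_simps)
    also have "\<dots> = exp (\<i> * of_real (t * \<theta> * drift)) * char \<mu> t"
      unfolding char_def by (rule integral_mult_right_zero)
    also have "(CLINT y|lborel. (iexp (t * y) - 1 - \<i> * of_real (t * y)) * of_real (\<theta> * h y))
      = of_real \<theta> * (CLINT y|lborel. (iexp (t * y) - 1 - \<i> * of_real (t * y)) * of_real (h y))"
      by (subst integral_mult_right_zero[symmetric]) (simp add: mult.left_commute)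
    then have "exp (\<i> * of_real (t * \<theta> * drift)) * char \<mu> t = exp (of_real \<theta> * (\<i> * of_real (drift * t)
       + (CLINT y|lborel. (iexp (t * y) - 1 - \<i> * of_real (t * y)) * of_real (h y))))"
      unfolding \<mu>(2) by (simp only:) (simp add: mult_exp_exp algebra_simps)
    finally show "char \<rho> t = exp (of_real \<theta> * (\<i> * of_real (drift * t)
       + (CLINT y|lborel. (iexp (t * y) - 1 - \<i> * of_real (t * y)) * of_real (h y))))" .
  next
    fix m :: nat
    show "integrable \<rho> (\<lambda>y. exp (real m * y))"
      unfolding \<rho>_def using \<mu>(3)[of m] by (subst integrable_distr_eq) (auto simp: exp_shift)
    have "(LINT y|lborel. (exp (real m * y) - 1 - real m * y) * (\<theta> * h y)) = \<theta> * Psi m"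
      unfolding Psi_def by (subst integral_mult_right_zero[symmetric]) (simp add: mult.left_commute)
    then have "(LINT y|\<rho>. exp (real m * y)) = exp (real m * \<theta> * drift) * exp (\<theta> * Psi m)"
      unfolding \<rho>_def using \<mu>(4)[of m] by (subst integral_distr) (auto simp: exp_shift)
    also have "\<dots> = exp (\<theta> * (drift * real m + Psi m))" by (simp add: mult_exp_exp algebra_simps)
    finally show "(LINT y|\<rho>. exp (real m * y)) = moment m powr \<theta>"
      using moment_pos[of m] by (simp only: ln_moment) (simp add: powr_def)
  qed
qed

lemma exp_functional_law:
  assumes \<rho>: "real_distribution \<rho>" and int: "\<And>m::nat. integrable \<rho> (\<lambda>y. exp (real m * y))"
    and mom: "\<And>m::nat. (LINT y|\<rho>. exp (real m * y)) = moment m"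
  shows "distr \<rho> borel exp = distr M borel (exp_functional \<xi>)"
proof -
  interpret \<rho>: real_distribution \<rho> by fact
  show ?thesis
  proof (rule moment_distribution_unique)
    show "real_distribution (distr \<rho> borel exp)" by (rule \<rho>.real_distribution_distr) simp
    show "real_distribution (distr M borel (exp_functional \<xi>))" by (rule real_distribution_distr) simp
    show "AE x in distr \<rho> borel exp. 0 \<le> x" by (subst AE_distr_iff) auto
    show "AE x in distr M borel (exp_functional \<xi>). 0 \<le> x"
      using exp_functional_pos by (subst AE_distr_iff) (auto elim!: eventually_mono)
    show "(\<integral>\<^sup>+x. ennreal (x ^ j) \<partial>distr M borel (exp_functional \<xi>)) = ennreal (moment j)" for j
      by (subst nn_integral_distr) (auto simp: exp_functional_moment)
    show "(\<integral>\<^sup>+x. ennreal (x ^ j) \<partial>distr \<rho> borel exp) = ennreal (moment j)" for j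
    proof -
      have "(\<integral>\<^sup>+x. ennreal (x ^ j) \<partial>distr \<rho> borel exp) = (\<integral>\<^sup>+y. ennreal (exp (real j * y)) \<partial>\<rho>)"
        by (subst nn_integral_distr) (auto simp: exp_of_nat_mult)
      also have "\<dots> = ennreal (moment j)"
        using nn_integral_eq_integral[OF int[of j]] mom by simp
      finally show ?thesis .
    qed
  qed
qed

lemma levy_measure_exp_functional:
  "levy_measure_of (distr M borel (\<lambda>\<omega>. ln (exp_functional \<xi> \<omega>))) (density lborel (\<lambda>y. ennreal (h y)))"
proof -
  let ?\<nu> = "density lborel (\<lambda>y. ennreal (h y))"
  obtain \<rho> where \<rho>: "real_distribution \<rho>"
    "\<And>t. char \<rho> t = exp (of_real 1 * (\<i> * of_real (drift * t)
       + (CLINT y|lborel. (iexp (t * y) - 1 - \<i> * of_real (t * y)) * of_real (h y))))"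
    "\<And>m::nat. integrable \<rho> (\<lambda>y. exp (real m * y))"
    "\<And>m::nat. (LINT y|\<rho>. exp (real m * y)) = moment m powr 1"
    using convolution_root_exists[of 1] by auto
  interpret \<rho>: real_distribution \<rho> by fact
  have "distr M borel (\<lambda>\<omega>. ln (exp_functional \<xi> \<omega>)) = distr (distr M borel (exp_functional \<xi>)) borel ln"
    by (subst distr_distr) (auto simp: comp_def)
  also have "distr M borel (exp_functional \<xi>) = distr \<rho> borel exp"
    by (rule exp_functional_law[symmetric]) (use \<rho> moment_pos in \<open>auto simp: less_imp_le\<close>)
  also have "distr (distr \<rho> borel exp) borel ln = distr \<rho> \<rho> (\<lambda>x. x)"
    by (subst distr_distr, simp, simp) (rule distr_cong, simp_all)
  also have "\<dots> = \<rho>" by (rule distr_id)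
  finally have law: "distr M borel (\<lambda>\<omega>. ln (exp_functional \<xi> \<omega>)) = \<rho>" .
  have sq_int: "integrable lborel (\<lambda>y. y\<^sup>2 * h y)"
    by (rule levy_density_sq_integrable[OF k_measurable k_nonneg])
  have "(\<integral>\<^sup>+x. ennreal (min 1 (x\<^sup>2)) \<partial>?\<nu>) = (\<integral>\<^sup>+x. ennreal (h x) * ennreal (min 1 (x\<^sup>2)) \<partial>lborel)"
    by (subst nn_integral_density) auto
  also have "\<dots> \<le> (\<integral>\<^sup>+x. ennreal (x\<^sup>2 * h x) \<partial>lborel)"
    using levy_density_nonneg[of k]
    by (intro nn_integral_mono) (auto simp: ennreal_mult'[symmetric] mult.commute intro!: ennreal_leI mult_left_mono)
  also have "\<dots> < \<infinity>"
    using nn_integral_eq_integral[OF sq_int] levy_density_nonneg[of k] by simp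
  finally have fin: "(\<integral>\<^sup>+x. ennreal (min 1 (x\<^sup>2)) \<partial>?\<nu>) < \<infinity>" .
  have "emeasure ?\<nu> {0} = (\<integral>\<^sup>+y. ennreal (h y) * indicator {0} y \<partial>lborel)"
    by (rule emeasure_density) auto
  also have "\<dots> = (\<integral>\<^sup>+y. 0 \<partial>(lborel :: real measure))"
    by (intro nn_integral_cong) (auto split: split_indicator simp: levy_density_zero)
  finally have atom: "emeasure ?\<nu> {0} = 0" by simp
  \<comment> \<open>The law was built with the compensator y on the whole line, whereas
    \<open>levy_measure_of\<close> compensates on [-1, 1] only. The difference is at most y^2 in
    modulus, so it integrates to a finite \<open>e\<close>, to be subtracted from the drift. There
    is no Gaussian part.\<close>
  define e where "e = (LINT y|lborel. (y - y * indicator {-1..1} y) * h y)"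
  have e_int: "integrable lborel (\<lambda>y. (y - y * indicator {-1..1} y) * h y)"
  proof (rule Bochner_Integration.integrable_bound[OF sq_int])
    have "\<bar>y - y * indicator {-1..1} y\<bar> \<le> y\<^sup>2" for y :: real
    proof (cases "\<bar>y\<bar> \<le> 1")
      case False
      then have "\<bar>y\<bar> * 1 \<le> \<bar>y\<bar> * \<bar>y\<bar>" by (intro mult_left_mono) auto
      then show ?thesis using False by (simp add: indicator_def power2_eq_square abs_mult[symmetric] split: if_splits)
    qed (simp add: indicator_def abs_le_iff)
    then show "AE y in lborel. norm ((y - y * indicator {-1..1} y) * h y) \<le> norm (y\<^sup>2 * h y)"
      using levy_density_nonneg[of k] by (intro AE_I2) (auto simp: abs_mult intro!: mult_right_mono)
  qed simp
  have "char \<rho> t = exp (\<i> * complex_of_real ((drift - e) * t) - complex_of_real (0 * t\<^sup>2 / 2)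
           + (CLINT x|?\<nu>. iexp (t * x) - 1 - \<i> * complex_of_real (t * x * indicator {-1..1} x)))" for t
  proof -
    have int1: "integrable lborel (\<lambda>y. (iexp (t * y) - 1 - \<i> * of_real (t * y)) * complex_of_real (h y))"
    proof (rule Bochner_Integration.integrable_bound[OF integrable_mult_right[OF sq_int, of "3 * t\<^sup>2"]])
      show "AE y in lborel. norm ((iexp (t * y) - 1 - \<i> * of_real (t * y)) * complex_of_real (h y)) \<le> norm (3 * t\<^sup>2 * (y\<^sup>2 * h y))"
      proof (rule AE_I2)
        fix y
        have "norm (iexp (t * y) - 1 - \<i> * of_real (t * y)) \<le> 3 * (norm (\<i> * complex_of_real (t * y)))\<^sup>2"
          by (rule norm_exp_minus_one_minus_le) simp
        also have "\<dots> = 3 * t\<^sup>2 * y\<^sup>2" by (simp add: norm_mult power_mult_distrib)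
        finally show "norm ((iexp (t * y) - 1 - \<i> * of_real (t * y)) * complex_of_real (h y)) \<le> norm (3 * t\<^sup>2 * (y\<^sup>2 * h y))"
          using levy_density_nonneg[of k y] mult_right_mono[OF _ levy_density_nonneg[of k y]]
          by (simp add: norm_mult abs_mult mult.assoc[symmetric])
      qed
    qed simp
    have int2: "integrable lborel (\<lambda>y. \<i> * of_real t * complex_of_real ((y - y * indicator {-1..1} y) * h y))"
      by (intro integrable_mult_right integrable_of_real e_int)
    have "(CLINT x|?\<nu>. iexp (t * x) - 1 - \<i> * complex_of_real (t * x * indicator {-1..1} x))
      = (CLINT y|lborel. h y *\<^sub>R (iexp (t * y) - 1 - \<i> * complex_of_real (t * y * indicator {-1..1} y)))"
      using levy_density_nonneg[of k] by (subst integral_density) auto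
    also have "\<dots> = (CLINT y|lborel. (iexp (t * y) - 1 - \<i> * of_real (t * y)) * complex_of_real (h y)
        + \<i> * of_real t * complex_of_real ((y - y * indicator {-1..1} y) * h y))"
      by (intro Bochner_Integration.integral_cong refl) (simp add: scaleR_conv_of_real algebra_simps)
    also have "\<dots> = (CLINT y|lborel. (iexp (t * y) - 1 - \<i> * of_real (t * y)) * complex_of_real (h y))
        + \<i> * of_real t * of_real e"
      unfolding Bochner_Integration.integral_add[OF int1 int2] e_def
      by (simp only: integral_mult_right_zero integral_complex_of_real)
    finally show ?thesis unfolding \<rho>(2) by (simp add: algebra_simps)
  qed
  then show ?thesis
    unfolding levy_measure_of_def law using fin atom
    by (intro conjI exI[of _ "drift - e"] exI[of _ 0]) auto
qed

text \<open>The factors are exponentials of n independent copies of the root for \<theta> = 1/n.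
  Their sum is identified by its characteristic function with the law for \<theta> = 1, whose image
  under exp is the law of the functional.\<close>

lemma mult_inf_div_exp_functional: "mult_inf_div M (exp_functional \<xi>)"
  unfolding mult_inf_div_def
proof (intro allI impI)
  fix n :: nat assume n: "2 \<le> n"
  define C where "C t = \<i> * of_real (drift * t)
       + (CLINT y|lborel. (iexp (t * y) - 1 - \<i> * of_real (t * y)) * of_real (h y))" for t
  obtain \<rho>1 where \<rho>1: "real_distribution \<rho>1" "\<And>t. char \<rho>1 t = exp (of_real 1 * C t)"
    "\<And>m::nat. integrable \<rho>1 (\<lambda>y. exp (real m * y))" "\<And>m::nat. (LINT y|\<rho>1. exp (real m * y)) = moment m powr 1"
    unfolding C_def using convolution_root_exists[of 1] by auto
  obtain \<rho> where \<rho>: "real_distribution \<rho>" "\<And>t. char \<rho> t = exp (of_real (1 / real n) * C t)"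
    by (rule convolution_root_exists[of "1 / real n"]) (simp, rule that, assumption, simp only: C_def)
  define N where "N = PiM {..<n} (\<lambda>_. \<rho>)"
  have n0: "0 < n" using n by simp
  note iid = iid_coordinates[OF \<rho>(1) n0, folded N_def]
  interpret N: prob_space N by (rule iid(1))
  define Y where "Y i \<omega> = exp (\<omega> i)" for i and \<omega> :: "nat \<Rightarrow> real"
  have Y_meas: "Y i \<in> borel_measurable N" if "i < n" for i
    unfolding Y_def[abs_def] using iid(2)[OF that] by measurable
  have S_meas: "(\<lambda>\<omega>. \<Sum>i<n. \<omega> i) \<in> borel_measurable N" using iid(2) by (intro borel_measurable_sum) auto
  have Y_distr: "distr N borel (Y i) = distr \<rho> borel exp" if "i < n" for i
  proof -
    have "distr N borel (Y i) = distr (distr N borel (\<lambda>\<omega>. \<omega> i)) borel exp"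
      using iid(2)[OF that] by (subst distr_distr) (auto simp: comp_def Y_def[abs_def])
    then show ?thesis by (simp add: iid(3)[OF that])
  qed
  have "distr N borel (\<lambda>\<omega>. \<Sum>i<n. \<omega> i) = \<rho>1"
  proof (rule Levy_uniqueness[OF _ \<rho>1(1)])
    show "real_distribution (distr N borel (\<lambda>\<omega>. \<Sum>i<n. \<omega> i))" by (rule N.real_distribution_distr[OF S_meas])
    show "char (distr N borel (\<lambda>\<omega>. \<Sum>i<n. \<omega> i)) = char \<rho>1"
    proof
      fix t
      have "char (distr N borel (\<lambda>\<omega>. \<Sum>i<n. \<omega> i)) t = (\<Prod>i<n. char (distr N borel (\<lambda>\<omega>. \<omega> i)) t)"
        by (rule N.char_distr_sum[OF iid(4)])
      also have "\<dots> = exp (of_real (1 / real n) * C t) ^ n" by (simp add: iid(3) \<rho>(2))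
      also have "\<dots> = exp (C t)" using n0 by (simp add: exp_of_nat_mult[symmetric])
      finally show "char (distr N borel (\<lambda>\<omega>. \<Sum>i<n. \<omega> i)) t = char \<rho>1 t" by (simp add: \<rho>1(2))
    qed
  qed
  moreover have "distr N borel (\<lambda>\<omega>. \<Prod>i<n. Y i \<omega>) = distr (distr N borel (\<lambda>\<omega>. \<Sum>i<n. \<omega> i)) borel exp"
    using S_meas by (subst distr_distr) (auto simp: comp_def Y_def exp_sum)
  moreover have "distr \<rho>1 borel exp = distr M borel (exp_functional \<xi>)"
    by (rule exp_functional_law) (use \<rho>1 moment_pos in \<open>auto simp: less_imp_le\<close>)
  ultimately have prod: "distr N borel (\<lambda>\<omega>. \<Prod>i<n. Y i \<omega>) = distr M borel (exp_functional \<xi>)" by simp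
  have "N.indep_vars (\<lambda>_. borel) Y {..<n}"
    unfolding Y_def[abs_def] using iid(4) by (rule N.indep_vars_compose2[where Y="\<lambda>_. exp"]) simp
  then show "\<exists>(N :: (nat \<Rightarrow> real) measure) (Y :: nat \<Rightarrow> (nat \<Rightarrow> real) \<Rightarrow> real).
      prob_space N \<and> (\<forall>i<n. Y i \<in> borel_measurable N \<and> (AE \<omega> in N. Y i \<omega> > 0)) \<and>
      prob_space.indep_vars N (\<lambda>_. borel) Y {..<n} \<and>
      (\<forall>i<n. distr N borel (Y i) = distr N borel (Y 0)) \<and>
      distr N borel (\<lambda>\<omega>. \<Prod>i<n. Y i \<omega>) = distr M borel (exp_functional \<xi>)"
    using iid(1) Y_meas Y_distr n0 prod by (intro exI[of _ N] exI[of _ Y]) (auto simp: Y_def)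
qed

end

context subordinator_kappa
begin

lemma kappa_le_imp_density:
  assumes le: "\<And>A. A \<in> sets borel \<Longrightarrow> emeasure \<kappa> A \<le> emeasure lborel A"
  shows "\<exists>k::real \<Rightarrow> real. k \<in> borel_measurable borel \<and> (\<forall>x. 0 \<le> k x) \<and> \<kappa> = density lborel (\<lambda>x. ennreal (k x))"
proof -
  have "absolutely_continuous lborel \<kappa>"
    unfolding absolutely_continuous_def
  proof
    fix A :: "real set" assume "A \<in> null_sets lborel"
    then show "A \<in> null_sets \<kappa>" using le[of A] by (auto simp: null_sets_def kappa_sets)
  qed
  then obtain f where f[measurable]: "f \<in> borel_measurable lborel" and f_density: "density lborel f = \<kappa>"
    using sigma_finite_measure.Radon_Nikodym[OF sigma_finite_lborel, of \<kappa>] by (auto simp: kappa_sets)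
  \<comment> \<open>The Radon-Nikodym derivative is \<open>ennreal\<close>-valued; this bound makes
    it finite almost everywhere, so a real version is available.\<close>
  have "AE x in lborel. f x \<le> 1"
    by (rule density_le_lborel_imp_AE_le_1) (use le f_density in auto)
  then have "AE x in lborel. f x = ennreal (enn2real (f x))"
  proof eventually_elim
    case (elim x)
    then show ?case by (cases "f x") (auto simp: top_unique)
  qed
  then have "density lborel f = density lborel (\<lambda>x. ennreal (enn2real (f x)))"
    by (intro density_cong) auto
  then show ?thesis using f_density by (intro exI[of _ "\<lambda>x. enn2real (f x)"]) auto
qed

lemma kappa_densityI:
  assumes le: "\<And>A. A \<in> sets borel \<Longrightarrow> emeasure \<kappa> A \<le> emeasure lborel A"
    and k: "k \<in> borel_measurable borel" "\<And>x. 0 \<le> k x" "\<kappa> = density lborel (\<lambda>x. ennreal (k x))"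
  shows "kappa_density M \<xi> \<kappa> k"
proof unfold_locales
  have "AE x in lborel. ennreal (k x) \<le> 1"
    by (rule density_le_lborel_imp_AE_le_1) (use le k in auto)
  then show "AE x in lborel. k x \<le> 1"
    by eventually_elim simp
qed (use k in auto)

end

theorem theorem3p3:
  fixes M :: "'a measure" and \<xi> :: "real \<Rightarrow> 'a \<Rightarrow> real" and \<kappa> :: "real measure"
  assumes sub: "subordinator M \<xi>"
    and nonzero: "\<exists>s>0. laplace_exponent M \<xi> s \<noteq> 0"
    and kappa_sets: "sets \<kappa> = sets borel"
    and kappa_supp: "emeasure \<kappa> {..<0} = 0"
    and kappa_laplace: "\<forall>s>0. (\<integral>\<^sup>+x. ennreal (exp (- s * x)) \<partial>\<kappa>)
                 = ennreal (deriv (laplace_exponent M \<xi>) s / laplace_exponent M \<xi> s)"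
  shows "(mult_inf_div M (exp_functional \<xi>) \<longleftrightarrow>
            (\<forall>A\<in>sets borel. A \<subseteq> {0..} \<longrightarrow> emeasure \<kappa> A \<le> emeasure lborel A))
       \<and> (mult_inf_div M (exp_functional \<xi>) \<longrightarrow>
            (\<exists>k::real \<Rightarrow> real. k \<in> borel_measurable borel \<and> (\<forall>x. 0 \<le> k x) \<and>
                 \<kappa> = density lborel (\<lambda>x. ennreal (k x))) \<and>
            (\<forall>k::real \<Rightarrow> real. k \<in> borel_measurable borel \<longrightarrow> (\<forall>x. 0 \<le> k x) \<longrightarrow>
                 \<kappa> = density lborel (\<lambda>x. ennreal (k x)) \<longrightarrow>
                 levy_measure_of (distr M borel (\<lambda>\<omega>. ln (exp_functional \<xi> \<omega>)))
                   (density lborel (\<lambda>x. ennreal (indicator {..<0} x * (1 / x)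
                        * (1 / (1 - exp (- x))) * (1 - k (- x)))))))"
proof -
  have "prob_space M" using sub by (simp add: subordinator_def)
  then interpret subordinator_kappa M \<xi> \<kappa>
    using sub nonzero kappa_sets kappa_supp kappa_laplace
    by (intro subordinator_kappa.intro nonzero_subordinator.intro subordinator_process.intro
        subordinator_process_axioms.intro nonzero_subordinator_axioms.intro subordinator_kappa_axioms.intro)
  \<comment> \<open>The statement compares the measures on the half line only; \<kappa> has no mass
    outside it.\<close>
  have le_UNIV: "emeasure \<kappa> A \<le> emeasure lborel A"
    if le: "\<forall>A\<in>sets borel. A \<subseteq> {0..} \<longrightarrow> emeasure \<kappa> A \<le> emeasure lborel A" and A: "A \<in> sets borel" for A
  proof -
    have "emeasure \<kappa> A = emeasure \<kappa> (A \<inter> {0..})"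
      using kappa_AE_nonneg A by (intro emeasure_eq_AE) (auto simp: kappa_sets)
    also have "\<dots> \<le> emeasure lborel (A \<inter> {0..})" using le A by auto
    also have "\<dots> \<le> emeasure lborel A" using A by (intro emeasure_mono) auto
    finally show ?thesis .
  qed
  have backward: "mult_inf_div M (exp_functional \<xi>)"
    if le: "\<forall>A\<in>sets borel. A \<subseteq> {0..} \<longrightarrow> emeasure \<kappa> A \<le> emeasure lborel A"
  proof -
    obtain k where "k \<in> borel_measurable borel" "\<forall>x. 0 \<le> k x" "\<kappa> = density lborel (\<lambda>x. ennreal (k x))"
      using kappa_le_imp_density[OF le_UNIV[OF le]] by blast
    then interpret kappa_density M \<xi> \<kappa> k
      by (intro kappa_densityI le_UNIV[OF le]) auto
    show ?thesis by (rule mult_inf_div_exp_functional)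
  qed
  have levy: "levy_measure_of (distr M borel (\<lambda>\<omega>. ln (exp_functional \<xi> \<omega>)))
       (density lborel (\<lambda>x. ennreal (indicator {..<0} x * (1 / x) * (1 / (1 - exp (- x))) * (1 - k (- x)))))"
    if mid: "mult_inf_div M (exp_functional \<xi>)" and k: "k \<in> borel_measurable borel" "\<forall>x. 0 \<le> k x"
      "\<kappa> = density lborel (\<lambda>x. ennreal (k x))" for k :: "real \<Rightarrow> real"
  proof -
    interpret kappa_density M \<xi> \<kappa> k
      using k by (intro kappa_densityI mult_inf_div_imp_kappa_le[OF mid]) auto
    \<comment> \<open>\<open>ennreal\<close> sends negative reals to 0, so the two densities agree
      at every point, including where k exceeds 1.\<close>
    have "ennreal (levy_density k x) = ennreal (indicator {..<0} x * (1 / x) * (1 / (1 - exp (- x))) * (1 - k (- x)))" for x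
      unfolding levy_density_def by (rule ennreal_max_0)
    with levy_measure_exp_functional show ?thesis by (simp only:)
  qed
  show ?thesis
    using backward levy mult_inf_div_imp_kappa_le kappa_le_imp_density by blast
qed

end
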